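(* Let $\mu$ be a non-atomic self-similar measure supported on an interval $J\subseteq\mathbb{R}$, and let $k\ge 2$ be an integer. Then there exists a constant $\tau=\tau(\mu,k)>0$, depending only on $\mu$ and $k$, such that the following holds. Let $g\in C^k(J)$ be a real-valued function such that for some $c_0>0$, $\max_{2\le j\le k}|g^{(j)}(x)|\ge c_0$ for every $x\in J$. Then there exists a constant $C=C(g)>0$ such that $$\left|\int_J e^{2\pi i g(x)\lambda}\,d\mu(x)\right|\le C\,\lambda^{-\tau}\quad\text{for all }\lambda>0.$$
   Context: A self-similar IFS is a finite set $\Phi=\{f_1,\dots,f_n\}$ of maps $f_i(x)=r_i x+t_i$ with $r_i\in(-1,1)\setminus\{0\}$, $t_i\in\mathbb{R}$, each mapping some fixed compact interval into itself. Standing assumption: there exist $i\ne j$ such that the fixed points of $f_i$ and $f_j$ differ. Given a strictly positive probability vector $\mathbf{p}=(p_1,\dots,p_n)$ ($p_i>0$ for all $i$, $\sum_i p_i=1$), the associated self-similar measure is the unique Borel probability measure $\mu$ on $\mathbb{R}$ with $\mu=\sum_{i=1}^n p_i\, f_i\mu$, where $f_i\mu$ denotes the push-forward of $\mu$ under $f_i$. Under the standing assumption $\mu$ is non-atomic. The constant $C$ may depend on $g$ (and on the fixed data $\mu,k$), while $\tau$ is uniform across all such $g$. *)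

theory Defs
  imports "HOL-Analysis.Analysis" "HOL-Probability.Probability"
begin

text \<open>
  An IFS is indexed by \<open>{..<n}\<close>; the maps are not required to be pairwise distinct. Coinciding
  maps can be merged by adding their weights, so the class of self-similar measures is the same.
  The last conjunct is the standing assumption that two of the maps have different fixed points.
\<close>

definition sim_map :: "real \<Rightarrow> real \<Rightarrow> real \<Rightarrow> real" where
  "sim_map r t x = r * x + t"

definition self_similar_IFS :: "nat \<Rightarrow> (nat \<Rightarrow> real) \<Rightarrow> (nat \<Rightarrow> real) \<Rightarrow> bool" where
  "self_similar_IFS n r t \<longleftrightarrow>
     (\<forall>i<n. r i \<in> {-1<..<1} - {0}) \<and>
     (\<exists>a b. a \<le> b \<and> (\<forall>i<n. sim_map (r i) (t i) ` {a..b} \<subseteq> {a..b})) \<and>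
     (\<exists>i<n. \<exists>j<n. \<exists>x y. i \<noteq> j \<and> sim_map (r i) (t i) x = x \<and> sim_map (r j) (t j) y = y \<and> x \<noteq> y)"

definition positive_prob_vector :: "nat \<Rightarrow> (nat \<Rightarrow> real) \<Rightarrow> bool" where
  "positive_prob_vector n p \<longleftrightarrow> (\<forall>i<n. p i > 0) \<and> (\<Sum>i<n. p i) = 1"

text \<open>
  By Hutchinson's theorem the stationarity equation has exactly one solution among Borel
  probability measures, so being a solution identifies the self-similar measure.
\<close>

definition self_similar_measure_of ::
    "nat \<Rightarrow> (nat \<Rightarrow> real) \<Rightarrow> (nat \<Rightarrow> real) \<Rightarrow> (nat \<Rightarrow> real) \<Rightarrow> real measure \<Rightarrow> bool" where
  "self_similar_measure_of n r t p \<mu> \<longleftrightarrow>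
     prob_space \<mu> \<and> sets \<mu> = sets borel \<and>
     (\<forall>A\<in>sets borel.
        measure \<mu> A = (\<Sum>i<n. p i * measure (distr \<mu> borel (sim_map (r i) (t i))) A))"

definition self_similar_measure :: "real measure \<Rightarrow> bool" where
  "self_similar_measure \<mu> \<longleftrightarrow>
     (\<exists>n r t p. self_similar_IFS n r t \<and> positive_prob_vector n p \<and>
                self_similar_measure_of n r t p \<mu>)"

definition non_atomic :: "real measure \<Rightarrow> bool" where
  "non_atomic \<mu> \<longleftrightarrow> (\<forall>x. measure \<mu> {x} = 0)"

definition msupport :: "real measure \<Rightarrow> real set" where
  "msupport \<mu> = {x. \<forall>e>0. measure \<mu> (ball x e) > 0}"

text \<open>
  The derivatives are taken within \<open>J\<close>, hence one-sided at end points that belong to \<open>J\<close>. They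
  are unique, and depend only on the values of \<open>g\<close> on \<open>J\<close>, if \<open>J\<close> is a non-degenerate interval.
\<close>

primrec nth_deriv_within :: "real set \<Rightarrow> nat \<Rightarrow> (real \<Rightarrow> real) \<Rightarrow> real \<Rightarrow> real" where
  "nth_deriv_within J 0 g = g"
| "nth_deriv_within J (Suc j) g = (\<lambda>x. vector_derivative (nth_deriv_within J j g) (at x within J))"

definition C_k_on :: "nat \<Rightarrow> real set \<Rightarrow> (real \<Rightarrow> real) \<Rightarrow> bool" where
  "C_k_on k J g \<longleftrightarrow>
     (\<forall>j<k. nth_deriv_within J j g differentiable_on J) \<and> continuous_on J (nth_deriv_within J k g)"

end

theory Submission
  imports Defs
begin

text \<open>
  Cut \<open>\<mu>\<close> into affine copies of ratio about \<open>\<rho> = s\<^bsup>-2/3\<^esup>\<close> and linearise \<open>g\<close> on each of them: up to an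
  error \<open>O(s \<rho>\<^sup>2)\<close> the integral is an average of values of the Fourier transform of \<open>\<mu>\<close> at
  frequencies \<open>2 \<pi> s r\<^sub>w g'(y\<^sub>w)\<close>. The hypothesis on \<open>g\<close> makes sublevel sets of \<open>g'\<close> small, so by the
  Frostman property of \<open>\<mu>\<close> these frequencies are not concentrated on short intervals (the maps take
  only polylogarithmically many different ratios).

  It remains to see that the Fourier transform is polynomially small on average over every
  such well spread family of frequencies. The compositions of two maps with different fixed points in
  the two orders have the same ratio and different translations, so stationarity gives a recursion
  for the Fourier transform with a factor less than \<open>1\<close> unless the frequency is close to a lattice.
  An Erdos-Kahane argument shows that a family cannot stay close to the lattice at most scales
  unless it is concentrated. Working with a high power of the transform makes the gain factor
  as small as desired, passing to long words makes almost every word contain a gain, and the few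
  words without gain are controlled by raising the concentration to a small power.
\<close>

section \<open>Stationarity for integrals\<close>

text \<open>Only averages of the transform can be used, because pointwise decay may fail: for the
  middle-third Cantor measure the transform does not tend to 0. Uniformity in \<open>g\<close>
  dictates the order of quantifiers. The Frostman exponent, the window length \<open>l\<close> and
  the decay rate of the averages are fixed by the system of maps and \<open>k\<close>;
  \<open>g\<close> enters only through bounds for its first two derivatives, through
  \<open>c0\<close> and through a number of covering intervals, and all of these go into a threshold
  for \<open>s\<close> and into \<open>C\<close>. Frequencies are compared ratio by ratio, since
  words of different ratios can produce the same frequency from different values of
  \<open>g'\<close>. The count of ratios is small because ratios commute: it is polynomial in the
  word length, and the length is logarithmic in \<open>s\<close>. The interval \<open>J\<close> need
  not contain the invariant interval that comes with the maps, so the whole argument runs on the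
  convex hull of the support, which \<open>J\<close> does contain.\<close>

lemma stationary_nn_integral:
  fixes \<mu> :: "real measure" and f :: "'i \<Rightarrow> real \<Rightarrow> real"
  assumes "finite I" "\<And>i. i \<in> I \<Longrightarrow> 0 \<le> p i" "prob_space \<mu>" and sets: "sets \<mu> = sets borel"
    and f: "\<And>i. i \<in> I \<Longrightarrow> f i \<in> borel_measurable borel"
    and st: "\<And>A. A \<in> sets borel \<Longrightarrow> measure \<mu> A = (\<Sum>i\<in>I. p i * measure (distr \<mu> borel (f i)) A)"
    and F: "F \<in> borel_measurable borel"
  shows "(\<integral>\<^sup>+x. F x \<partial>\<mu>) = (\<Sum>i\<in>I. ennreal (p i) * (\<integral>\<^sup>+x. F (f i x) \<partial>\<mu>))"
proof -
  interpret prob_space \<mu> by fact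
  have sp: "space \<mu> = UNIV" using sets_eq_imp_space_eq[OF sets] by simp
  have fm [measurable]: "f i \<in> measurable \<mu> borel" if "i \<in> I" for i
    using f[OF that] measurable_cong_sets[OF sets refl] by auto
  have mb: "u \<in> borel_measurable borel \<Longrightarrow> u \<in> borel_measurable \<mu>" for u :: "real \<Rightarrow> ennreal"
    using measurable_cong_sets[OF sets refl, of borel] by auto
  have mbf: "(\<lambda>x. u (f i x)) \<in> borel_measurable \<mu>"
    if "u \<in> borel_measurable borel" "i \<in> I" for u :: "real \<Rightarrow> ennreal" and i
    using measurable_compose[OF fm[OF that(2)] that(1)] by simp
  show ?thesis
    using F
  proof (induct rule: borel_measurable_induct)
    case (cong f g)
    then show ?case by simp
  next
    case (set A)
    have "(\<integral>\<^sup>+x. indicator A x \<partial>\<mu>) = ennreal (measure \<mu> A)"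
      using set sets by (simp add: emeasure_eq_measure)
    also have "\<dots> = (\<Sum>i\<in>I. ennreal (p i * measure (distr \<mu> borel (f i)) A))"
      using st[OF set] assms(2) by (simp add: sum_nonneg flip: sum_ennreal)
    also have "\<dots> = (\<Sum>i\<in>I. ennreal (p i) * (\<integral>\<^sup>+x. indicator A (f i x) \<partial>\<mu>))"
    proof (rule sum.cong[OF refl])
      fix i assume i: "i \<in> I"
      interpret D: prob_space "distr \<mu> borel (f i)" by (rule prob_space_distr[OF fm[OF i]])
      have "(\<integral>\<^sup>+x. indicator A (f i x) \<partial>\<mu>) = (\<integral>\<^sup>+x. indicator A x \<partial>distr \<mu> borel (f i))"
        using set i fm by (subst nn_integral_distr) auto
      also have "\<dots> = ennreal (measure (distr \<mu> borel (f i)) A)"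
        using set by (simp add: D.emeasure_eq_measure)
      finally show "ennreal (p i * measure (distr \<mu> borel (f i)) A)
          = ennreal (p i) * (\<integral>\<^sup>+x. indicator A (f i x) \<partial>\<mu>)"
        using assms(2)[OF i] by (simp add: ennreal_mult)
    qed
    finally show ?case .
  next
    case (mult u c)
    have "(\<integral>\<^sup>+x. c * u x \<partial>\<mu>) = c * (\<integral>\<^sup>+x. u x \<partial>\<mu>)"
      by (rule nn_integral_cmult[OF mb[OF mult(2)]])
    also have "\<dots> = (\<Sum>i\<in>I. ennreal (p i) * (c * (\<integral>\<^sup>+x. u (f i x) \<partial>\<mu>)))"
      unfolding mult(4) by (simp add: sum_distrib_left mult_ac)
    also have "\<dots> = (\<Sum>i\<in>I. ennreal (p i) * (\<integral>\<^sup>+x. c * u (f i x) \<partial>\<mu>))"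
      by (intro sum.cong refl arg_cong2[where f="(*)"] nn_integral_cmult[symmetric] mbf mult(2))
    finally show ?case .
  next
    case (add u v)
    have "(\<integral>\<^sup>+x. v x + u x \<partial>\<mu>) = (\<integral>\<^sup>+x. v x \<partial>\<mu>) + (\<integral>\<^sup>+x. u x \<partial>\<mu>)"
      by (intro nn_integral_add mb add(1,4))
    also have "\<dots> = (\<Sum>i\<in>I. ennreal (p i) * ((\<integral>\<^sup>+x. v (f i x) \<partial>\<mu>) + (\<integral>\<^sup>+x. u (f i x) \<partial>\<mu>)))"
      unfolding add(3,7) by (simp add: sum.distrib distrib_left)
    also have "\<dots> = (\<Sum>i\<in>I. ennreal (p i) * (\<integral>\<^sup>+x. v (f i x) + u (f i x) \<partial>\<mu>))"
      by (intro sum.cong refl arg_cong2[where f="(*)"] nn_integral_add[symmetric] mbf add(1,4))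
    finally show ?case .
  next
    case (seq U)
    have "(\<integral>\<^sup>+x. (SUP i. U i) x \<partial>\<mu>) = (\<integral>\<^sup>+x. (SUP i. U i x) \<partial>\<mu>)"
      by (simp add: image_image)
    also have "\<dots> = (SUP n. \<integral>\<^sup>+x. U n x \<partial>\<mu>)"
      by (intro nn_integral_monotone_convergence_SUP mb seq(1,4))
    also have "\<dots> = (SUP n. \<Sum>i\<in>I. ennreal (p i) * (\<integral>\<^sup>+x. U n (f i x) \<partial>\<mu>))"
      unfolding seq(3) by simp
    also have "\<dots> = (\<Sum>i\<in>I. SUP n. ennreal (p i) * (\<integral>\<^sup>+x. U n (f i x) \<partial>\<mu>))"
      using seq(4) by (intro ennreal_SUP_sum)
        (auto simp: incseq_def le_fun_def intro!: mult_left_mono nn_integral_mono)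
    also have "\<dots> = (\<Sum>i\<in>I. ennreal (p i) * (SUP n. (\<integral>\<^sup>+x. U n (f i x) \<partial>\<mu>)))"
      by (simp add: SUP_mult_left_ennreal)
    also have "\<dots> = (\<Sum>i\<in>I. ennreal (p i) * (\<integral>\<^sup>+x. (SUP n. U n (f i x)) \<partial>\<mu>))"
    proof (intro sum.cong refl arg_cong2[where f="(*)"] nn_integral_monotone_convergence_SUP[symmetric])
      show "incseq (\<lambda>n x. U n (f i x))" for i using seq(4) by (auto simp: incseq_def le_fun_def)
    qed (use mbf[OF seq(1)] in auto)
    finally show ?case by (simp add: image_image)
  qed
qed

text \<open>The definition of a self-similar measure speaks of sets only, whereas characters call
  for bounded complex functions. Real and imaginary parts are treated separately, after a shift to
  non-negative integrands.\<close>

lemma stationary_integral: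
  fixes \<mu> :: "real measure" and f :: "'i \<Rightarrow> real \<Rightarrow> real" and F :: "real \<Rightarrow> complex"
  assumes "finite I" "\<And>i. i \<in> I \<Longrightarrow> 0 \<le> p i" "prob_space \<mu>" and sets: "sets \<mu> = sets borel"
    and sum: "sum p I = 1"
    and f: "\<And>i. i \<in> I \<Longrightarrow> f i \<in> borel_measurable borel"
    and st: "\<And>A. A \<in> sets borel \<Longrightarrow> measure \<mu> A = (\<Sum>i\<in>I. p i * measure (distr \<mu> borel (f i)) A)"
    and F: "F \<in> borel_measurable borel" and B: "\<And>x. cmod (F x) \<le> B"
  shows "(LINT x|\<mu>. F x) = (\<Sum>i\<in>I. of_real (p i) * (LINT x|\<mu>. F (f i x)))"
proof -
  interpret prob_space \<mu> by fact
  have fm [measurable]: "f i \<in> measurable \<mu> borel" if "i \<in> I" for i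
    using f[OF that] measurable_cong_sets[OF sets refl] by auto
  have mb: "u \<in> borel_measurable borel \<Longrightarrow> u \<in> borel_measurable \<mu>" for u :: "real \<Rightarrow> 'c::topological_space"
    using measurable_cong_sets[OF sets refl, of borel] by auto
  have nonneg: "(LINT x|\<mu>. G x) = (\<Sum>i\<in>I. p i * (LINT x|\<mu>. G (f i x)))"
    if G: "G \<in> borel_measurable borel" "\<And>x. 0 \<le> G x" "\<And>x. G x \<le> B" for G B
  proof -
    have n: "(\<integral>\<^sup>+x. ennreal (G (h x)) \<partial>\<mu>) = ennreal (LINT x|\<mu>. G (h x))"
      if h: "h \<in> measurable \<mu> borel" for h
    proof (rule nn_integral_eq_integral)
      show "integrable \<mu> (\<lambda>x. G (h x))"
        using measurable_compose[OF h G(1)] G by (intro integrable_const_bound[of _ B]) auto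
    qed (use G in auto)
    have G': "(\<lambda>x. ennreal (G x)) \<in> borel_measurable borel" using G by measurable
    have "ennreal (LINT x|\<mu>. G x) = (\<Sum>i\<in>I. ennreal (p i) * ennreal (LINT x|\<mu>. G (f i x)))"
      using stationary_nn_integral[OF assms(1-4) f st G'] n[OF mb[of "\<lambda>x. x"]] n[OF fm]
      by simp
    also have "\<dots> = ennreal (\<Sum>i\<in>I. p i * (LINT x|\<mu>. G (f i x)))"
      using assms(2) G(2) by (subst sum_ennreal[symmetric]) (auto simp: ennreal_mult intro!: sum.cong)
    finally show ?thesis
      using assms(2) G(2) by (subst (asm) ennreal_inj) (auto intro!: sum_nonneg)
  qed
  have real: "(LINT x|\<mu>. G x) = (\<Sum>i\<in>I. p i * (LINT x|\<mu>. G (f i x)))"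
    if G: "G \<in> borel_measurable borel" "\<And>x. \<bar>G x\<bar> \<le> B" for G :: "real \<Rightarrow> real"
  proof -
    have int: "integrable \<mu> (\<lambda>x. G (h x))" if "h \<in> measurable \<mu> borel" for h
      using measurable_compose[OF that G(1)] G by (intro integrable_const_bound[of _ B]) auto
    \<comment> \<open>Adding \<open>B\<close> makes the integrand non-negative; the shift cancels
      afterwards because the weights sum to 1.\<close>
    have n: "(LINT x|\<mu>. G x + B) = (\<Sum>i\<in>I. p i * (LINT x|\<mu>. G (f i x) + B))"
    proof (rule nonneg)
      show "0 \<le> G x + B" "G x + B \<le> 2 * B" for x using G(2)[of x] by auto
    qed (use G in measurable)
    have 1: "(LINT x|\<mu>. G x + B) = (LINT x|\<mu>. G x) + B"
      using int[OF mb[of "\<lambda>x. x"]] by (subst Bochner_Integration.integral_add) (auto simp: prob_space)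
    have 2: "(LINT x|\<mu>. G (f i x) + B) = (LINT x|\<mu>. G (f i x)) + B" if "i \<in> I" for i
      using int[OF fm[OF that]] by (subst Bochner_Integration.integral_add) (auto simp: prob_space)
    have "(\<Sum>i\<in>I. p i * (LINT x|\<mu>. G (f i x) + B)) = (\<Sum>i\<in>I. p i * (LINT x|\<mu>. G (f i x))) + B"
      using 2 sum by (simp add: distrib_left sum.distrib flip: sum_distrib_right)
    with n 1 show ?thesis by simp
  qed
  have int: "integrable \<mu> (\<lambda>x. F (h x))" if "h \<in> measurable \<mu> borel" for h
    using measurable_compose[OF that F] B by (intro integrable_const_bound[of _ B]) auto
  have Re: "(LINT x|\<mu>. Re (F x)) = (\<Sum>i\<in>I. p i * (LINT x|\<mu>. Re (F (f i x))))"
    using F B by (intro real) (auto intro: order_trans[OF abs_Re_le_cmod])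
  have Im: "(LINT x|\<mu>. Im (F x)) = (\<Sum>i\<in>I. p i * (LINT x|\<mu>. Im (F (f i x))))"
    using F B by (intro real) (auto intro: order_trans[OF abs_Im_le_cmod])
  show ?thesis
    using Re Im int[OF mb[of "\<lambda>x. x"]] int[OF fm]
    by (auto simp: complex_eq_iff )
qed

section \<open>Iterated function systems and words\<close>

definition words :: "'i set \<Rightarrow> nat \<Rightarrow> 'i list set" where
  "words I m = {w. set w \<subseteq> I \<and> length w = m}"

definition wprod :: "('i \<Rightarrow> real) \<Rightarrow> 'i list \<Rightarrow> real" where
  "wprod h w = prod_list (map h w)"

text \<open>The map \<open>wprod r w * x + wtrans r t w\<close> is the composition of the maps along
  \<open>w\<close> with the head outermost, so appending a letter refines from inside;
  \<open>wtrans_append\<close> is the composition rule.\<close>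

fun wtrans :: "('i \<Rightarrow> real) \<Rightarrow> ('i \<Rightarrow> real) \<Rightarrow> 'i list \<Rightarrow> real" where
  "wtrans r t [] = 0"
| "wtrans r t (i # w) = r i * wtrans r t w + t i"

lemma wprod_simps [simp]: "wprod h [] = 1" "wprod h (i # w) = h i * wprod h w"
  by (simp_all add: wprod_def)

lemma wprod_append: "wprod h (v @ w) = wprod h v * wprod h w"
  by (simp add: wprod_def)

lemma wtrans_append: "wtrans r t (v @ w) = wprod r v * wtrans r t w + wtrans r t v"
  by (induction v) (auto simp: algebra_simps)

lemma finite_words: "finite I \<Longrightarrow> finite (words I m)"
  unfolding words_def by (rule finite_lists_length_eq)

lemma words_0 [simp]: "words I 0 = {[]}"
  by (auto simp: words_def)

lemma words_Suc: "words I (Suc m) = (\<lambda>(i, w). i # w) ` (I \<times> words I m)"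
  by (auto simp: words_def image_iff length_Suc_conv)

lemma sum_words_Suc:
  "(\<Sum>w\<in>words I (Suc m). F w) = (\<Sum>i\<in>I. \<Sum>w\<in>words I m. F (i # w))"
proof -
  have "inj_on (\<lambda>(i, w). i # w) (I \<times> words I m)" by (auto simp: inj_on_def)
  then show ?thesis
    unfolding words_Suc by (subst sum.reindex) (auto simp: sum.cartesian_product case_prod_unfold)
qed

lemma sum_wprod_words: "(\<Sum>w\<in>words I m. wprod h w) = (\<Sum>i\<in>I. h i) ^ m"
  by (induction m) (simp_all add: sum_words_Suc sum_distrib_right flip: sum_distrib_left)

lemma wprod_abs_bounds:
  assumes "\<And>i. i \<in> I \<Longrightarrow> c \<le> \<bar>h i\<bar> \<and> \<bar>h i\<bar> \<le> d" "0 \<le> c" "w \<in> words I m"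
  shows "c ^ m \<le> \<bar>wprod h w\<bar>" "\<bar>wprod h w\<bar> \<le> d ^ m"
proof -
  have "c ^ length w \<le> \<bar>wprod h w\<bar> \<and> \<bar>wprod h w\<bar> \<le> d ^ length w" if "set w \<subseteq> I" for w
    using that
  proof (induction w)
    case (Cons i w)
    then have "c \<le> \<bar>h i\<bar>" "\<bar>h i\<bar> \<le> d" using assms(1)[of i] by auto
    then show ?case using Cons assms(2) by (auto simp: abs_mult intro: mult_mono)
  qed simp
  with assms(3) show "c ^ m \<le> \<bar>wprod h w\<bar>" "\<bar>wprod h w\<bar> \<le> d ^ m"
    unfolding words_def by auto
qed

text \<open>Angular frequency, without a factor 2 pi; that factor reappears in the phase differences
  and in \<open>N = 2 * pi * s\<close>.\<close>

definition ft :: "real measure \<Rightarrow> real \<Rightarrow> complex" where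
  "ft \<mu> \<xi> = (LINT x|\<mu>. cis (\<xi> * x))"

text \<open>One measure is stationary for many systems: the given maps, all words of a fixed length,
  all words cut at a scale. With an abstract index set every result applies to each of them, over
  the same interval \<open>{a..b}\<close>. Stationarity is assumed in its form for bounded test
  functions, which iterates by substitution.\<close>

locale self_sim = prob_space \<mu> for \<mu> :: "real measure" +
  fixes I :: "'i set" and p r t :: "'i \<Rightarrow> real" and a b :: real
  assumes fin: "finite I"
    and p_pos: "i \<in> I \<Longrightarrow> 0 < p i"
    and p_sum: "sum p I = 1"
    and r_ne: "i \<in> I \<Longrightarrow> r i \<noteq> 0"
    and r_lt: "i \<in> I \<Longrightarrow> \<bar>r i\<bar> < 1"
    and sets_mu: "sets \<mu> = sets borel"
    and ab: "a < b"
    and conc: "AE x in \<mu>. x \<in> {a..b}"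
    and inv: "i \<in> I \<Longrightarrow> x \<in> {a..b} \<Longrightarrow> r i * x + t i \<in> {a..b}"
    and stat: "F \<in> borel_measurable borel \<Longrightarrow> (\<And>x. cmod (F x) \<le> B) \<Longrightarrow>
      (LINT x|\<mu>. F x) = (\<Sum>i\<in>I. of_real (p i) * (LINT x|\<mu>. F (r i * x + t i)))"
begin

lemma space_mu [simp]: "space \<mu> = UNIV"
  using sets_eq_imp_space_eq[OF sets_mu] by simp

lemma borel_measurable_mu: "u \<in> borel_measurable borel \<Longrightarrow> u \<in> borel_measurable \<mu>"
  for u :: "real \<Rightarrow> 'c::topological_space"
  using measurable_cong_sets[OF sets_mu refl, of borel] by auto

lemma I_ne: "I \<noteq> {}"
  using p_sum by auto

lemma ratio_bounds: "\<exists>c d. 0 < c \<and> c \<le> d \<and> d < 1 \<and> (\<forall>i\<in>I. c \<le> \<bar>r i\<bar> \<and> \<bar>r i\<bar> \<le> d)"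
proof (intro exI conjI ballI)
  let ?R = "(\<lambda>i. \<bar>r i\<bar>) ` I"
  have R: "finite ?R" "?R \<noteq> {}" using fin I_ne by auto
  show "0 < Min ?R" using R r_ne by (simp add: Min_gr_iff)
  show "Max ?R < 1" using R r_lt by simp
  show "Min ?R \<le> Max ?R" using R by simp
  show "Min ?R \<le> \<bar>r i\<bar>" "\<bar>r i\<bar> \<le> Max ?R" if "i \<in> I" for i using R that by auto
qed

lemma stat_measure:
  assumes A: "A \<in> sets borel"
  shows "prob A = (\<Sum>i\<in>I. p i * prob {x. r i * x + t i \<in> A})"
proof -
  have m: "{x. r i * x + t i \<in> A} \<in> sets \<mu>" for i
    using A sets_mu by simp
  have "complex_of_real (prob A) = (LINT x|\<mu>. of_real (indicator A x))"
    using A sets_mu by simp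
  also have "\<dots> = (\<Sum>i\<in>I. of_real (p i) * (LINT x|\<mu>. of_real (indicator A (r i * x + t i))))"
    using A by (intro stat[of _ 1]) (auto simp: indicator_def)
  also have "\<dots> = (\<Sum>i\<in>I. of_real (p i) * (LINT x|\<mu>. of_real (indicator {x. r i * x + t i \<in> A} x)))"
    by (simp add: indicator_def)
  also have "\<dots> = of_real (\<Sum>i\<in>I. p i * prob {x. r i * x + t i \<in> A})"
    using m by simp
  finally show ?thesis by (simp only: of_real_eq_iff)
qed

lemma stat_words:
  assumes "F \<in> borel_measurable borel" "\<And>x. cmod (F x) \<le> B"
  shows "(LINT x|\<mu>. F x)
    = (\<Sum>w\<in>words I m. of_real (wprod p w) * (LINT x|\<mu>. F (wprod r w * x + wtrans r t w)))"
  using assms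
proof (induction m arbitrary: F)
  case (Suc m)
  have "(LINT x|\<mu>. F x) = (\<Sum>i\<in>I. of_real (p i) * (LINT x|\<mu>. F (r i * x + t i)))"
    by (rule stat[OF Suc.prems])
  also have "\<dots> = (\<Sum>i\<in>I. of_real (p i) * (\<Sum>w\<in>words I m. of_real (wprod p w) *
      (LINT x|\<mu>. F (r i * (wprod r w * x + wtrans r t w) + t i))))"
    using Suc.prems by (intro sum.cong refl arg_cong2[where f="(*)"] Suc.IH) auto
  finally show ?case
    by (simp add: sum_words_Suc sum_distrib_left algebra_simps)
qed simp

lemma inv_words:
  assumes "set w \<subseteq> I" "x \<in> {a..b}"
  shows "wprod r w * x + wtrans r t w \<in> {a..b}"
  using assms(1)
proof (induction w)
  case (Cons i w)
  then have "r i * (wprod r w * x + wtrans r t w) + t i \<in> {a..b}" by (intro inv) auto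
  then show ?case by (simp add: algebra_simps)
qed (use assms in simp)

lemma wprod_p_pos: "set w \<subseteq> I \<Longrightarrow> 0 < wprod p w"
  by (induction w) (auto simp: p_pos)

text \<open>Iterated stationarity turns words into symbols; positive length is what keeps their
  ratios strictly below 1.\<close>

lemma words_self_sim:
  assumes "m > 0"
  shows "self_sim \<mu> (words I m) (wprod p) (wprod r) (wtrans r t) a b"
proof
  obtain c d where cd: "0 < c" "c \<le> d" "d < 1" "\<And>i. i \<in> I \<Longrightarrow> c \<le> \<bar>r i\<bar> \<and> \<bar>r i\<bar> \<le> d"
    using ratio_bounds by auto
  show "sum (wprod p) (words I m) = 1" by (simp add: sum_wprod_words p_sum)
  fix w assume w: "w \<in> words I m"
  show "0 < wprod p w" using w wprod_p_pos by (auto simp: words_def)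
  have "0 < c ^ m" using cd by simp
  then show "wprod r w \<noteq> 0" using wprod_abs_bounds(1)[where h=r, OF cd(4) _ w] cd(1)
    by (metis abs_zero less_eq_real_def not_le)
  have "d ^ m < 1" using cd assms by (simp add: power_less_one_iff)
  then show "\<bar>wprod r w\<bar> < 1" using wprod_abs_bounds(2)[where h=r, OF cd(4) _ w] cd(1) by auto
  show "wprod r w * x + wtrans r t w \<in> {a..b}" if "x \<in> {a..b}" for x
    using w that by (intro inv_words) (auto simp: words_def)
next
  fix F :: "real \<Rightarrow> complex" and B assume F: "F \<in> borel_measurable borel" "\<And>x. cmod (F x) \<le> B"
  show "(LINT x|\<mu>. F x)
    = (\<Sum>w\<in>words I m. of_real (wprod p w) * (LINT x|\<mu>. F (wprod r w * x + wtrans r t w)))"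
    by (rule stat_words[OF F])
qed (use fin finite_words sets_mu ab conc in auto)

lemma cmod_ft_le: "cmod (ft \<mu> \<xi>) \<le> 1"
proof -
  have "cmod (ft \<mu> \<xi>) \<le> (LINT x|\<mu>. cmod (cis (\<xi> * x)))"
    unfolding ft_def by (rule integral_norm_bound)
  then show ?thesis using prob_space[unfolded space_mu] by simp
qed

lemma ft_stat: "ft \<mu> \<xi> = (\<Sum>i\<in>I. of_real (p i) * cis (\<xi> * t i) * ft \<mu> (r i * \<xi>))"
proof -
  have "ft \<mu> \<xi> = (\<Sum>i\<in>I. of_real (p i) * (LINT x|\<mu>. cis (\<xi> * (r i * x + t i))))"
    unfolding ft_def
    by (intro stat[of _ 1] borel_measurable_continuous_onI continuous_intros) auto
  also have "\<dots> = (\<Sum>i\<in>I. of_real (p i) * cis (\<xi> * t i) * ft \<mu> (r i * \<xi>))"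
  proof (rule sum.cong[OF refl])
    fix i
    have "(LINT x|\<mu>. cis (\<xi> * (r i * x + t i))) = (LINT x|\<mu>. cis (\<xi> * t i) * cis ((r i * \<xi>) * x))"
      by (simp add: cis_mult algebra_simps)
    also have "\<dots> = cis (\<xi> * t i) * ft \<mu> (r i * \<xi>)"
      unfolding ft_def by simp
    finally show "of_real (p i) * (LINT x|\<mu>. cis (\<xi> * (r i * x + t i)))
        = of_real (p i) * cis (\<xi> * t i) * ft \<mu> (r i * \<xi>)" by simp
  qed
  finally show ?thesis .
qed

end

section \<open>The Frostman property\<close>

lemma geometric_scale:
  fixes c x :: real
  assumes "0 < c" "c < 1" "0 < x" "x \<le> 1"
  shows "\<exists>n. c ^ Suc n < x \<and> x \<le> c ^ n"
proof -
  obtain n0 where "c ^ n0 < x" using real_arch_pow_inv assms by blast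
  define n where "n = (LEAST n. c ^ n < x)"
  have n: "c ^ n < x" unfolding n_def by (rule LeastI[of _ n0]) fact
  then have "n \<noteq> 0" using assms by (intro notI) simp
  then obtain m where m: "n = Suc m" by (cases n) auto
  have "\<not> c ^ m < x" using not_less_Least[of m "\<lambda>n. c ^ n < x"] m unfolding n_def by simp
  with n m show ?thesis by auto
qed

lemma power_powr_commute: "0 < (c::real) \<Longrightarrow> (c ^ n) powr \<beta> = (c powr \<beta>) ^ n"
  by (induction n) (auto simp: powr_mult)

lemma affine_preimage_interval:
  fixes r t s \<delta> :: real
  assumes "r \<noteq> 0"
  shows "\<exists>s'. {x. r * x + t \<in> {s..s+\<delta>}} \<subseteq> {s'..s' + \<delta> / \<bar>r\<bar>}"
proof (cases "r > 0")
  case True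
  then show ?thesis by (intro exI[of _ "(s - t) / r"]) (auto simp: field_simps)
next
  case False
  with assms have "r < 0" by simp
  have "(s + \<delta> - t) / r \<le> x \<and> x \<le> (s + \<delta> - t) / r + \<delta> / \<bar>r\<bar>" if "r * x + t \<in> {s..s+\<delta>}" for x
  proof -
    have "(s + \<delta> - t) / r \<le> x" "x \<le> (s - t) / r"
      using that \<open>r < 0\<close> by (auto simp: neg_divide_le_eq neg_le_divide_eq mult.commute)
    then show ?thesis using \<open>r < 0\<close> by (simp add: add_divide_distrib diff_divide_distrib)
  qed
  then show ?thesis by (intro exI[of _ "(s + \<delta> - t) / r"]) auto
qed

context self_sim
begin

lemma prob_mono_borel: "A \<subseteq> B \<Longrightarrow> B \<in> sets borel \<Longrightarrow> prob A \<le> prob B"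
  using sets_mu by (intro finite_measure_mono) auto

text \<open>An interval of length at most \<open>\<delta>0\<close> misses one of the two separated
  images, so a symbol of weight at least \<open>\<eta>\<close> contributes no mass. The other
  symbols pull the interval back to one at most \<open>1 / c\<close> times longer. Iterating, length
  \<open>\<delta>0 * c ^ n\<close> has mass at most \<open>(1 - \<eta>) ^ n\<close>.\<close>

lemma frostman_separated:
  assumes uv: "u \<in> I" "v \<in> I" and "0 < \<delta>0"
    and sep: "\<And>x y. x \<in> {a..b} \<Longrightarrow> y \<in> {a..b} \<Longrightarrow> \<delta>0 < \<bar>(r u * x + t u) - (r v * y + t v)\<bar>"
  shows "\<exists>\<beta>>0. \<exists>C>0. \<forall>s \<delta>. 0 < \<delta> \<longrightarrow> prob {s..s+\<delta>} \<le> C * \<delta> powr \<beta>"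
proof -
  obtain c d where cd: "0 < c" "c \<le> d" "d < 1" "\<And>i. i \<in> I \<Longrightarrow> c \<le> \<bar>r i\<bar> \<and> \<bar>r i\<bar> \<le> d"
    using ratio_bounds by auto
  \<comment> \<open>Half of the smaller weight, so that \<open>1 - \<eta>\<close> is positive and
    has a logarithm.\<close>
  define \<eta> where "\<eta> = min (p u) (p v) / 2"
  have p1: "p i \<le> 1" if "i \<in> I" for i
    using p_sum p_pos that fin member_le_sum[of i I p] by (auto intro: less_imp_le)
  have \<eta>: "0 < \<eta>" "\<eta> < 1" "\<eta> \<le> p u" "\<eta> \<le> p v"
    using p_pos[OF uv(1)] p_pos[OF uv(2)] p1[OF uv(1)] unfolding \<eta>_def by auto
  have null: "prob {x. r w * x + t w \<in> A} = 0"
    if "A \<in> sets borel" and dj: "\<And>x. x \<in> {a..b} \<Longrightarrow> r w * x + t w \<notin> A" for w A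
  proof -
    have "AE x in \<mu>. x \<notin> {x. r w * x + t w \<in> A}"
      using conc by eventually_elim (use dj in auto)
    moreover have "{x. r w * x + t w \<in> A} \<in> sets \<mu>" using that(1) sets_mu by simp
    ultimately show ?thesis by (subst prob_eq_0) auto
  qed
  have decay: "prob {s..s+\<delta>} \<le> (1 - \<eta>) ^ n" if "\<delta> \<le> \<delta>0 * c ^ n" for s \<delta> n
    using that
  proof (induction n arbitrary: s \<delta>)
    case (Suc n)
    let ?A = "{s..s+\<delta>}"
    have "c ^ Suc n \<le> 1" using cd by (intro power_le_one) auto
    then have \<delta>: "\<delta> \<le> \<delta>0"
      using Suc.prems \<open>0 < \<delta>0\<close> by (meson mult_left_le less_imp_le order_trans)
    have "(\<forall>x\<in>{a..b}. r u * x + t u \<notin> ?A) \<or> (\<forall>x\<in>{a..b}. r v * x + t v \<notin> ?A)"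
    proof (rule ccontr)
      assume "\<not> ?thesis"
      then obtain x y where "x \<in> {a..b}" "y \<in> {a..b}" "r u * x + t u \<in> ?A" "r v * y + t v \<in> ?A"
        by blast
      with sep[of x y] \<delta> show False by auto
    qed
    then obtain w where w: "w \<in> I" "\<eta> \<le> p w" "\<And>x. x \<in> {a..b} \<Longrightarrow> r w * x + t w \<notin> ?A"
      using uv \<eta> by blast
    have "prob ?A = (\<Sum>i\<in>I. p i * prob {x. r i * x + t i \<in> ?A})"
      by (rule stat_measure) simp
    also have "\<dots> = p w * prob {x. r w * x + t w \<in> ?A} + (\<Sum>i\<in>I-{w}. p i * prob {x. r i * x + t i \<in> ?A})"
      by (rule sum.remove[OF fin w(1)])
    also have "\<dots> = (\<Sum>i\<in>I-{w}. p i * prob {x. r i * x + t i \<in> ?A})"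
      using null[of ?A w] w(3) by simp
    also have "\<dots> \<le> (\<Sum>i\<in>I-{w}. p i * (1 - \<eta>) ^ n)"
    proof (intro sum_mono mult_left_mono)
      fix i assume i: "i \<in> I - {w}"
      obtain s' where s': "{x. r i * x + t i \<in> ?A} \<subseteq> {s'..s' + \<delta> / \<bar>r i\<bar>}"
        using affine_preimage_interval r_ne i by blast
      have "\<delta> / \<bar>r i\<bar> \<le> \<delta>0 * c ^ Suc n / \<bar>r i\<bar>"
        using Suc.prems by (intro divide_right_mono) auto
      also have "\<dots> \<le> \<delta>0 * c ^ n"
      proof -
        have "c / \<bar>r i\<bar> \<le> 1" using cd(1) cd(4)[of i] i r_ne by (simp add: divide_le_eq)
        then have "(\<delta>0 * c ^ n) * (c / \<bar>r i\<bar>) \<le> \<delta>0 * c ^ n"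
          using cd(1) \<open>0 < \<delta>0\<close> by (intro mult_left_le) auto
        then show ?thesis by (simp add: mult_ac)
      qed
      finally have "prob {s'..s' + \<delta> / \<bar>r i\<bar>} \<le> (1 - \<eta>) ^ n" by (rule Suc.IH)
      with prob_mono_borel[OF s'] show "prob {x. r i * x + t i \<in> ?A} \<le> (1 - \<eta>) ^ n" by simp
      show "0 \<le> p i" using p_pos i by (auto intro: less_imp_le)
    qed
    also have "\<dots> = (1 - p w) * (1 - \<eta>) ^ n"
      using p_sum sum.remove[OF fin w(1), of p] by (simp flip: sum_distrib_right)
    also have "\<dots> \<le> (1 - \<eta>) ^ Suc n" using w(2) \<eta> by (simp add: mult_right_mono)
    finally show ?case .
  qed simp
  \<comment> \<open>Solves \<open>c powr \<beta> = 1 - \<eta>\<close>: a factor \<open>c\<close> in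
    length buys a factor \<open>1 - \<eta>\<close> in mass.\<close>
  define \<beta> where "\<beta> = ln (1 - \<eta>) / ln c"
  have \<beta>: "0 < \<beta>" unfolding \<beta>_def using \<eta> cd by (simp add: divide_neg_neg)
  have c\<beta>: "c powr \<beta> = 1 - \<eta>" unfolding powr_def \<beta>_def using cd \<eta> by simp
  \<comment> \<open>The factor \<open>\<delta>0 powr \<beta>\<close> normalises the length, and
    \<open>1 - \<eta>\<close> pays for rounding to a scale \<open>c ^ n\<close>. Beyond
    \<open>\<delta>0\<close> the resulting bound exceeds the trivial bound 1.\<close>
  define C where "C = 1 / (\<delta>0 powr \<beta> * (1 - \<eta>))"
  have C: "0 < C" unfolding C_def using \<eta> \<open>0 < \<delta>0\<close> by simp
  have "prob {s..s+\<delta>} \<le> C * \<delta> powr \<beta>" if \<delta>_pos: "0 < \<delta>" for s \<delta>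
  proof (cases "\<delta> \<le> \<delta>0")
    case True
    obtain n where n: "c ^ Suc n < \<delta> / \<delta>0" "\<delta> / \<delta>0 \<le> c ^ n"
      using geometric_scale[of c "\<delta> / \<delta>0"] cd True \<delta>_pos \<open>0 < \<delta>0\<close> by (auto simp: divide_le_eq)
    have "prob {s..s+\<delta>} \<le> (1 - \<eta>) ^ n"
      using n(2) \<open>0 < \<delta>0\<close> by (intro decay) (simp add: divide_le_eq mult.commute)
    also have "(1 - \<eta>) * (1 - \<eta>) ^ n = (c ^ Suc n) powr \<beta>"
      using power_powr_commute[of c "Suc n" \<beta>] cd c\<beta> by simp
    then have "(1 - \<eta>) ^ n = (c ^ Suc n) powr \<beta> / (1 - \<eta>)" using \<eta> by (simp add: field_simps)
    also have "\<dots> \<le> (\<delta> / \<delta>0) powr \<beta> / (1 - \<eta>)"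
      using n(1) cd \<eta> \<beta> by (intro divide_right_mono powr_mono2) auto
    also have "\<dots> = C * \<delta> powr \<beta>"
      unfolding C_def using that \<open>0 < \<delta>0\<close> by (simp add: powr_divide)
    finally show ?thesis .
  next
    case False
    have "prob {s..s+\<delta>} \<le> 1" by simp
    also have "1 \<le> C * \<delta>0 powr \<beta>" unfolding C_def using \<eta> \<open>0 < \<delta>0\<close> by (simp add: field_simps)
    also have "\<dots> \<le> C * \<delta> powr \<beta>"
      using C False \<beta> \<open>0 < \<delta>0\<close> by (intro mult_left_mono powr_mono2) auto
    finally show ?thesis .
  qed
  with \<beta> C show ?thesis by blast
qed

lemma replicate_word_affine:
  assumes "r i * x + t i = x"
  shows "wprod r (replicate m i) * z + wtrans r t (replicate m i) = x + r i ^ m * (z - x)"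
proof (induction m)
  case (Suc m)
  have "wprod r (replicate (Suc m) i) * z + wtrans r t (replicate (Suc m) i)
      = r i * (wprod r (replicate m i) * z + wtrans r t (replicate m i)) + t i"
    by (simp add: algebra_simps)
  also have "\<dots> = (r i * x + t i) + r i ^ Suc m * (z - x)"
    unfolding Suc by (simp add: algebra_simps)
  finally show ?case using assms by simp
qed simp

text \<open>High powers of two maps with different fixed points send \<open>{a..b}\<close> close to
  these points, hence to separated sets. Words of a suitable length \<open>m\<close> thus fall under
  \<open>frostman_separated\<close>.\<close>

lemma frostman:
  assumes ij: "i \<in> I" "j \<in> I" and x: "r i * x + t i = x" and y: "r j * y + t j = y" and "x \<noteq> y"
  shows "\<exists>\<beta>>0. \<exists>C>0. \<forall>s \<delta>. 0 < \<delta> \<longrightarrow> prob {s..s+\<delta>} \<le> C * \<delta> powr \<beta>"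
proof -
  define K where "K = \<bar>a\<bar> + \<bar>b\<bar> + \<bar>x\<bar> + \<bar>y\<bar> + 1"
  have "K > 0" unfolding K_def by simp
  have "(\<lambda>m. \<bar>r l\<bar> ^ m * K) \<longlonglongrightarrow> 0" if "l \<in> I" for l
    using r_lt[OF that] by (intro tendsto_mult_left_zero LIMSEQ_realpow_zero) auto
  then have "(\<lambda>m. \<bar>r i\<bar> ^ m * K + \<bar>r j\<bar> ^ m * K) \<longlonglongrightarrow> 0"
    using ij by (intro tendsto_add_zero) auto
  then have "\<forall>\<^sub>F m in sequentially. \<bar>r i\<bar> ^ m * K + \<bar>r j\<bar> ^ m * K < \<bar>x - y\<bar> / 2"
    using \<open>x \<noteq> y\<close> by (intro order_tendstoD(2)) auto
  then have "\<forall>\<^sub>F m in sequentially. \<bar>r i\<bar> ^ m * K + \<bar>r j\<bar> ^ m * K < \<bar>x - y\<bar> / 2 \<and> 0 < m"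
    using eventually_gt_at_top[of 0] by eventually_elim auto
  then obtain m where m: "\<bar>r i\<bar> ^ m * K + \<bar>r j\<bar> ^ m * K < \<bar>x - y\<bar> / 2" "0 < m"
    by (auto simp: eventually_sequentially)
  interpret W: self_sim \<mu> "words I m" "wprod p" "wprod r" "wtrans r t" a b
    by (rule words_self_sim[OF m(2)])
  show ?thesis
  proof (rule W.frostman_separated)
    show "replicate m i \<in> words I m" "replicate m j \<in> words I m" using ij by (auto simp: words_def)
    show "0 < \<bar>x - y\<bar> / 2" using \<open>x \<noteq> y\<close> by simp
    fix u v assume uv: "u \<in> {a..b}" "v \<in> {a..b}"
    have "\<bar>u - x\<bar> \<le> K" "\<bar>v - y\<bar> \<le> K" unfolding K_def using uv by auto
    then have "\<bar>r i ^ m * (u - x)\<bar> \<le> \<bar>r i\<bar> ^ m * K" "\<bar>r j ^ m * (v - y)\<bar> \<le> \<bar>r j\<bar> ^ m * K"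
      by (auto simp: abs_mult power_abs intro!: mult_left_mono)
    with m(1) have "\<bar>r i ^ m * (u - x)\<bar> + \<bar>r j ^ m * (v - y)\<bar> < \<bar>x - y\<bar> / 2" by simp
    moreover have "\<bar>x - y\<bar> / 2 < \<bar>x + P - (y + Q)\<bar>" if "\<bar>P\<bar> + \<bar>Q\<bar> < \<bar>x - y\<bar> / 2" for P Q
      using that by (auto simp: abs_if split: if_splits)
    ultimately show "\<bar>x - y\<bar> / 2 < \<bar>wprod r (replicate m i) * u + wtrans r t (replicate m i) -
        (wprod r (replicate m j) * v + wtrans r t (replicate m j))\<bar>"
      unfolding replicate_word_affine[of i x, OF x] replicate_word_affine[of j y, OF y] by blast
  qed
qed

end

section \<open>Concentration of families of frequencies\<close>

text \<open>A bound for the Levy concentration function of the discrete measure with mass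
  \<open>v k\<close> at \<open>x k\<close>, at the window length \<open>l\<close>. Stating it by
  subfamilies lets the recursion change \<open>v\<close> and \<open>x\<close> while \<open>K\<close>
  stays the same.\<close>

definition conc_bound :: "real \<Rightarrow> 'k set \<Rightarrow> ('k \<Rightarrow> real) \<Rightarrow> ('k \<Rightarrow> real) \<Rightarrow> real \<Rightarrow> bool" where
  "conc_bound l K v x \<kappa> \<longleftrightarrow>
    (\<forall>K'\<subseteq>K. (\<forall>k\<in>K'. \<forall>k'\<in>K'. \<bar>x k - x k'\<bar> \<le> l) \<longrightarrow> sum v K' \<le> \<kappa>)"

lemma conc_boundD:
  "conc_bound l K v x \<kappa> \<Longrightarrow> K' \<subseteq> K \<Longrightarrow> (\<And>k k'. k \<in> K' \<Longrightarrow> k' \<in> K' \<Longrightarrow> \<bar>x k - x k'\<bar> \<le> l) \<Longrightarrow> sum v K' \<le> \<kappa>"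
  unfolding conc_bound_def by blast

lemma conc_bound_nonneg: "conc_bound l K v x \<kappa> \<Longrightarrow> 0 \<le> \<kappa>"
  using conc_boundD[of l K v x \<kappa> "{}"] by simp

text \<open>Pigeonhole: cells of length \<open>l\<close> are counted from the smallest frequency.
  The extra cell in \<open>R + 1\<close> is for a point at distance exactly
  \<open>l * R\<close>.\<close>

lemma conc_bound_split:
  fixes R :: nat and v x :: "'k \<Rightarrow> real" and l \<kappa> :: real
  assumes cb: "conc_bound l K v x \<kappa>" and "finite K" "0 < l" and K': "K' \<subseteq> K"
    and diam: "\<And>k k'. k \<in> K' \<Longrightarrow> k' \<in> K' \<Longrightarrow> \<bar>x k - x k'\<bar> \<le> l * real R"
  shows "sum v K' \<le> (real R + 1) * \<kappa>"
proof (cases "K' = {}")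
  case True
  then show ?thesis using conc_bound_nonneg[OF cb] by simp
next
  case False
  have fin: "finite K'" using K' \<open>finite K\<close> finite_subset by blast
  define y where "y = Min (x ` K')"
  have "y \<in> x ` K'" unfolding y_def using fin False by (intro Min_in) auto
  then obtain k0 where k0: "k0 \<in> K'" "y = x k0" by auto
  have y: "y \<le> x k" if "k \<in> K'" for k unfolding y_def using fin that by simp
  define f where "f k = nat \<lfloor>(x k - y) / l\<rfloor>" for k
  have f: "f k \<in> {..R}" if k: "k \<in> K'" for k
  proof -
    have "(x k - y) / l \<le> R"
      using diam[OF k k0(1)] k0 \<open>0 < l\<close> by (simp add: divide_le_eq mult.commute)
    then have "\<lfloor>(x k - y) / l\<rfloor> \<le> int R" by linarith
    then show ?thesis unfolding f_def by simp
  qed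
  have "sum v K' = (\<Sum>m\<le>R. sum v {k\<in>K'. f k = m})"
    using fin f by (intro sum.group[symmetric]) auto
  also have "\<dots> \<le> (\<Sum>m\<le>R. \<kappa>)"
  proof (rule sum_mono, rule conc_boundD[OF cb])
    fix m k k' assume k: "k \<in> {k\<in>K'. f k = m}" "k' \<in> {k\<in>K'. f k = m}"
    have "0 \<le> (x k - y) / l" "0 \<le> (x k' - y) / l" using k y \<open>0 < l\<close> by auto
    moreover have "nat \<lfloor>(x k - y) / l\<rfloor> = nat \<lfloor>(x k' - y) / l\<rfloor>" using k unfolding f_def by simp
    ultimately have "\<lfloor>(x k - y) / l\<rfloor> = \<lfloor>(x k' - y) / l\<rfloor>"
      by (metis eq_nat_nat_iff zero_le_floor)
    then have "\<bar>(x k - y) / l - (x k' - y) / l\<bar> \<le> 1" by linarith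
    then have "\<bar>(x k - x k') / l\<bar> \<le> 1" by (simp add: diff_divide_distrib)
    then show "\<bar>x k - x k'\<bar> \<le> l" using \<open>0 < l\<close> by (simp add: divide_le_eq)
  qed (use K' in auto)
  finally show ?thesis by (simp add: add.commute)
qed

text \<open>The price of a word without gain: a window of length \<open>l\<close> for the new
  frequencies pulls back to one of length \<open>l / \<bar>r\<bar>\<close>, which is cut into
  windows of length \<open>l\<close> again.\<close>

lemma conc_bound_step:
  fixes R :: nat and v x :: "'k \<Rightarrow> real" and l \<kappa> :: real
  assumes cb: "conc_bound l K v x \<kappa>" and "finite K" "0 < l" and v: "\<And>k. k \<in> K \<Longrightarrow> 0 \<le> v k"
    and A: "\<And>\<xi>. 0 \<le> A \<xi>" "\<And>\<xi>. A \<xi> \<le> 1" and r: "r \<noteq> 0" "1 / \<bar>r\<bar> \<le> real R"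
  shows "conc_bound l K (\<lambda>k. v k * A (x k)) (\<lambda>k. r * x k) ((real R + 1) * \<kappa>)"
  unfolding conc_bound_def
proof (intro allI impI)
  fix K' assume K': "K' \<subseteq> K" and d: "\<forall>k\<in>K'. \<forall>k'\<in>K'. \<bar>r * x k - r * x k'\<bar> \<le> l"
  have "(\<Sum>k\<in>K'. v k * A (x k)) \<le> sum v K'"
    using K' v A by (intro sum_mono mult_left_le) auto
  also have "\<dots> \<le> (real R + 1) * \<kappa>"
  proof (rule conc_bound_split[OF cb \<open>finite K\<close> \<open>0 < l\<close> K'])
    fix k k' assume "k \<in> K'" "k' \<in> K'"
    then have "\<bar>r\<bar> * \<bar>x k - x k'\<bar> \<le> l" using d by (auto simp: right_diff_distrib simp flip: abs_mult)
    then have "\<bar>x k - x k'\<bar> \<le> l * (1 / \<bar>r\<bar>)" using r by (simp add: field_simps)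
    also have "\<dots> \<le> l * real R" using r \<open>0 < l\<close> by (intro mult_left_mono) auto
    finally show "\<bar>x k - x k'\<bar> \<le> l * real R" .
  qed
  finally show "(\<Sum>k\<in>K'. v k * A (x k)) \<le> (real R + 1) * \<kappa>" .
qed

text \<open>
  The heart of the Erdos-Kahane argument: a set of diameter \<open>l R\<close> on which \<open>D \<xi>\<close> varies by less
  than \<open>1\<close> meets at most one of the short intervals around \<open>(1 / D) \<int>\<close> outside of which the
  factor \<open>A\<close> is small, so pulling back by \<open>r\<close> hardly increases the concentration.
\<close>
lemma conc_bound_step_gain:
  fixes R :: nat and v x :: "'k \<Rightarrow> real" and l \<kappa> r D \<delta> \<gamma> :: real
  assumes cb: "conc_bound l K v x \<kappa>" and "finite K" "0 < l" and v: "\<And>k. k \<in> K \<Longrightarrow> 0 \<le> v k"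
    and A: "\<And>\<xi>. 0 \<le> A \<xi>" "\<And>\<xi>. A \<xi> \<le> 1" and r: "r \<noteq> 0" "1 / \<bar>r\<bar> \<le> real R"
    and gain: "\<And>\<xi>. (\<And>m::int. \<delta> \<le> \<bar>D * \<xi> - m\<bar>) \<Longrightarrow> A \<xi> \<le> \<gamma>"
    and D: "D \<noteq> 0" "\<bar>D\<bar> * (l * real R) \<le> 1 / 2" and \<delta>: "\<delta> \<le> 1 / 4" "2 * \<delta> \<le> l * \<bar>D\<bar>"
    and "0 \<le> \<gamma>"
  shows "conc_bound l K (\<lambda>k. v k * A (x k)) (\<lambda>k. r * x k) ((1 + \<gamma> * (real R + 1)) * \<kappa>)"
  unfolding conc_bound_def
proof (intro allI impI)
  fix K' assume K': "K' \<subseteq> K" and d: "\<forall>k\<in>K'. \<forall>k'\<in>K'. \<bar>r * x k - r * x k'\<bar> \<le> l"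
  have fin: "finite K'" using K' \<open>finite K\<close> finite_subset by blast
  have diam: "\<bar>x k - x k'\<bar> \<le> l * real R" if "k \<in> K'" "k' \<in> K'" for k k'
  proof -
    have "\<bar>r\<bar> * \<bar>x k - x k'\<bar> \<le> l" using d that by (auto simp: right_diff_distrib simp flip: abs_mult)
    then have "\<bar>x k - x k'\<bar> \<le> l * (1 / \<bar>r\<bar>)" using r by (simp add: field_simps)
    also have "\<dots> \<le> l * real R" using r \<open>0 < l\<close> by (intro mult_left_mono) auto
    finally show ?thesis .
  qed
  \<comment> \<open>The indices whose frequency is too close to the lattice for the gain
    hypothesis.\<close>
  define K1 where "K1 = {k\<in>K'. \<exists>m::int. \<bar>D * x k - m\<bar> < \<delta>}"
  have "(\<Sum>k\<in>K1. v k * A (x k)) \<le> sum v K1"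
    using K' v A unfolding K1_def by (intro sum_mono mult_left_le) auto
  also have "\<dots> \<le> \<kappa>"
  proof (rule conc_boundD[OF cb])
    fix k k' assume k: "k \<in> K1" "k' \<in> K1"
    then obtain m m' :: int where m: "\<bar>D * x k - m\<bar> < \<delta>" "\<bar>D * x k' - m'\<bar> < \<delta>"
      unfolding K1_def by blast
    have "\<bar>D * x k - D * x k'\<bar> = \<bar>D\<bar> * \<bar>x k - x k'\<bar>" by (simp add: right_diff_distrib flip: abs_mult)
    also have "\<dots> \<le> \<bar>D\<bar> * (l * real R)" using diam k unfolding K1_def by (intro mult_left_mono) auto
    also have "\<dots> \<le> 1 / 2" by (rule D)
    \<comment> \<open>Variation at most 1/2 plus two errors below 1/4 leave room for a single
      integer. Both phases are then within \<open>\<delta>\<close> of it, and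
      \<open>2 * \<delta> \<le> l * \<bar>D\<bar>\<close> puts \<open>K1\<close> into one window,
      which costs \<open>\<kappa>\<close> without any factor.\<close>
    finally have "\<bar>real_of_int m - real_of_int m'\<bar> < 1" using m \<delta>(1) by linarith
    then have "m = m'" by linarith
    with m have "\<bar>D * x k - D * x k'\<bar> < 2 * \<delta>" by linarith
    also note \<delta>(2)
    also have "\<bar>D * x k - D * x k'\<bar> = \<bar>x k - x k'\<bar> * \<bar>D\<bar>" by (simp add: right_diff_distrib mult.commute flip: abs_mult)
    finally show "\<bar>x k - x k'\<bar> \<le> l" using D(1) by simp
  qed (use K' in \<open>auto simp: K1_def\<close>)
  finally have 1: "(\<Sum>k\<in>K1. v k * A (x k)) \<le> \<kappa>" .
  \<comment> \<open>Away from the lattice the crude pullback loss \<open>R + 1\<close> occurs, but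
    multiplied by \<open>\<gamma>\<close>.\<close>
  have "(\<Sum>k\<in>K'-K1. v k * A (x k)) \<le> (\<Sum>k\<in>K'-K1. v k * \<gamma>)"
    using K' v unfolding K1_def by (intro sum_mono mult_left_mono gain) (auto simp: not_less)
  also have "\<dots> = \<gamma> * sum v (K' - K1)" by (simp add: sum_distrib_left mult.commute)
  also have "\<dots> \<le> \<gamma> * ((real R + 1) * \<kappa>)"
    using K' diam \<open>0 \<le> \<gamma>\<close>
    by (intro mult_left_mono conc_bound_split[OF cb \<open>finite K\<close> \<open>0 < l\<close>]) auto
  finally have 2: "(\<Sum>k\<in>K'-K1. v k * A (x k)) \<le> \<gamma> * ((real R + 1) * \<kappa>)" .
  have "(\<Sum>k\<in>K'. v k * A (x k)) = (\<Sum>k\<in>K'-K1. v k * A (x k)) + (\<Sum>k\<in>K1. v k * A (x k))"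
    by (rule sum.subset_diff) (auto simp: K1_def fin)
  also have "\<dots> \<le> (1 + \<gamma> * (real R + 1)) * \<kappa>" using 1 2 by (simp add: algebra_simps)
  finally show "(\<Sum>k\<in>K'. v k * A (x k)) \<le> (1 + \<gamma> * (real R + 1)) * \<kappa>" .
qed

text \<open>
  Raising the concentration to a small power \<open>s\<close> turns the bound into an average of
  \<open>(growth factor)\<^sup>s\<close>, which is what makes words without gain negligible.
\<close>
lemma decay_iterate:
  fixes M :: "real \<Rightarrow> real" and K :: "'k set" and R :: nat and v x :: "'k \<Rightarrow> real" and l \<kappa> :: real
  assumes M: "\<And>\<xi>. 0 \<le> M \<xi>" "\<And>\<xi>. M \<xi> \<le> 1"
    and rec: "\<And>\<xi>. M \<xi> \<le> (\<Sum>i\<in>I. p i * A i \<xi> * M (r i * \<xi>))"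
    and p: "\<And>i. i \<in> I \<Longrightarrow> 0 \<le> p i"
    and A: "\<And>i \<xi>. i \<in> I \<Longrightarrow> 0 \<le> A i \<xi>" "\<And>i \<xi>. i \<in> I \<Longrightarrow> A i \<xi> \<le> 1"
    and r: "\<And>i. i \<in> I \<Longrightarrow> \<bar>r i\<bar> \<le> d" and "0 < d"
    and G: "\<And>i. i \<in> I \<Longrightarrow> 0 \<le> G i"
    and step: "\<And>i (K::'k set) v x \<kappa>. i \<in> I \<Longrightarrow> finite K \<Longrightarrow> (\<And>k. k \<in> K \<Longrightarrow> 0 \<le> v k) \<Longrightarrow>
      conc_bound l K v x \<kappa> \<Longrightarrow> conc_bound l K (\<lambda>k. v k * A i (x k)) (\<lambda>k. r i * x k) (G i * \<kappa>)"
    and s: "0 < s" "s \<le> 1" and l: "0 < l" "2 \<le> l * real R"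
    and K: "finite K" "\<And>k. k \<in> K \<Longrightarrow> 0 \<le> v k" "sum v K \<le> 1"
      "\<And>k. k \<in> K \<Longrightarrow> \<bar>x k\<bar> \<le> (1 / d) ^ n" "conc_bound l K v x \<kappa>"
  shows "(\<Sum>k\<in>K. v k * M (x k)) \<le> ((real R + 1) * \<kappa>) powr s * (\<Sum>i\<in>I. p i * G i powr s) ^ n"
  using K(2-)
proof (induction n arbitrary: v x \<kappa>)
  case 0
  let ?S = "sum v K"
  have S: "0 \<le> ?S" using 0 by (intro sum_nonneg) auto
  have "(\<Sum>k\<in>K. v k * M (x k)) \<le> ?S"
    using 0 M by (intro sum_mono mult_left_le) auto
  \<comment> \<open>The power \<open>s\<close> enters here, at the end of the recursion: the total
    mass is at most 1 and \<open>s \<le> 1\<close>.\<close>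
  also have "?S \<le> ?S powr s"
  proof (cases "?S = 0")
    case False
    then show ?thesis using S 0 s powr_mono'[of s 1 ?S] by simp
  qed simp
  also have "\<dots> \<le> ((real R + 1) * \<kappa>) powr s"
  proof (rule powr_mono2)
    \<comment> \<open>All frequencies are now in \<open>{-1..1}\<close>, so the family as a whole
      has diameter at most \<open>2 \<le> l * R\<close> and the concentration bounds its total
      mass.\<close>
    show "?S \<le> (real R + 1) * \<kappa>"
    proof (rule conc_bound_split[OF 0(4) K(1) l(1)])
      fix k k' assume "k \<in> K" "k' \<in> K"
      then have "\<bar>x k\<bar> \<le> 1" "\<bar>x k'\<bar> \<le> 1" using 0(3) by auto
      then show "\<bar>x k - x k'\<bar> \<le> l * real R" using l by linarith
    qed simp
  qed (use s S in auto)
  finally show ?case by simp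
next
  case (Suc n)
  let ?E = "(\<Sum>i\<in>I. p i * G i powr s)"
  have \<kappa>: "0 \<le> \<kappa>" using conc_bound_nonneg Suc.prems(4) by blast
  have "(\<Sum>k\<in>K. v k * M (x k)) \<le> (\<Sum>k\<in>K. v k * (\<Sum>i\<in>I. p i * A i (x k) * M (r i * x k)))"
    using Suc.prems(1) rec by (intro sum_mono mult_left_mono) auto
  also have "\<dots> = (\<Sum>i\<in>I. p i * (\<Sum>k\<in>K. (v k * A i (x k)) * M (r i * x k)))"
    unfolding sum_distrib_left by (subst sum.swap) (simp add: mult_ac)
  \<comment> \<open>Each branch \<open>i\<close> continues with its own weights, frequencies and
    concentration \<open>G i * \<kappa>\<close>; hence the induction over arbitrary
    \<open>v\<close>, \<open>x\<close> and \<open>\<kappa>\<close>. The average over branches is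
    taken after the power \<open>s\<close>.\<close>
  also have "\<dots> \<le> (\<Sum>i\<in>I. p i * (((real R + 1) * (G i * \<kappa>)) powr s * ?E ^ n))"
  proof (intro sum_mono mult_left_mono p Suc.IH)
    fix i assume i: "i \<in> I"
    show "conc_bound l K (\<lambda>k. v k * A i (x k)) (\<lambda>k. r i * x k) (G i * \<kappa>)"
      by (rule step[OF i K(1) Suc.prems(1,4)])
    show "0 \<le> v k * A i (x k)" if "k \<in> K" for k using Suc.prems(1) A i that by simp
    have "(\<Sum>k\<in>K. v k * A i (x k)) \<le> sum v K"
      using Suc.prems(1) A i by (intro sum_mono mult_left_le) auto
    then show "(\<Sum>k\<in>K. v k * A i (x k)) \<le> 1" using Suc.prems(2) by simp
    show "\<bar>r i * x k\<bar> \<le> (1 / d) ^ n" if "k \<in> K" for k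
    proof -
      have "\<bar>r i\<bar> * \<bar>x k\<bar> \<le> d * (1 / d) ^ Suc n"
        using r[OF i] Suc.prems(3)[OF that] \<open>0 < d\<close> by (intro mult_mono) auto
      then show ?thesis using \<open>0 < d\<close> by (simp add: abs_mult)
    qed
  qed auto
  also have "\<dots> = (\<Sum>i\<in>I. ((real R + 1) * \<kappa>) powr s * ?E ^ n * (p i * G i powr s))"
  proof (rule sum.cong[OF refl])
    fix i assume i: "i \<in> I"
    have "((real R + 1) * (G i * \<kappa>)) powr s = ((real R + 1) * \<kappa>) powr s * G i powr s"
      using G[OF i] \<kappa> by (subst powr_mult[symmetric]) (auto simp: mult_ac)
    then show "p i * (((real R + 1) * (G i * \<kappa>)) powr s * ?E ^ n)
        = ((real R + 1) * \<kappa>) powr s * ?E ^ n * (p i * G i powr s)" by simp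
  qed
  also have "\<dots> = ((real R + 1) * \<kappa>) powr s * ?E ^ Suc n"
    by (simp only: sum_distrib_left[symmetric]) (simp add: mult_ac)
  finally show ?case .
qed

section \<open>Cancellation between two phases, and its trace along words\<close>

text \<open>Law of cosines: the squared modulus is
  \<open>(p + q)\<^sup>2 - 2 * p * q * (1 - cos (2 * pi * \<theta>))\<close>, and a distance of at
  least \<open>\<delta>\<close> from the integers keeps the cosine away from 1.\<close>

lemma two_phase_gap:
  fixes p q \<delta> :: real
  assumes "0 < p" "0 < q" "0 < \<delta>" "\<delta> \<le> 1 / 2"
  shows "\<exists>\<eta>. 0 \<le> \<eta> \<and> \<eta> < 1 \<and> (\<forall>\<theta>. (\<forall>m::int. \<delta> \<le> \<bar>\<theta> - m\<bar>) \<longrightarrow>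
    cmod (of_real p + of_real q * cis (2 * pi * \<theta>)) / (p + q) \<le> \<eta>)"
proof (intro exI conjI allI impI)
  define S where "S = (p + q)\<^sup>2 - 2 * p * q * (1 - cos (2 * pi * \<delta>))"
  let ?\<eta> = "sqrt S / (p + q)"
  have cos1: "cos (2 * pi * \<delta>) < 1"
    using cos_monotone_0_pi[of 0 "2 * pi * \<delta>"] assms by simp
  have Sle: "S < (p + q)\<^sup>2" unfolding S_def using assms cos1 by simp
  have "p * q * (1 - cos (2 * pi * \<delta>)) \<le> p * q * 2"
    using assms cos_ge_minus_one[of "2 * pi * \<delta>"] by (intro mult_left_mono) (simp_all del: cos_ge_minus_one)
  moreover have "0 \<le> (p - q)\<^sup>2" by simp
  ultimately have S0: "0 \<le> S" unfolding S_def by (simp add: power2_eq_square algebra_simps)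
  show "0 \<le> ?\<eta>" using S0 assms by simp
  have "sqrt S < p + q" using Sle assms real_sqrt_less_mono[OF Sle] by simp
  then show "?\<eta> < 1" using assms by simp
  fix \<theta> assume \<theta>: "\<forall>m::int. \<delta> \<le> \<bar>\<theta> - m\<bar>"
  define u where "u = \<theta> - round \<theta>"
  have u: "\<bar>u\<bar> \<le> 1 / 2" "\<delta> \<le> \<bar>u\<bar>"
    using of_int_round_abs_le[of \<theta>] \<theta> unfolding u_def by (auto simp: abs_minus_commute)
  have "cos (2 * pi * \<theta>) = cos (2 * pi * u + 2 * pi * of_int (round \<theta>))"
    unfolding u_def by (simp add: algebra_simps)
  also have "\<dots> = cos (2 * pi * u)" by (simp add: cos_add cos_int_2pin sin_int_2pin)
  also have "\<dots> = cos (2 * pi * \<bar>u\<bar>)" by (simp add: abs_if)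
  also have "\<dots> \<le> cos (2 * pi * \<delta>)"
    using u assms by (intro cos_monotone_0_pi_le) auto
  finally have c: "cos (2 * pi * \<theta>) \<le> cos (2 * pi * \<delta>)" .
  have expand: "(p + q * c)\<^sup>2 + (q * s)\<^sup>2 = p\<^sup>2 + q\<^sup>2 * (c\<^sup>2 + s\<^sup>2) + 2 * p * q * c" for c s
    by (simp add: power2_eq_square algebra_simps)
  have "(cmod (of_real p + of_real q * cis (2 * pi * \<theta>)))\<^sup>2
      = (p + q * cos (2 * pi * \<theta>))\<^sup>2 + (q * sin (2 * pi * \<theta>))\<^sup>2"
    by (simp add: cmod_power2)
  also have "\<dots> = p\<^sup>2 + q\<^sup>2 * ((cos (2 * pi * \<theta>))\<^sup>2 + (sin (2 * pi * \<theta>))\<^sup>2) + 2 * p * q * cos (2 * pi * \<theta>)"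
    by (rule expand)
  also have "\<dots> \<le> p\<^sup>2 + q\<^sup>2 + 2 * p * q * cos (2 * pi * \<delta>)"
    using c assms by simp
  also have "\<dots> = S" unfolding S_def by (simp add: power2_eq_square algebra_simps)
  finally have "cmod (of_real p + of_real q * cis (2 * pi * \<theta>)) \<le> sqrt S"
    by (simp add: real_le_rsqrt)
  then show "cmod (of_real p + of_real q * cis (2 * pi * \<theta>)) / (p + q) \<le> ?\<eta>"
    using assms by (intro divide_right_mono) auto
qed

text \<open>The transform at \<open>\<xi>\<close> calls itself at \<open>r i * \<xi>\<close>, so the
  factor of a letter is evaluated at the frequency already rescaled by the letters before
  it.\<close>

fun wfactor :: "('i \<Rightarrow> real \<Rightarrow> real) \<Rightarrow> ('i \<Rightarrow> real) \<Rightarrow> 'i list \<Rightarrow> real \<Rightarrow> real" where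
  "wfactor c r [] \<xi> = 1"
| "wfactor c r (i # w) \<xi> = c i \<xi> * wfactor c r w (r i * \<xi>)"

lemma wfactor_bounds:
  assumes "\<And>i \<xi>. 0 \<le> c i \<xi>" "\<And>i \<xi>. c i \<xi> \<le> 1"
  shows "0 \<le> wfactor c r w \<xi>" "wfactor c r w \<xi> \<le> 1"
proof -
  have "0 \<le> wfactor c r w \<xi> \<and> wfactor c r w \<xi> \<le> 1"
    using assms by (induction w arbitrary: \<xi>) (auto intro: mult_le_one)
  then show "0 \<le> wfactor c r w \<xi>" "wfactor c r w \<xi> \<le> 1" by auto
qed

text \<open>Only the first letter from \<open>E\<close> is exploited: the letters before it rescale
  \<open>D\<close> by their ratios, and all other factors are at most 1. The two bounds on
  \<open>D'\<close> make the later choice of window and threshold uniform over words of one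
  length.\<close>

lemma wfactor_gain:
  assumes c: "\<And>i \<xi>. 0 \<le> c i \<xi>" "\<And>i \<xi>. c i \<xi> \<le> 1" and gain: "\<And>i \<xi>. i \<in> E \<Longrightarrow> c i \<xi> \<le> c0 (D * \<xi>)"
    and r: "\<And>i. i \<in> I \<Longrightarrow> e \<le> \<bar>r i\<bar> \<and> \<bar>r i\<bar> \<le> 1" and e: "0 \<le> e" "e \<le> 1"
    and w: "set w \<subseteq> I" "set w \<inter> E \<noteq> {}"
  shows "\<exists>D'. \<bar>D\<bar> * e ^ length w \<le> \<bar>D'\<bar> \<and> \<bar>D'\<bar> \<le> \<bar>D\<bar> \<and> (\<forall>\<xi>. wfactor c r w \<xi> \<le> c0 (D' * \<xi>))"
  using w
proof (induction w)
  case (Cons i w)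
  show ?case
  proof (cases "i \<in> E")
    case True
    have "e ^ length (i # w) \<le> 1" using e by (intro power_le_one) auto
    moreover have "wfactor c r (i # w) \<xi> \<le> c0 (D * \<xi>)" for \<xi>
    proof -
      have "c i \<xi> * wfactor c r w (r i * \<xi>) \<le> c i \<xi>"
        using c wfactor_bounds[of c r w] by (intro mult_left_le) auto
      with gain[OF True, of \<xi>] show ?thesis by simp
    qed
    ultimately show ?thesis by (intro exI[of _ D]) (auto intro: mult_left_le)
  next
    case False
    then obtain D' where D': "\<bar>D\<bar> * e ^ length w \<le> \<bar>D'\<bar>" "\<bar>D'\<bar> \<le> \<bar>D\<bar>"
      "\<And>\<xi>. wfactor c r w \<xi> \<le> c0 (D' * \<xi>)" using Cons by auto
    have ri: "e \<le> \<bar>r i\<bar>" "\<bar>r i\<bar> \<le> 1" using r Cons.prems by auto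
    have "\<bar>D\<bar> * e ^ length (i # w) \<le> \<bar>D' * r i\<bar>"
      using mult_mono[OF D'(1) ri(1)] e by (simp add: abs_mult mult_ac)
    moreover have "\<bar>D' * r i\<bar> \<le> \<bar>D\<bar>"
      using mult_mono[OF D'(2) ri(2)] by (simp add: abs_mult)
    moreover have "wfactor c r (i # w) \<xi> \<le> c0 (D' * r i * \<xi>)" for \<xi>
    proof -
      have "c i \<xi> * wfactor c r w (r i * \<xi>) \<le> wfactor c r w (r i * \<xi>)"
        using c wfactor_bounds[of c r w] by (intro mult_left_le_one_le) auto
      with D'(3)[of "r i * \<xi>"] show ?thesis by (simp add: mult_ac)
    qed
    ultimately show ?thesis by blast
  qed
qed simp

text \<open>Jensen's inequality, used both for the recursion and for the family of
  frequencies.\<close>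

lemma mean_power_le:
  fixes p y :: "'i \<Rightarrow> real"
  assumes "finite I" "\<And>i. i \<in> I \<Longrightarrow> 0 \<le> p i" "sum p I = 1" "even q"
  shows "(\<Sum>i\<in>I. p i * y i) ^ q \<le> (\<Sum>i\<in>I. p i * y i ^ q)"
proof -
  have "I \<noteq> {}" using assms by auto
  then show ?thesis
    using convex_on_sum[OF assms(1) _ convex_power_even[OF assms(4)] assms(3), of y] assms(2) by simp
qed

lemma powr_le_quadratic:
  fixes G s :: real
  assumes "1 \<le> G" "0 \<le> s" "s * ln G \<le> 1"
  shows "G powr s \<le> 1 + s * ln G + (s * ln G)\<^sup>2"
  using exp_bound[of "s * ln G"] assms by (simp add: powr_def)

section \<open>Decay of the Fourier transform on average\<close>

context self_sim
begin

text \<open>With \<open>D = (t h - t g) / (2 * pi)\<close> the phase difference of the two maps is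
  \<open>2 * pi * (D * \<xi>)\<close>; cancellation is absent exactly when \<open>D * \<xi>\<close>
  is an integer.\<close>

definition pair_factor :: "'i \<Rightarrow> 'i \<Rightarrow> 'i \<Rightarrow> real \<Rightarrow> real" where
  "pair_factor g h i \<xi> = (if i \<in> {g, h} then
     cmod (of_real (p g) + of_real (p h) * cis (2 * pi * ((t h - t g) / (2 * pi) * \<xi>))) / (p g + p h) else 1)"

lemma pair_factor_bounds:
  assumes "g \<in> I" "h \<in> I"
  shows "0 \<le> pair_factor g h i \<xi>" "pair_factor g h i \<xi> \<le> 1"
proof -
  have pp: "0 < p g" "0 < p h" using assms p_pos by auto
  then show "0 \<le> pair_factor g h i \<xi>" unfolding pair_factor_def by auto
  have "cmod (of_real (p g) + of_real (p h) * cis \<phi>) \<le> p g + p h" for \<phi>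
    using pp norm_triangle_ineq[of "of_real (p g)" "of_real (p h) * cis \<phi>"] by (simp add: norm_mult)
  then show "pair_factor g h i \<xi> \<le> 1" unfolding pair_factor_def using pp by (simp add: divide_le_eq)
qed

text \<open>Two maps with equal ratio contribute \<open>p g cis (\<xi> t g) + p h cis (\<xi> t h)\<close> to the same term
  \<open>ft \<mu> (r g * \<xi>)\<close>, and cancellation between them is shared out to both symbols.\<close>
lemma ft_pair_rec:
  assumes gh: "g \<in> I" "h \<in> I" "g \<noteq> h" "r g = r h"
  shows "cmod (ft \<mu> \<xi>) \<le> (\<Sum>i\<in>I. p i * pair_factor g h i \<xi> * cmod (ft \<mu> (r i * \<xi>)))"
proof -
  have pp: "0 < p g" "0 < p h" using gh p_pos by auto
  let ?z = "\<lambda>i. of_real (p i) * cis (\<xi> * t i) * ft \<mu> (r i * \<xi>)"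
  let ?f = "\<lambda>i. p i * pair_factor g h i \<xi> * cmod (ft \<mu> (r i * \<xi>))"
  have split: "sum u I = u g + u h + sum u (I - {g, h})" for u :: "'i \<Rightarrow> 'c::comm_monoid_add"
  proof -
    have "sum u I = sum u (I - {g, h}) + sum u {g, h}"
      using gh fin by (intro sum.subset_diff) auto
    also have "sum u {g, h} = u g + u h" using gh(3) by simp
    finally show ?thesis by (simp add: ac_simps)
  qed
  have "cis (\<xi> * t h) = cis (\<xi> * t g) * cis (2 * pi * ((t h - t g) / (2 * pi) * \<xi>))"
  proof -
    have "2 * pi * ((t h - t g) / (2 * pi) * \<xi>) = \<xi> * t h - \<xi> * t g" by (simp add: field_simps)
    then show ?thesis by (simp add: cis_mult)
  qed
  then have "?z g + ?z h = cis (\<xi> * t g) * ft \<mu> (r g * \<xi>) *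
      (of_real (p g) + of_real (p h) * cis (2 * pi * ((t h - t g) / (2 * pi) * \<xi>)))"
    using gh(4) by (simp add: algebra_simps)
  then have "cmod (?z g + ?z h) = cmod (ft \<mu> (r g * \<xi>)) *
      cmod (of_real (p g) + of_real (p h) * cis (2 * pi * ((t h - t g) / (2 * pi) * \<xi>)))"
    by (simp only: norm_mult norm_cis mult_1)
  also have "\<dots> = cmod (ft \<mu> (r g * \<xi>)) * ((p g + p h) * pair_factor g h g \<xi>)"
    unfolding pair_factor_def using pp by simp
  also have "\<dots> = ?f g + ?f h"
  proof -
    have "pair_factor g h h \<xi> = pair_factor g h g \<xi>" by (simp add: pair_factor_def)
    then show ?thesis using gh(4) by (simp add: algebra_simps)
  qed
  finally have 1: "cmod (?z g + ?z h) = ?f g + ?f h" .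
  have 2: "cmod (sum ?z (I - {g, h})) \<le> sum ?f (I - {g, h})"
  proof (rule sum_norm_le)
    fix i assume "i \<in> I - {g, h}"
    then show "cmod (?z i) \<le> ?f i"
      using p_pos[of i] by (simp add: norm_mult pair_factor_def)
  qed
  have "cmod (ft \<mu> \<xi>) = cmod ((?z g + ?z h) + sum ?z (I - {g, h}))"
    unfolding ft_stat[of \<xi>] split[of ?z] ..
  also have "\<dots> \<le> ?f g + ?f h + sum ?f (I - {g, h})"
    using norm_triangle_ineq[of "?z g + ?z h" "sum ?z (I - {g, h})"] 1 2 by linarith
  also have "\<dots> = sum ?f I" unfolding split[of ?f] ..
  finally show ?thesis .
qed

lemma ft_pair_rec_words:
  assumes gh: "g \<in> I" "h \<in> I" "g \<noteq> h" "r g = r h"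
  shows "cmod (ft \<mu> \<xi>) \<le>
    (\<Sum>w\<in>words I m. wprod p w * wfactor (pair_factor g h) r w \<xi> * cmod (ft \<mu> (wprod r w * \<xi>)))"
proof (induction m arbitrary: \<xi>)
  case (Suc m)
  have "cmod (ft \<mu> \<xi>) \<le> (\<Sum>i\<in>I. p i * pair_factor g h i \<xi> * cmod (ft \<mu> (r i * \<xi>)))"
    by (rule ft_pair_rec[OF gh])
  also have "\<dots> \<le> (\<Sum>i\<in>I. p i * pair_factor g h i \<xi> * (\<Sum>w\<in>words I m. wprod p w *
      wfactor (pair_factor g h) r w (r i * \<xi>) * cmod (ft \<mu> (wprod r w * (r i * \<xi>)))))"
    using Suc.IH pair_factor_bounds(1)[OF gh(1,2)] p_pos
    by (intro sum_mono mult_left_mono mult_nonneg_nonneg) (auto intro: less_imp_le)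
  finally show ?case
    by (simp add: sum_words_Suc sum_distrib_left mult_ac)
qed simp

text \<open>The aim is a mean growth factor of at most \<open>exp (3 * \<beta> * s)\<close> per
  word. The three parts come from words with gain, from the quadratic error of
  \<open>G powr s\<close>, and from words without gain. The constants are chosen so that each part
  is at most \<open>s * \<beta>\<close>.\<close>

lemma ft_decay_pair:
  assumes gh: "g \<in> I" "h \<in> I" "g \<noteq> h" "r g = r h" "t g \<noteq> t h" and "0 < \<alpha>"
  shows "\<exists>l>0. \<exists>\<tau>>0. \<exists>C>0. \<forall>T (K::'k set) v x. 1 \<le> T \<longrightarrow> finite K \<longrightarrow> (\<forall>k\<in>K. 0 \<le> v k) \<longrightarrow>
    sum v K = 1 \<longrightarrow> (\<forall>k\<in>K. \<bar>x k\<bar> \<le> T) \<longrightarrow> conc_bound l K v x (T powr - \<alpha>) \<longrightarrow>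
    (\<Sum>k\<in>K. v k * cmod (ft \<mu> (x k))) \<le> C * T powr - \<tau>"
proof -
  obtain c d where cd: "0 < c" "c \<le> d" "d < 1" "\<And>i. i \<in> I \<Longrightarrow> c \<le> \<bar>r i\<bar> \<and> \<bar>r i\<bar> \<le> d"
    using ratio_bounds by auto
  define L where "L = ln (1 / d)"
  have L: "0 < L" unfolding L_def using cd by simp
  \<comment> \<open>About \<open>ln T / L\<close> steps, each costing
    \<open>exp (3 * \<beta> * s)\<close>, amount to \<open>T powr (\<alpha> * s / 2)\<close> up to a
    constant. This consumes half of the initial smallness \<open>T powr (- \<alpha> * s)\<close>,
    which explains the 6.\<close>
  define \<beta> where "\<beta> = \<alpha> * L / 6"
  have \<beta>: "0 < \<beta>" unfolding \<beta>_def using L \<open>0 < \<alpha>\<close> by simp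
  define \<theta> where "\<theta> = sum p (I - {g, h})"
  have pp: "0 < p g" "0 < p h" using gh p_pos by auto
  have "1 = \<theta> + sum p {g, h}"
    unfolding \<theta>_def p_sum[symmetric] using gh fin by (intro sum.subset_diff) auto
  moreover have "0 \<le> \<theta>" unfolding \<theta>_def using p_pos by (intro sum_nonneg) (auto intro: less_imp_le)
  ultimately have \<theta>: "0 \<le> \<theta>" "\<theta> < 1" using gh(3) pp by auto
  \<comment> \<open>Words of length \<open>N\<close> avoiding \<open>g\<close> and \<open>h\<close>
    have total weight \<open>\<theta> ^ N\<close>, while the logarithm of their cost grows only
    linearly in \<open>N\<close>. For large \<open>N\<close> they contribute at most
    \<open>\<beta>\<close>.\<close>
  have "(\<lambda>N. ln 4 * \<theta> ^ N + ln (1 / c) * (of_nat N * \<theta> ^ N)) \<longlonglongrightarrow> ln 4 * 0 + ln (1 / c) * 0"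
    using \<theta> by (intro tendsto_add tendsto_mult tendsto_const LIMSEQ_realpow_zero powser_times_n_limit_0) auto
  then have "\<forall>\<^sub>F N in sequentially. ln 4 * \<theta> ^ N + ln (1 / c) * (of_nat N * \<theta> ^ N) < \<beta>"
    using \<beta> by (intro order_tendstoD(2)) auto
  then have "\<forall>\<^sub>F N in sequentially. ln 4 * \<theta> ^ N + ln (1 / c) * (of_nat N * \<theta> ^ N) < \<beta> \<and> 0 < N"
    using eventually_gt_at_top[of 0] by eventually_elim auto
  then obtain N where N: "ln 4 * \<theta> ^ N + ln (1 / c) * (of_nat N * \<theta> ^ N) < \<beta>" "0 < N"
    by (auto simp: eventually_sequentially)
  define e where "e = c ^ N"
  have e: "0 < e" "e \<le> 1" unfolding e_def using cd by (auto intro: power_le_one)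
  define R where "R = nat \<lceil>1 / e\<rceil>"
  have R: "1 / e \<le> real R" "real R + 2 \<le> 4 / e" "1 \<le> real R"
  proof -
    show *: "1 / e \<le> real R" unfolding R_def by linarith
    have "1 \<le> 1 / e" using e by simp
    then show "1 \<le> real R" using * by linarith
    have "real R \<le> 1 / e + 1" unfolding R_def using \<open>1 \<le> 1 / e\<close> by linarith
    then have "real R + 2 \<le> 4 * (1 / e)" using \<open>1 \<le> 1 / e\<close> by linarith
    then show "real R + 2 \<le> 4 / e" by simp
  qed
  define LR where "LR = ln (real R + 2)"
  have LR: "0 < LR" unfolding LR_def using R by simp
  have "LR \<le> ln (4 / e)" unfolding LR_def using R e by (subst ln_le_cancel_iff) auto
  also have "\<dots> = ln 4 + N * ln (1 / c)"
    unfolding e_def using cd by (simp add: ln_div ln_realpow)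
  finally have "LR * \<theta> ^ N \<le> (ln 4 + N * ln (1 / c)) * \<theta> ^ N"
    using \<theta> by (intro mult_right_mono) auto
  also have "\<dots> \<le> \<beta>" using N by (simp add: algebra_simps)
  finally have LR\<theta>: "LR * \<theta> ^ N \<le> \<beta>" .
  define D where "D = (t h - t g) / (2 * pi)"
  have D: "D \<noteq> 0" unfolding D_def using gh by simp
  \<comment> \<open>The phase \<open>D * \<xi>\<close> varies by 1/2 over a window of length
    \<open>l * R\<close>, and the phase \<open>D' * \<xi>\<close> of any word by no more, since
    \<open>\<bar>D'\<bar> \<le> \<bar>D\<bar>\<close>.\<close>
  define l where "l = 1 / (2 * \<bar>D\<bar> * R)"
  have l: "0 < l" unfolding l_def using D R by simp
  have lDR: "\<bar>D\<bar> * (l * real R) = 1 / 2" unfolding l_def using D R by simp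
  \<comment> \<open>As \<open>\<bar>D'\<bar> \<ge> \<bar>D\<bar> * e\<close> for all words of length
    \<open>N\<close> with gain, this one \<open>\<delta>\<close> satisfies
    \<open>2 * \<delta> \<le> l * \<bar>D'\<bar>\<close> for all of them.\<close>
  define \<delta> where "\<delta> = l * \<bar>D\<bar> * e / 2"
  have "l * \<bar>D\<bar> * 1 \<le> l * \<bar>D\<bar> * real R" using l R by (intro mult_left_mono) auto
  also have "\<dots> = 1 / 2" using lDR by (simp add: mult_ac)
  finally have "l * \<bar>D\<bar> \<le> 1 / 2" by simp
  then have lDe: "(l * \<bar>D\<bar>) * e \<le> (1 / 2) * 1" using e l by (intro mult_mono) auto
  have \<delta>: "0 < \<delta>" "\<delta> \<le> 1 / 4"
    using l D e lDe unfolding \<delta>_def by (simp, linarith)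
  obtain \<eta> where \<eta>: "0 \<le> \<eta>" "\<eta> < 1" "\<And>\<theta>. (\<And>m::int. \<delta> \<le> \<bar>\<theta> - m\<bar>) \<Longrightarrow>
      cmod (of_real (p g) + of_real (p h) * cis (2 * pi * \<theta>)) / (p g + p h) \<le> \<eta>"
    using two_phase_gap[OF pp \<delta>(1)] \<delta>(2) by auto
  have "0 < \<beta> / (real R + 1)" using \<beta> by simp
  then obtain q0 where q0: "\<eta> ^ q0 < \<beta> / (real R + 1)"
    using real_arch_pow_inv \<eta> by blast
  \<comment> \<open>Even for the sake of Jensen, and at least \<open>q0\<close>, so that the gain
    \<open>\<eta> ^ q\<close> beats the pullback loss \<open>R + 1\<close> down to
    \<open>\<beta>\<close>.\<close>
  define q where "q = 2 * (q0 + 1)"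
  have q: "even q" "0 < q" unfolding q_def by auto
  define \<gamma> where "\<gamma> = \<eta> ^ q"
  have "\<gamma> \<le> \<eta> ^ q0" unfolding \<gamma>_def q_def using \<eta> by (intro power_decreasing) auto
  with q0 have "\<gamma> \<le> \<beta> / (real R + 1)" by simp
  then have \<gamma>: "0 \<le> \<gamma>" "\<gamma> \<le> 1" "\<gamma> * (real R + 1) \<le> \<beta>"
    unfolding \<gamma>_def using \<eta> by (auto intro: power_le_one simp: le_divide_eq)
  \<comment> \<open>Small enough that terms of first order in \<open>s\<close> dominate:
    \<open>s * LR \<le> 1\<close> permits the quadratic bound for the exponential, and the quadratic
    term is then at most \<open>s * \<beta>\<close>.\<close>
  define s where "s = min 1 (min (1 / LR) (\<beta> / LR\<^sup>2))"
  have s: "0 < s" "s \<le> 1" "s * LR \<le> 1" "(s * LR)\<^sup>2 \<le> s * \<beta>"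
  proof -
    show s0: "0 < s" "s \<le> 1" unfolding s_def using LR \<beta> by auto
    have "s \<le> 1 / LR" "s \<le> \<beta> / LR\<^sup>2" unfolding s_def by auto
    then show "s * LR \<le> 1" "(s * LR)\<^sup>2 \<le> s * \<beta>"
      using LR s0 by (auto simp: field_simps power2_eq_square)
  qed
  let ?F = "wfactor (pair_factor g h) r"
  note pf = pair_factor_bounds[OF gh(1,2)]
  have F: "0 \<le> ?F w \<xi>" "?F w \<xi> \<le> 1" for w \<xi> using wfactor_bounds[of "pair_factor g h"] pf by auto
  interpret W: self_sim \<mu> "words I N" "wprod p" "wprod r" "wtrans r t" a b
    by (rule words_self_sim[OF N(2)])
  define E where "E = {w. set w \<inter> {g, h} \<noteq> {}}"
  \<comment> \<open>Growth of the concentration under one word: close to 1 if the word contains a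
    letter of the pair, and \<open>R + 1\<close> otherwise.\<close>
  define G where "G w = (if w \<in> E then 1 + \<gamma> * (real R + 1) else real R + 1)" for w
  have \<gamma>R: "\<gamma> * (real R + 1) \<le> 1 * (real R + 1)" using \<gamma>(2) by (intro mult_right_mono) auto
  have G: "1 \<le> G w" "G w \<le> real R + 2" for w
  proof -
    show "1 \<le> G w" using \<gamma> unfolding G_def by simp
    have "1 + \<gamma> * (real R + 1) \<le> 1 + 1 * (real R + 1)" by (rule add_left_mono[OF \<gamma>R])
    also have "\<dots> = real R + 2" by simp
    finally show "G w \<le> real R + 2" unfolding G_def by simp
  qed
  let ?M = "\<lambda>\<xi>. cmod (ft \<mu> \<xi>) ^ q"
  have rec: "?M \<xi> \<le> (\<Sum>w\<in>words I N. wprod p w * ?F w \<xi> ^ q * ?M (wprod r w * \<xi>))" for \<xi>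
  proof -
    have "?M \<xi> \<le> (\<Sum>w\<in>words I N. wprod p w * (?F w \<xi> * cmod (ft \<mu> (wprod r w * \<xi>)))) ^ q"
      using ft_pair_rec_words[OF gh(1-4), of \<xi> N] by (intro power_mono) (auto simp: mult.assoc)
    also have "\<dots> \<le> (\<Sum>w\<in>words I N. wprod p w * (?F w \<xi> * cmod (ft \<mu> (wprod r w * \<xi>))) ^ q)"
      using W.fin W.p_pos W.p_sum q by (intro mean_power_le) (auto intro: less_imp_le)
    finally show ?thesis by (simp add: power_mult_distrib mult.assoc)
  qed
  have ratio: "1 / \<bar>wprod r w\<bar> \<le> real R" "\<bar>wprod r w\<bar> \<le> d" if w: "w \<in> words I N" for w
  proof -
    have "e \<le> \<bar>wprod r w\<bar>" unfolding e_def
      using wprod_abs_bounds(1)[where h=r, OF cd(4) _ w] cd(1) by simp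
    then have "1 / \<bar>wprod r w\<bar> \<le> 1 / e" using e by (intro divide_left_mono) auto
    then show "1 / \<bar>wprod r w\<bar> \<le> real R" using R by simp
    have "\<bar>wprod r w\<bar> \<le> d ^ N"
      using wprod_abs_bounds(2)[where h=r, OF cd(4) _ w] cd(1) by simp
    also have "d ^ N \<le> d ^ 1" using cd N by (intro power_decreasing) auto
    finally show "\<bar>wprod r w\<bar> \<le> d" by simp
  qed
  have step: "conc_bound l K (\<lambda>k. v k * ?F w (x k) ^ q) (\<lambda>k. wprod r w * x k) (G w * \<kappa>)"
    if w: "w \<in> words I N" and K: "finite K" "\<And>k. k \<in> K \<Longrightarrow> 0 \<le> v k" and cb: "conc_bound l K v x \<kappa>"
    for w \<kappa> and K :: "'k set" and v x
  proof (cases "w \<in> E")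
    case False
    then show ?thesis
      using conc_bound_step[OF cb K(1) l K(2), of "\<lambda>\<xi>. ?F w \<xi> ^ q" "wprod r w" R] F W.r_ne[OF w] ratio[OF w]
      by (simp add: G_def power_le_one)
  next
    case True
    let ?c0 = "\<lambda>\<theta>. cmod (of_real (p g) + of_real (p h) * cis (2 * pi * \<theta>)) / (p g + p h)"
    have "\<exists>D'. \<bar>D\<bar> * c ^ length w \<le> \<bar>D'\<bar> \<and> \<bar>D'\<bar> \<le> \<bar>D\<bar> \<and> (\<forall>\<xi>. ?F w \<xi> \<le> ?c0 (D' * \<xi>))"
    proof (rule wfactor_gain[where E="{g,h}" and I=I])
      show "pair_factor g h i \<xi> \<le> ?c0 (D * \<xi>)" if "i \<in> {g, h}" for i \<xi>
        using that unfolding pair_factor_def D_def by auto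
      show "c \<le> \<bar>r i\<bar> \<and> \<bar>r i\<bar> \<le> 1" if "i \<in> I" for i using cd(3) cd(4)[OF that] by auto
    qed (use pf cd w True in \<open>auto simp: words_def E_def\<close>)
    then obtain D' where D': "\<bar>D\<bar> * e \<le> \<bar>D'\<bar>" "\<bar>D'\<bar> \<le> \<bar>D\<bar>" "\<And>\<xi>. ?F w \<xi> \<le> ?c0 (D' * \<xi>)"
      using w unfolding e_def words_def by auto
    have "conc_bound l K (\<lambda>k. v k * ?F w (x k) ^ q) (\<lambda>k. wprod r w * x k) ((1 + \<gamma> * (real R + 1)) * \<kappa>)"
    proof (rule conc_bound_step_gain[OF cb K(1) l K(2), where A="\<lambda>\<xi>. ?F w \<xi> ^ q"])
      show "?F w \<xi> ^ q \<le> \<gamma>" if "\<And>m::int. \<delta> \<le> \<bar>D' * \<xi> - m\<bar>" for \<xi>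
        unfolding \<gamma>_def using F by (intro power_mono order_trans[OF D'(3) \<eta>(3)] that)
      have "0 < \<bar>D\<bar> * e" using D e by simp
      then show "D' \<noteq> 0" using D'(1) by auto
      have "\<bar>D'\<bar> * (l * real R) \<le> \<bar>D\<bar> * (l * real R)" using D' l by (intro mult_right_mono) auto
      then show "\<bar>D'\<bar> * (l * real R) \<le> 1 / 2" using lDR by simp
      show "2 * \<delta> \<le> l * \<bar>D'\<bar>" unfolding \<delta>_def using D'(1) l by simp
    qed (use F W.r_ne[OF w] ratio[OF w] \<delta> \<gamma> in \<open>auto intro: power_le_one\<close>)
    with True show ?thesis by (simp add: G_def)
  qed
  let ?E = "\<Sum>w\<in>words I N. wprod p w * G w powr s"
  have "?E \<le> (\<Sum>w\<in>words I N. wprod p w * ((1 + 2 * s * \<beta>) + (if w \<in> E then 0 else s * LR)))"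
  proof (intro sum_mono mult_left_mono)
    fix w assume w: "w \<in> words I N"
    show "0 \<le> wprod p w" using W.p_pos[OF w] by simp
    have lnG: "ln (G w) \<le> LR" "0 \<le> ln (G w)"
      unfolding LR_def using G[of w] by (auto simp: ln_le_cancel_iff)
    then have 1: "s * ln (G w) \<le> s * LR" using s by simp
    then have "s * ln (G w) \<le> 1" using s by linarith
    then have 2: "G w powr s \<le> 1 + s * ln (G w) + (s * ln (G w))\<^sup>2"
      using s G by (intro powr_le_quadratic) auto
    have "(s * ln (G w))\<^sup>2 \<le> (s * LR)\<^sup>2" using 1 lnG s by (intro power_mono) auto
    then have 3: "(s * ln (G w))\<^sup>2 \<le> s * \<beta>" using s by linarith
    have 4: "s * ln (G w) \<le> s * \<beta>" if "w \<in> E"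
    proof -
      have "ln (G w) \<le> \<gamma> * (real R + 1)"
        using that \<gamma> ln_add_one_self_le_self[of "\<gamma> * (real R + 1)"] unfolding G_def by simp
      then show ?thesis using \<gamma> s by simp
    qed
    have "0 \<le> s * \<beta>" using s \<beta> by simp
    with 1 2 3 4 show "G w powr s \<le> (1 + 2 * s * \<beta>) + (if w \<in> E then 0 else s * LR)"
      by (cases "w \<in> E") auto
  qed
  also have "\<dots> = (1 + 2 * s * \<beta>) + s * LR * (\<Sum>w\<in>words I N. if w \<in> E then 0 else wprod p w)"
  proof -
    have "(\<Sum>w\<in>words I N. wprod p w * ((1 + 2 * s * \<beta>) + (if w \<in> E then 0 else s * LR)))
      = (\<Sum>w\<in>words I N. wprod p w * (1 + 2 * s * \<beta>) + s * LR * (if w \<in> E then 0 else wprod p w))"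
      by (intro sum.cong) (auto simp: algebra_simps)
    then show ?thesis
      using W.p_sum by (simp only: sum.distrib sum_distrib_left[symmetric] sum_distrib_right[symmetric] mult_1)
  qed
  also have "(\<Sum>w\<in>words I N. if w \<in> E then 0 else wprod p w) = (\<Sum>w\<in>words (I - {g, h}) N. wprod p w)"
    using W.fin by (intro sum.mono_neutral_cong_right) (auto simp: words_def E_def)
  also have "\<dots> = \<theta> ^ N" unfolding \<theta>_def by (rule sum_wprod_words)
  also have "(1 + 2 * s * \<beta>) + s * LR * \<theta> ^ N \<le> 1 + 3 * \<beta> * s"
    using mult_left_mono[OF LR\<theta>, of s] s by (simp add: algebra_simps)
  also have "\<dots> \<le> exp (3 * \<beta> * s)" by (rule exp_ge_add_one_self)
  finally have E: "?E \<le> exp (3 * \<beta> * s)" .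
  have E0: "0 \<le> ?E" using W.p_pos by (intro sum_nonneg mult_nonneg_nonneg) (auto intro: less_imp_le)
  \<comment> \<open>Distinct from \<open>R\<close>: it serves the final stage only, where the
    frequencies lie in an interval of length 2.\<close>
  define R' where "R' = nat \<lceil>2 / l\<rceil>"
  have "2 / l \<le> real R'" unfolding R'_def by linarith
  then have R': "2 \<le> l * real R'" using l by (simp add: field_simps)
  define Q where "Q = (real R' + 1) powr s * exp (3 * \<beta> * s)"
  define \<tau> where "\<tau> = \<alpha> * s / (2 * q)"
  have Q: "0 < Q" unfolding Q_def by simp
  have \<tau>: "0 < \<tau>" unfolding \<tau>_def using \<open>0 < \<alpha>\<close> s q by simp
  have main: "(\<Sum>k\<in>K. v k * cmod (ft \<mu> (x k))) \<le> Q powr (1 / q) * T powr - \<tau>"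
    if T: "1 \<le> T" and K: "finite K" "\<forall>k\<in>K. 0 \<le> v k" "sum v K = 1" "\<forall>k\<in>K. \<bar>x k\<bar> \<le> T"
      and cb: "conc_bound l K v x (T powr - \<alpha>)" for T and K :: "'k set" and v x
  proof -
    \<comment> \<open>Enough contractions by \<open>d\<close> to bring all frequencies of size
      \<open>T\<close> down to size 1.\<close>
    define n where "n = nat \<lceil>ln T / L\<rceil>"
    have "0 \<le> ln T / L" using T L by simp
    then have n: "ln T / L \<le> real n" "real n \<le> ln T / L + 1" unfolding n_def by linarith+
    have "ln T \<le> real n * L" using n(1) L by (simp add: divide_le_eq)
    then have "exp (ln T) \<le> exp (real n * L)" by simp
    also have "\<dots> = (1 / d) ^ n" unfolding L_def using cd by (simp add: exp_of_nat_mult)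
    finally have Tn: "T \<le> (1 / d) ^ n" using T by simp
    let ?S = "\<Sum>k\<in>K. v k * cmod (ft \<mu> (x k))"
    have S: "0 \<le> ?S" using K by (intro sum_nonneg) auto
    have "?S ^ q \<le> (\<Sum>k\<in>K. v k * ?M (x k))"
      using K q by (intro mean_power_le) auto
    also have "\<dots> \<le> ((real R' + 1) * T powr - \<alpha>) powr s * ?E ^ n"
    proof (rule decay_iterate[where M="?M" and v=v and x=x and n=n and A="\<lambda>w \<xi>. ?F w \<xi> ^ q" and r="wprod r" and d=d and l=l])
      show "\<bar>x k\<bar> \<le> (1 / d) ^ n" if "k \<in> K" for k using K(4) Tn that by force
      show "conc_bound l K (\<lambda>k. v k * ?F w (x k) ^ q) (\<lambda>k. wprod r w * x k) (G w * \<kappa>)"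
        if "w \<in> words I N" "finite K" "\<And>k. k \<in> K \<Longrightarrow> 0 \<le> v k" "conc_bound l K v x \<kappa>"
        for w \<kappa> and K :: "'k set" and v x
        using that by (rule step)
      show "0 \<le> G w" for w using G(1)[of w] by simp
    qed (use K cb rec F ratio W.p_pos cd s l R' cmod_ft_le in \<open>auto intro: less_imp_le power_le_one\<close>)
    also have "\<dots> \<le> ((real R' + 1) * T powr - \<alpha>) powr s * exp (3 * \<beta> * s) ^ n"
      using E E0 by (intro mult_left_mono power_mono) auto
    also have "exp (3 * \<beta> * s) ^ n = exp (real n * (3 * \<beta> * s))" by (simp add: exp_of_nat_mult)
    also have "\<dots> \<le> exp ((ln T / L + 1) * (3 * \<beta> * s))"
      using n(2) \<beta> s by (simp add: mult_right_mono)
    also have "(ln T / L + 1) * (3 * \<beta> * s) = 3 * \<beta> * s + (\<alpha> * s / 2) * ln T"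
      unfolding \<beta>_def using L by (simp add: field_simps)
    also have "exp \<dots> = exp (3 * \<beta> * s) * T powr (\<alpha> * s / 2)"
      using T by (simp add: exp_add powr_def)
    also have "((real R' + 1) * T powr - \<alpha>) powr s * (exp (3 * \<beta> * s) * T powr (\<alpha> * s / 2))
        = Q * (T powr (- \<alpha> * s) * T powr (\<alpha> * s / 2))"
      unfolding Q_def by (simp add: powr_mult powr_powr)
    also have "T powr (- \<alpha> * s) * T powr (\<alpha> * s / 2) = T powr - (\<alpha> * s / 2)"
      by (simp flip: powr_add)
    finally have Sq: "?S ^ q \<le> Q * T powr - (\<alpha> * s / 2)"
      by (simp add: mult_left_mono)
    have "?S = (?S ^ q) powr (1 / q)"
    proof (cases "?S = 0")
      case False
      then have "0 < ?S" using S by linarith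
      then show ?thesis using q by (simp add: powr_powr flip: powr_realpow)
    qed (use q in simp)
    also have "\<dots> \<le> (Q * T powr - (\<alpha> * s / 2)) powr (1 / q)"
      using Sq S by (intro powr_mono2) auto
    also have "\<dots> = Q powr (1 / q) * T powr - \<tau>"
      unfolding \<tau>_def using Q by (simp add: powr_mult powr_powr)
    finally show ?thesis .
  qed
  show ?thesis
  proof (rule exI[of _ l], rule conjI[OF l], rule exI[of _ \<tau>], rule conjI[OF \<tau>],
      rule exI[of _ "Q powr (1 / q)"], rule conjI, goal_cases)
    case 1
    show ?case using Q by simp
  next
    case 2
    show ?case by (intro allI impI) (rule main; assumption)
  qed
qed

text \<open>For the two compositions \<open>[i, j]\<close> and \<open>[j, i]\<close> the ratios
  agree by commutativity and the translations differ by
  \<open>(1 - r i) * (1 - r j) * (x - y)\<close>. Words of length 2 therefore always contain a pair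
  as required by \<open>ft_decay_pair\<close>.\<close>

lemma ft_decay:
  assumes ij: "i \<in> I" "j \<in> I" and x: "r i * x + t i = x" and y: "r j * y + t j = y" and "x \<noteq> y" "0 < \<alpha>"
  shows "\<exists>l>0. \<exists>\<tau>>0. \<exists>C>0. \<forall>T (K::'k set) v x. 1 \<le> T \<longrightarrow> finite K \<longrightarrow> (\<forall>k\<in>K. 0 \<le> v k) \<longrightarrow>
    sum v K = 1 \<longrightarrow> (\<forall>k\<in>K. \<bar>x k\<bar> \<le> T) \<longrightarrow> conc_bound l K v x (T powr - \<alpha>) \<longrightarrow>
    (\<Sum>k\<in>K. v k * cmod (ft \<mu> (x k))) \<le> C * T powr - \<tau>"
proof -
  interpret W: self_sim \<mu> "words I 2" "wprod p" "wprod r" "wtrans r t" a b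
    by (rule words_self_sim) simp
  have ri: "r i \<noteq> 1" "r j \<noteq> 1" using r_lt[of i] r_lt[of j] ij by auto
  have ij': "i \<noteq> j"
  proof
    assume "i = j"
    then have "(1 - r i) * (x - y) = 0" using x y by (simp add: algebra_simps)
    with ri \<open>x \<noteq> y\<close> show False by simp
  qed
  show ?thesis
  proof (rule W.ft_decay_pair[of "[i, j]" "[j, i]"])
    show "[i, j] \<in> words I 2" "[j, i] \<in> words I 2" using ij by (auto simp: words_def)
    show "wtrans r t [i, j] \<noteq> wtrans r t [j, i]"
    proof
      assume *: "wtrans r t [i, j] = wtrans r t [j, i]"
      have t: "t i = (1 - r i) * x" "t j = (1 - r j) * y" using x y by (auto simp: algebra_simps)
      have "(1 - r i) * (1 - r j) * (x - y) = 0" using * unfolding t by (simp add: t algebra_simps)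
      with ri \<open>x \<noteq> y\<close> show False by simp
    qed
  qed (use ij' \<open>0 < \<alpha>\<close> in auto)
qed

end

section \<open>Sublevel sets\<close>

text \<open>By the mean value theorem the points with
  \<open>\<bar>D j x\<bar> < c * \<delta>\<close> fit into one interval of length
  \<open>2 * \<delta>\<close> when \<open>\<bar>D (Suc j) x\<bar> \<ge> c\<close>. Removing it
  leaves two convex pieces to which induction applies with \<open>c * \<delta>\<close> in place of
  \<open>c\<close>, so the number of intervals goes from \<open>2 ^ j - 1\<close> to twice that plus
  1.\<close>

lemma sublevel_cover:
  fixes D :: "nat \<Rightarrow> real \<Rightarrow> real" and c \<delta> :: real
  assumes "convex S" "\<And>i x. i < j \<Longrightarrow> x \<in> S \<Longrightarrow> (D i has_real_derivative D (Suc i) x) (at x within S)"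
    and "\<And>x. x \<in> S \<Longrightarrow> c \<le> \<bar>D j x\<bar>" "0 < c" "0 < \<delta>"
  shows "\<exists>F. finite F \<and> card F + 1 \<le> 2 ^ j \<and> {x\<in>S. \<bar>D 0 x\<bar> < c * \<delta> ^ j} \<subseteq> (\<Union>u\<in>F. {u..u + 2 * \<delta>})"
  using assms(1-4)
proof (induction j arbitrary: S c)
  case 0
  then show ?case by (intro exI[of _ "{}"]) force
next
  case (Suc j)
  have IH: "\<exists>F. finite F \<and> card F + 1 \<le> 2 ^ j \<and>
      {x\<in>S'. \<bar>D 0 x\<bar> < c * \<delta> ^ Suc j} \<subseteq> (\<Union>u\<in>F. {u..u + 2 * \<delta>})"
    if "convex S'" "S' \<subseteq> S" "\<And>x. x \<in> S' \<Longrightarrow> c * \<delta> \<le> \<bar>D j x\<bar>" for S'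
  proof -
    have "\<exists>F. finite F \<and> card F + 1 \<le> 2 ^ j \<and>
      {x\<in>S'. \<bar>D 0 x\<bar> < c * \<delta> * \<delta> ^ j} \<subseteq> (\<Union>u\<in>F. {u..u + 2 * \<delta>})"
    proof (rule Suc.IH)
      fix i x assume "i < j" "x \<in> S'"
      then have "(D i has_real_derivative D (Suc i) x) (at x within S)"
        using that(2) by (intro Suc.prems(2)) auto
      then show "(D i has_real_derivative D (Suc i) x) (at x within S')"
        using that(2) by (rule has_field_derivative_subset)
    qed (use that Suc.prems(4) \<open>0 < \<delta>\<close> in auto)
    then show ?thesis by (simp add: mult.assoc)
  qed
  define Q where "Q = {x\<in>S. \<bar>D j x\<bar> < c * \<delta>}"
  show ?case
  proof (cases "Q = {}")
    case True
    then obtain F where "finite F" "card F + 1 \<le> 2 ^ j"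
      "{x\<in>S. \<bar>D 0 x\<bar> < c * \<delta> ^ Suc j} \<subseteq> (\<Union>u\<in>F. {u..u + 2 * \<delta>})"
      using IH[of S] Suc.prems(1) unfolding Q_def by (auto simp: not_less)
    moreover have "(2::nat) ^ j \<le> 2 ^ Suc j" by simp
    ultimately show ?thesis by (meson order_trans)
  next
    case False
    have diam: "y - x \<le> 2 * \<delta>" if "x \<in> Q" "y \<in> Q" for x y
    proof (cases "x < y")
      case True
      have sub: "{x..y} \<subseteq> S"
      proof -
        have "closed_segment x y \<subseteq> S"
          using that Suc.prems(1) unfolding Q_def by (intro closed_segment_subset) auto
        then show ?thesis using True by (simp add: closed_segment_eq_real_ivl)
      qed
      have "\<exists>z\<in>{x<..<y}. D j y - D j x = (*) (D (Suc j) z) (y - x)"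
      proof (rule mvt_simple[OF True])
        fix z assume "x \<le> z" "z \<le> y"
        then have "(D j has_real_derivative D (Suc j) z) (at z within S)"
          using sub by (intro Suc.prems(2)) auto
        then show "(D j has_derivative (*) (D (Suc j) z)) (at z within {x..y})"
          using sub by (auto simp: has_field_derivative_def intro: has_derivative_subset)
      qed
      then obtain z where z: "z \<in> {x<..<y}" "D j y - D j x = D (Suc j) z * (y - x)" by blast
      have "z \<in> S" using z(1) sub by force
      then have "c * (y - x) \<le> \<bar>D (Suc j) z\<bar> * (y - x)"
        using Suc.prems(3)[of z] True by (intro mult_right_mono) auto
      also have "\<dots> = \<bar>D j y - D j x\<bar>" unfolding z(2) using True by (simp add: abs_mult)
      also have "\<dots> \<le> c * (2 * \<delta>)" using that unfolding Q_def by auto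
      finally show ?thesis using \<open>0 < c\<close> by simp
    qed (use \<open>0 < \<delta>\<close> in auto)
    \<comment> \<open>All of \<open>Q\<close> lies between \<open>u\<close> and
      \<open>u + 2 * \<delta>\<close>; the parts of \<open>S\<close> on either side are disjoint
      from \<open>Q\<close>.\<close>
    define u where "u = Inf Q"
    obtain q where q: "q \<in> Q" using False by auto
    have "bdd_below Q" using diam[OF _ q] by (intro bdd_belowI[of _ "q - 2 * \<delta>"]) force
    then have u1: "u \<le> x" if "x \<in> Q" for x unfolding u_def using that by (rule cInf_lower[rotated])
    have u2: "x \<le> u + 2 * \<delta>" if "x \<in> Q" for x
    proof -
      have "x - 2 * \<delta> \<le> u" unfolding u_def using False diam that by (intro cInf_greatest) force+
      then show ?thesis by simp
    qed
    obtain F1 where F1: "finite F1" "card F1 + 1 \<le> 2 ^ j"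
      "{x\<in>S \<inter> {..<u}. \<bar>D 0 x\<bar> < c * \<delta> ^ Suc j} \<subseteq> (\<Union>u\<in>F1. {u..u + 2 * \<delta>})"
      using IH[of "S \<inter> {..<u}"] Suc.prems(1) u1 unfolding Q_def by (force simp: convex_Int not_less)
    obtain F2 where F2: "finite F2" "card F2 + 1 \<le> 2 ^ j"
      "{x\<in>S \<inter> {u + 2 * \<delta><..}. \<bar>D 0 x\<bar> < c * \<delta> ^ Suc j} \<subseteq> (\<Union>u\<in>F2. {u..u + 2 * \<delta>})"
      using IH[of "S \<inter> {u + 2 * \<delta><..}"] Suc.prems(1) u2 unfolding Q_def by (force simp: convex_Int not_less)
    have "{x\<in>S. \<bar>D 0 x\<bar> < c * \<delta> ^ Suc j} \<subseteq> {x\<in>S \<inter> {..<u}. \<bar>D 0 x\<bar> < c * \<delta> ^ Suc j} \<union>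
        {x\<in>S \<inter> {u + 2 * \<delta><..}. \<bar>D 0 x\<bar> < c * \<delta> ^ Suc j} \<union> {u..u + 2 * \<delta>}"
      by auto
    also have "\<dots> \<subseteq> (\<Union>u\<in>insert u (F1 \<union> F2). {u..u + 2 * \<delta>})"
      using F1(3) F2(3) by blast
    finally have "{x\<in>S. \<bar>D 0 x\<bar> < c * \<delta> ^ Suc j} \<subseteq> (\<Union>u\<in>insert u (F1 \<union> F2). {u..u + 2 * \<delta>})" .
    moreover have "card (insert u (F1 \<union> F2)) + 1 \<le> 2 ^ Suc j"
      using card_insert_le_m1[of "card F1 + card F2 + 1" "F1 \<union> F2" u] card_Un_le[of F1 F2] F1 F2
      by simp
    ultimately show ?thesis using F1 F2 by (intro exI[of _ "insert u (F1 \<union> F2)"]) auto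
  qed
qed

text \<open>The order of the derivative that is large may change from point to point. By continuity
  one order works, with \<open>c / 2\<close>, on a ball around each point, and finitely many balls
  suffice. Their number depends neither on \<open>y\<close> nor on \<open>\<delta>\<close>.\<close>

lemma sublevel_cover_compact:
  fixes D :: "nat \<Rightarrow> real \<Rightarrow> real" and c :: real
  assumes D: "\<And>i x. i < m \<Longrightarrow> x \<in> {a..b} \<Longrightarrow> (D i has_real_derivative D (Suc i) x) (at x within {a..b})"
    and cont: "continuous_on {a..b} (D m)" and "0 < c"
    and nondeg: "\<And>x. x \<in> {a..b} \<Longrightarrow> \<exists>i\<in>{1..m}. c \<le> \<bar>D i x\<bar>"
  shows "\<exists>P::nat. \<forall>y \<delta>. 0 < \<delta> \<longrightarrow> \<delta> \<le> 1 \<longrightarrow> (\<exists>F. finite F \<and> card F \<le> P \<and>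
    {x\<in>{a..b}. \<bar>D 0 x - y\<bar> < c / 2 * \<delta> ^ m} \<subseteq> (\<Union>u\<in>F. {u..u + 2 * \<delta>}))"
proof -
  have contD: "continuous_on {a..b} (D i)" if "i \<le> m" for i
  proof (cases "i = m")
    case False
    with that have "i < m" by simp
    then show ?thesis using D[of i] by (intro DERIV_continuous_on) auto
  qed (use cont in simp)
  have "\<exists>e>0. \<exists>i\<in>{1..m}. \<forall>z\<in>{a..b} \<inter> ball x e. c / 2 \<le> \<bar>D i z\<bar>" if x: "x \<in> {a..b}" for x
  proof -
    obtain i where i: "i \<in> {1..m}" "c \<le> \<bar>D i x\<bar>" using nondeg[OF x] by blast
    then have "continuous_on {a..b} (D i)" by (intro contD) auto
    then obtain e where e: "0 < e" "\<And>z. z \<in> {a..b} \<Longrightarrow> dist z x < e \<Longrightarrow> dist (D i z) (D i x) < c / 2"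
      using x \<open>0 < c\<close> unfolding continuous_on_iff by (meson half_gt_zero)
    have "c / 2 \<le> \<bar>D i z\<bar>" if "z \<in> {a..b} \<inter> ball x e" for z
    proof -
      have "\<bar>D i z - D i x\<bar> < c / 2"
        using e(2)[of z] that by (auto simp: dist_real_def abs_minus_commute)
      then show ?thesis using i(2) by linarith
    qed
    with e(1) i(1) show ?thesis by blast
  qed
  then obtain e i where ei: "\<And>x. x \<in> {a..b} \<Longrightarrow> 0 < e x" "\<And>x. x \<in> {a..b} \<Longrightarrow> i x \<in> {1..m}"
    "\<And>x z. x \<in> {a..b} \<Longrightarrow> z \<in> {a..b} \<inter> ball x (e x) \<Longrightarrow> c / 2 \<le> \<bar>D (i x) z\<bar>"
    by metis
  obtain X where X: "X \<subseteq> {a..b}" "finite X" "{a..b} \<subseteq> (\<Union>x\<in>X. ball x (e x))"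
  proof (rule compactE_image[of "{a..b}" "{a..b}" "\<lambda>x. ball x (e x)"])
    show "{a..b} \<subseteq> (\<Union>x\<in>{a..b}. ball x (e x))" using ei(1) by force
  qed auto
  have "\<exists>F. finite F \<and> card F \<le> card X * 2 ^ m \<and>
      {x\<in>{a..b}. \<bar>D 0 x - y\<bar> < c / 2 * \<delta> ^ m} \<subseteq> (\<Union>u\<in>F. {u..u + 2 * \<delta>})"
    if \<delta>: "0 < \<delta>" "\<delta> \<le> 1" for y \<delta>
  proof -
    define cov where "cov x F \<longleftrightarrow> finite F \<and> card F \<le> 2 ^ m \<and>
      {z\<in>{a..b} \<inter> ball x (e x). \<bar>D 0 z - y\<bar> < c / 2 * \<delta> ^ m} \<subseteq> (\<Union>u\<in>F. {u..u + 2 * \<delta>})"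
      for x and F :: "real set"
    have "\<exists>F. cov x F" if x: "x \<in> X" for x
    proof -
      have xab: "x \<in> {a..b}" using x X by auto
      have im: "1 \<le> i x" "i x \<le> m" using ei(2)[OF xab] by auto
      \<comment> \<open>Subtracting \<open>y\<close> affects order 0 only, and the large derivative
        has order at least 1. Together with \<open>\<delta> \<le> 1\<close>, which replaces
        \<open>\<delta> ^ i x\<close> by \<open>\<delta> ^ m\<close>, this gives one cover size for
        all levels.\<close>
      define D' where "D' n = (if n = 0 then \<lambda>z. D 0 z - y else D n)" for n
      have "\<exists>F. finite F \<and> card F + 1 \<le> 2 ^ i x \<and>
        {z\<in>{a..b} \<inter> ball x (e x). \<bar>D' 0 z\<bar> < c / 2 * \<delta> ^ i x} \<subseteq> (\<Union>u\<in>F. {u..u + 2 * \<delta>})"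
      proof (rule sublevel_cover)
        show "convex ({a..b} \<inter> ball x (e x))" by (intro convex_Int) auto
        fix n z assume n: "n < i x" and z: "z \<in> {a..b} \<inter> ball x (e x)"
        have "(D n has_real_derivative D (Suc n) z) (at z within {a..b} \<inter> ball x (e x))"
          using D[of n z] n z im by (auto intro: has_field_derivative_subset)
        then show "(D' n has_real_derivative D' (Suc n) z) (at z within {a..b} \<inter> ball x (e x))"
          unfolding D'_def by (auto intro!: derivative_eq_intros)
      next
        fix z assume "z \<in> {a..b} \<inter> ball x (e x)"
        then show "c / 2 \<le> \<bar>D' (i x) z\<bar>" using ei(3)[OF xab] im unfolding D'_def by auto
      qed (use \<delta> \<open>0 < c\<close> in auto)
      then obtain F where F: "finite F" "card F + 1 \<le> 2 ^ i x"
        "{z\<in>{a..b} \<inter> ball x (e x). \<bar>D' 0 z\<bar> < c / 2 * \<delta> ^ i x} \<subseteq> (\<Union>u\<in>F. {u..u + 2 * \<delta>})"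
        by blast
      have "\<delta> ^ m \<le> \<delta> ^ i x" using im \<delta> by (intro power_decreasing) auto
      then have "c / 2 * \<delta> ^ m \<le> c / 2 * \<delta> ^ i x" using \<open>0 < c\<close> by simp
      then have incl: "{z\<in>{a..b} \<inter> ball x (e x). \<bar>D 0 z - y\<bar> < c / 2 * \<delta> ^ m}
          \<subseteq> {z\<in>{a..b} \<inter> ball x (e x). \<bar>D' 0 z\<bar> < c / 2 * \<delta> ^ i x}"
        unfolding D'_def by auto
      have "(2::nat) ^ i x \<le> 2 ^ m" using im by (intro power_increasing) auto
      then have "card F \<le> 2 ^ m" using F(2) by linarith
      with F(1) order_trans[OF incl F(3)] show ?thesis unfolding cov_def by (intro exI[of _ F] conjI)
    qed
    then obtain F where "\<And>x. x \<in> X \<Longrightarrow> cov x (F x)" by metis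
    then have F: "\<And>x. x \<in> X \<Longrightarrow> finite (F x)" "\<And>x. x \<in> X \<Longrightarrow> card (F x) \<le> 2 ^ m"
      "\<And>x. x \<in> X \<Longrightarrow> {z\<in>{a..b} \<inter> ball x (e x). \<bar>D 0 z - y\<bar> < c / 2 * \<delta> ^ m} \<subseteq> (\<Union>u\<in>F x. {u..u + 2 * \<delta>})"
      unfolding cov_def by blast+
    have "card (\<Union>x\<in>X. F x) \<le> (\<Sum>x\<in>X. card (F x))" using X(2) by (rule card_UN_le)
    also have "\<dots> \<le> card X * 2 ^ m" using F(2) sum_bounded_above[of X "\<lambda>x. card (F x)" "2 ^ m"] by simp
    finally have "card (\<Union>x\<in>X. F x) \<le> card X * 2 ^ m" .
    moreover have "{x\<in>{a..b}. \<bar>D 0 x - y\<bar> < c / 2 * \<delta> ^ m} \<subseteq> (\<Union>u\<in>(\<Union>x\<in>X. F x). {u..u + 2 * \<delta>})"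
    proof
      fix z assume z: "z \<in> {x\<in>{a..b}. \<bar>D 0 x - y\<bar> < c / 2 * \<delta> ^ m}"
      then obtain x where "x \<in> X" "z \<in> ball x (e x)" using X(3) by blast
      with z F(3)[of x] show "z \<in> (\<Union>u\<in>(\<Union>x\<in>X. F x). {u..u + 2 * \<delta>})" by blast
    qed
    moreover have "finite (\<Union>x\<in>X. F x)" using X(2) F(1) by blast
    ultimately show ?thesis by (intro exI[of _ "\<Union>x\<in>X. F x"] conjI)
  qed
  then show ?thesis by blast
qed

section \<open>Cutting at a scale\<close>

lemma wprod_eq_prod_count:
  assumes "finite I" "set w \<subseteq> I"
  shows "wprod h w = (\<Prod>i\<in>I. h i ^ count_list w i)"
  using assms(2)
proof (induction w)
  case (Cons j w)
  then have j: "j \<in> I" by simp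
  have "(\<Prod>i\<in>I. h i ^ count_list (j # w) i) = (\<Prod>i\<in>I. (if i = j then h j else 1) * h i ^ count_list w i)"
    by (intro prod.cong) auto
  also have "\<dots> = h j * (\<Prod>i\<in>I. h i ^ count_list w i)"
    using j assms(1) by (simp add: prod.distrib)
  finally show ?case using Cons by simp
qed simp

text \<open>Multiplication being commutative, a product sees only how often each letter occurs.
  Exponentially many words thus have only polynomially many ratios.\<close>

lemma card_wprod_le:
  assumes "finite I" "\<And>w. w \<in> K \<Longrightarrow> set w \<subseteq> I \<and> length w \<le> m"
  shows "finite (wprod h ` K)" "card (wprod h ` K) \<le> (m + 1) ^ card I"
proof -
  let ?P = "\<lambda>\<phi>. \<Prod>i\<in>I. h i ^ \<phi> i" and ?E = "I \<rightarrow>\<^sub>E {..m}"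
  have sub: "wprod h ` K \<subseteq> ?P ` ?E"
  proof
    fix y assume "y \<in> wprod h ` K"
    then obtain w where w: "w \<in> K" "y = wprod h w" by auto
    define \<phi> where "\<phi> = restrict (count_list w) I"
    have "\<phi> \<in> ?E"
      using assms(2)[OF w(1)] count_le_length[of w] unfolding \<phi>_def by (auto intro: order_trans)
    moreover have "y = ?P \<phi>"
      using assms w(2) wprod_eq_prod_count[OF assms(1)] assms(2)[OF w(1)] unfolding \<phi>_def by simp
    ultimately show "y \<in> ?P ` ?E" by blast
  qed
  have fin: "finite ?E" using assms(1) by (intro finite_PiE) auto
  then show "finite (wprod h ` K)" using sub finite_subset by blast
  have "card (wprod h ` K) \<le> card (?P ` ?E)" using sub fin by (intro card_mono) auto
  also have "\<dots> \<le> card ?E" using fin by (rule card_image_le)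
  also have "\<dots> = (m + 1) ^ card I" using assms(1) by (simp add: card_PiE)
  finally show "card (wprod h ` K) \<le> (m + 1) ^ card I" .
qed

context self_sim
begin

text \<open>A stopping rule: a word is extended by every letter as long as its ratio exceeds
  \<open>\<rho>\<close>. The last letter costs a factor of at least \<open>c\<close>, whence the
  lower bound \<open>c * \<rho>\<close>; \<open>d ^ m \<le> \<rho>\<close> ends the process after
  \<open>m\<close> rounds. Each extension is stationarity applied inside one copy, so the stopped
  words form a system again.\<close>

lemma cut_at_scale:
  assumes \<rho>: "0 < \<rho>" "\<rho> < 1" and c: "0 < c" "c \<le> 1" and d: "d ^ m \<le> \<rho>"
    and r: "\<And>i. i \<in> I \<Longrightarrow> c \<le> \<bar>r i\<bar> \<and> \<bar>r i\<bar> \<le> d"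
  shows "\<exists>K. self_sim \<mu> K (wprod p) (wprod r) (wtrans r t) a b \<and>
    (\<forall>w\<in>K. set w \<subseteq> I \<and> length w \<le> m \<and> c * \<rho> \<le> \<bar>wprod r w\<bar> \<and> \<bar>wprod r w\<bar> \<le> \<rho>)"
proof -
  let ?st = "\<lambda>K F. (LINT x|\<mu>. F x)
    = (\<Sum>w\<in>K. of_real (wprod p w) * (LINT x|\<mu>. F (wprod r w * x + wtrans r t w)))"
  define stat_on where "stat_on K \<longleftrightarrow>
    (\<forall>F B. F \<in> borel_measurable borel \<longrightarrow> (\<forall>x. cmod (F x) \<le> B) \<longrightarrow> ?st K F)" for K
  \<comment> \<open>Words that have not been stopped after \<open>m\<close> rounds all have length
    exactly \<open>m\<close>, and only these may still have ratio above
    \<open>\<rho>\<close>.\<close>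
  define good where "good m w \<longleftrightarrow> set w \<subseteq> I \<and> length w \<le> m \<and> c * \<rho> \<le> \<bar>wprod r w\<bar> \<and>
    (\<bar>wprod r w\<bar> \<le> \<rho> \<or> length w = m)" for m w
  have stat_onD: "?st K F"
    if "stat_on K" "F \<in> borel_measurable borel" "\<And>x. cmod (F x) \<le> B" for K F B
    using that(1)[unfolded stat_on_def, rule_format, OF that(2,3)] .
  have "\<exists>K. finite K \<and> (\<forall>w\<in>K. good m w) \<and> stat_on K" for m
  proof (induction m)
    case 0
    have "c * \<rho> \<le> 1" using c \<rho> by (intro mult_le_one) auto
    then show ?case by (intro exI[of _ "{[]}"]) (simp add: good_def stat_on_def)
  next
    case (Suc m)
    then obtain K where K: "finite K" "\<forall>w\<in>K. good m w" "stat_on K" by blast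
    note st = stat_onD[OF K(3)]
    define S where "S = {w\<in>K. \<bar>wprod r w\<bar> \<le> \<rho>}"
    define U where "U = K - S"
    define V where "V = (\<lambda>(w, i). w @ [i]) ` (U \<times> I)"
    have len: "length w = m" if "w \<in> U" for w using K(2) that unfolding U_def S_def good_def by auto
    have finSU: "finite S" "finite U" "finite V" unfolding S_def U_def V_def using K(1) fin by auto
    have disj: "S \<inter> V = {}"
      using K(2) len unfolding V_def S_def good_def by force
    have inj: "inj_on (\<lambda>(w, i). w @ [i]) (U \<times> I)" by (auto simp: inj_on_def)
    have st': "stat_on (S \<union> V)"
      unfolding stat_on_def
    proof (intro allI impI)
      fix F :: "real \<Rightarrow> complex" and B :: real
      assume F: "F \<in> borel_measurable borel" "\<forall>x. cmod (F x) \<le> B"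
      let ?G = "\<lambda>w. of_real (wprod p w) * (LINT x|\<mu>. F (wprod r w * x + wtrans r t w))"
      have expand: "?G w = (\<Sum>i\<in>I. ?G (w @ [i]))" for w
      proof -
        have "(LINT x|\<mu>. F (wprod r w * x + wtrans r t w))
          = (\<Sum>i\<in>I. of_real (p i) * (LINT x|\<mu>. F (wprod r w * (r i * x + t i) + wtrans r t w)))"
          using F by (intro stat[of _ B]) auto
        then show ?thesis by (simp add: wprod_append wtrans_append sum_distrib_left algebra_simps)
      qed
      have "(LINT x|\<mu>. F x) = sum ?G K" using F by (intro st[of _ B]) auto
      also have "\<dots> = sum ?G S + sum ?G U"
        unfolding U_def using K(1) by (subst sum.subset_diff[of S K]) (auto simp: S_def)
      also have "sum ?G U = (\<Sum>w\<in>U. \<Sum>i\<in>I. ?G (w @ [i]))" by (intro sum.cong refl expand)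
      also have "\<dots> = sum ?G V"
        unfolding V_def sum.reindex[OF inj] by (simp add: sum.cartesian_product case_prod_unfold)
      also have "sum ?G S + sum ?G V = sum ?G (S \<union> V)"
        using finSU disj by (intro sum.union_disjoint[symmetric]) auto
      finally show "?st (S \<union> V) F" .
    qed
    have "good (Suc m) w" if "w \<in> S \<union> V" for w
    proof (cases "w \<in> S")
      case True
      then show ?thesis using K(2) unfolding S_def good_def by auto
    next
      case False
      with that obtain w' i where w: "w = w' @ [i]" "w' \<in> U" "i \<in> I" unfolding V_def by auto
      then have "\<rho> \<le> \<bar>wprod r w'\<bar>" unfolding U_def S_def by auto
      then have "\<rho> * c \<le> \<bar>wprod r w'\<bar> * \<bar>r i\<bar>" using r[OF w(3)] c \<rho> by (intro mult_mono) auto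
      then show ?thesis using w K(2) len[OF w(2)] unfolding U_def good_def
        by (auto simp: wprod_append abs_mult mult.commute)
    qed
    with finSU st' show ?case by (intro exI[of _ "S \<union> V"]) blast
  qed
  then obtain K where K: "finite K" "\<forall>w\<in>K. good m w" "stat_on K" by blast
  have K': "set w \<subseteq> I" "length w \<le> m" "c * \<rho> \<le> \<bar>wprod r w\<bar>" "\<bar>wprod r w\<bar> \<le> \<rho>" if w: "w \<in> K" for w
  proof -
    show *: "set w \<subseteq> I" "length w \<le> m" "c * \<rho> \<le> \<bar>wprod r w\<bar>" using K(2) w unfolding good_def by auto
    have "\<bar>wprod r w\<bar> \<le> \<rho>" if "length w = m"
    proof -
      have "w \<in> words I m" using that * by (simp add: words_def)
      then have "\<bar>wprod r w\<bar> \<le> d ^ m" using wprod_abs_bounds(2)[where h=r, OF r] c by auto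
      with d show ?thesis by simp
    qed
    then show "\<bar>wprod r w\<bar> \<le> \<rho>" using K(2) w unfolding good_def by auto
  qed
  have "self_sim \<mu> K (wprod p) (wprod r) (wtrans r t) a b"
  proof
    have "complex_of_real 1 = (\<Sum>w\<in>K. of_real (wprod p w) * 1)"
      using stat_onD[OF K(3), of "\<lambda>_. 1" 1] prob_space[unfolded space_mu] by simp
    then have "complex_of_real 1 = of_real (sum (wprod p) K)" by simp
    then show "sum (wprod p) K = 1" by (simp only: of_real_eq_iff)
    fix w assume w: "w \<in> K"
    show "0 < wprod p w" using K'(1)[OF w] by (rule wprod_p_pos)
    have "0 < c * \<rho>" using c \<rho> by simp
    then show "wprod r w \<noteq> 0" using K'(3)[OF w] by auto
    show "\<bar>wprod r w\<bar> < 1" using K'(4)[OF w] \<rho> by simp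
    show "wprod r w * x + wtrans r t w \<in> {a..b}" if "x \<in> {a..b}" for x
      using K'(1)[OF w] that by (rule inv_words)
  next
    fix F :: "real \<Rightarrow> complex" and B :: real assume F: "F \<in> borel_measurable borel" "\<And>x. cmod (F x) \<le> B"
    show "?st K F" by (rule stat_onD[OF K(3) F])
  qed (use K(1) sets_mu ab conc in auto)
  with K' show ?thesis by blast
qed

end

section \<open>Oscillatory integrals\<close>

lemma norm_cis_diff_le: "cmod (cis u - cis v) \<le> \<bar>u - v\<bar>"
proof -
  have "cis u - cis v = cis v * (cis (u - v) - 1)"
    by (simp add: algebra_simps cis_mult)
  then have "cmod (cis u - cis v) = cmod (exp (\<i> * of_real (u - v)) - 1)"
    by (simp add: norm_mult cis_conv_exp)
  also have "\<dots> = 2 * \<bar>sin ((u - v) / 2)\<bar>" by (rule dist_exp_i_1)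
  also have "\<dots> \<le> 2 * \<bar>(u - v) / 2\<bar>" using abs_sin_x_le_abs_x[of "(u - v) / 2"] by simp
  finally show ?thesis by simp
qed

lemma eventually_powr_le:
  fixes A u v :: real
  assumes "u < v"
  shows "\<forall>\<^sub>F x in at_top. A * x powr u \<le> x powr v"
proof -
  define x0 where "x0 = (max 1 A) powr (1 / (v - u))"
  show ?thesis
    using eventually_ge_at_top[of x0] eventually_gt_at_top[of 0]
  proof eventually_elim
    case (elim x)
    have "max 1 A = x0 powr (v - u)" unfolding x0_def using assms by (simp add: powr_powr)
    also have "\<dots> \<le> x powr (v - u)" using elim assms by (intro powr_mono2) (auto simp: x0_def)
    finally have "A * x powr u \<le> x powr (v - u) * x powr u" by (intro mult_right_mono) auto
    then show ?case by (simp flip: powr_add)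
  qed
qed

context self_sim
begin

text \<open>On each copy \<open>g\<close> is replaced by its tangent at the image of the left end
  \<open>a\<close>. The constant part is a unimodular factor, the linear part gives a value of
  \<open>ft\<close>, and the Lipschitz bound for \<open>g'\<close> controls the error. Since
  \<open>g\<close> is controlled on \<open>{a..b}\<close> only, the integrand uses a Borel function
  \<open>G\<close> that agrees with it there.\<close>

lemma linearized_bound:
  assumes g: "\<And>x. x \<in> {a..b} \<Longrightarrow> (g has_real_derivative g' x) (at x within {a..b})"
    and lip: "\<And>x y. x \<in> {a..b} \<Longrightarrow> y \<in> {a..b} \<Longrightarrow> \<bar>g' x - g' y\<bar> \<le> M * \<bar>x - y\<bar>" and "0 \<le> M"
    and r: "\<And>i. i \<in> I \<Longrightarrow> \<bar>r i\<bar> \<le> \<rho>" and "0 \<le> N"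
    and G: "G \<in> borel_measurable borel" "\<And>x. x \<in> {a..b} \<Longrightarrow> G x = g x"
  shows "cmod (LINT x|\<mu>. cis (N * G x))
    \<le> (\<Sum>i\<in>I. p i * cmod (ft \<mu> (N * r i * g' (r i * a + t i)))) + N * M * (\<rho> * (b - a))\<^sup>2"
proof -
  have cisb: "(\<lambda>x. cis (h x)) \<in> borel_measurable borel" if "h \<in> borel_measurable borel" for h :: "real \<Rightarrow> real"
    using that by (rule borel_measurable_continuous_on[rotated]) (intro continuous_intros)
  have int: "integrable \<mu> (\<lambda>x. cis (h x))" if "h \<in> borel_measurable borel" for h
    using borel_measurable_mu[OF cisb[OF that]] by (intro integrable_const_bound[of _ 1]) auto
  let ?E = "N * M * (\<rho> * (b - a))\<^sup>2"
  have each: "cmod (LINT x|\<mu>. cis (N * G (r i * x + t i))) \<le> cmod (ft \<mu> (N * r i * g' (r i * a + t i))) + ?E"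
    if i: "i \<in> I" for i
  proof -
    define y where "y = r i * a + t i"
    have y: "y \<in> {a..b}" unfolding y_def using ab by (intro inv[OF i]) auto
    define V where "V x = N * (g y + g' y * (r i * (x - a)))" for x
    define U where "U x = N * G (r i * x + t i)" for x
    have [measurable]: "U \<in> borel_measurable borel" "V \<in> borel_measurable borel"
      unfolding U_def V_def using G(1) by measurable
    have "(LINT x|\<mu>. cis (V x)) = (LINT x|\<mu>. cis (N * (g y - g' y * r i * a)) * cis (N * r i * g' y * x))"
      unfolding V_def by (simp add: cis_mult algebra_simps)
    also have "\<dots> = cis (N * (g y - g' y * r i * a)) * ft \<mu> (N * r i * g' y)"
      unfolding ft_def by simp
    finally have V: "cmod (LINT x|\<mu>. cis (V x)) = cmod (ft \<mu> (N * r i * g' y))"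
      by (simp add: norm_mult)
    have UV: "cmod (cis (U x) - cis (V x)) \<le> ?E" if x: "x \<in> {a..b}" for x
    proof -
      let ?z = "r i * x + t i"
      have z: "?z \<in> {a..b}" using inv[OF i x] .
      have zy: "?z - y = r i * (x - a)" unfolding y_def by (simp add: algebra_simps)
      have seg: "closed_segment y ?z \<subseteq> {a..b}" using y z by (intro closed_segment_subset) auto
      have "norm ((\<lambda>u. g u - g' y * u) ?z - (\<lambda>u. g u - g' y * u) y) \<le> (M * \<bar>?z - y\<bar>) * norm (?z - y)"
      proof (rule field_differentiable_bound[where S="closed_segment y ?z" and f'="\<lambda>u. g' u - g' y"])
        fix u assume u: "u \<in> closed_segment y ?z"
        have "(g has_real_derivative g' u) (at u within closed_segment y ?z)"
          using u seg by (intro has_field_derivative_subset[OF g seg]) auto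
        then show "((\<lambda>u. g u - g' y * u) has_real_derivative g' u - g' y) (at u within closed_segment y ?z)"
          by (auto intro!: derivative_eq_intros)
        have "\<bar>u - y\<bar> \<le> \<bar>?z - y\<bar>" using u by (auto simp: closed_segment_eq_real_ivl split: if_splits)
        then have "M * \<bar>u - y\<bar> \<le> M * \<bar>?z - y\<bar>" using \<open>0 \<le> M\<close> by (rule mult_left_mono)
        moreover have "\<bar>g' u - g' y\<bar> \<le> M * \<bar>u - y\<bar>" using u seg y by (intro lip) auto
        ultimately show "norm (g' u - g' y) \<le> M * \<bar>?z - y\<bar>" unfolding real_norm_def by linarith
      qed auto
      also have "\<dots> = M * (\<bar>r i\<bar> * \<bar>x - a\<bar>)\<^sup>2"
        unfolding zy by (simp add: abs_mult power2_eq_square)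
      also have "\<dots> \<le> M * (\<rho> * (b - a))\<^sup>2"
        using r[OF i] x \<open>0 \<le> M\<close> by (intro mult_left_mono power_mono mult_mono) auto
      finally have lin: "\<bar>g ?z - (g y + g' y * (?z - y))\<bar> \<le> M * (\<rho> * (b - a))\<^sup>2"
        by (simp add: algebra_simps)
      have "\<bar>U x - V x\<bar> = N * \<bar>g ?z - (g y + g' y * (?z - y))\<bar>"
        unfolding U_def V_def zy using G(2)[OF z] \<open>0 \<le> N\<close>
        by (simp add: abs_mult flip: right_diff_distrib)
      also have "\<dots> \<le> ?E" using mult_left_mono[OF lin \<open>0 \<le> N\<close>] by (simp add: mult.assoc)
      finally show ?thesis using norm_cis_diff_le[of "U x" "V x"] by linarith
    qed
    have "cmod ((LINT x|\<mu>. cis (U x)) - (LINT x|\<mu>. cis (V x))) = cmod (LINT x|\<mu>. cis (U x) - cis (V x))"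
      by (subst Bochner_Integration.integral_diff) (auto intro: int)
    also have "\<dots> \<le> (LINT x|\<mu>. cmod (cis (U x) - cis (V x)))" by (rule integral_norm_bound)
    also have "\<dots> \<le> (LINT x|\<mu>. ?E)"
    proof (rule integral_mono_AE)
      show "integrable \<mu> (\<lambda>x. cmod (cis (U x) - cis (V x)))"
        by (intro integrable_norm Bochner_Integration.integrable_diff int) auto
      show "AE x in \<mu>. cmod (cis (U x) - cis (V x)) \<le> ?E"
        using conc by eventually_elim (rule UV)
    qed simp
    also have "\<dots> = ?E" using prob_space[unfolded space_mu] by simp
    finally have "cmod ((LINT x|\<mu>. cis (U x)) - (LINT x|\<mu>. cis (V x))) \<le> ?E" .
    then have "cmod (LINT x|\<mu>. cis (U x)) \<le> cmod (LINT x|\<mu>. cis (V x)) + ?E"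
      using norm_triangle_sub[of "LINT x|\<mu>. cis (U x)" "LINT x|\<mu>. cis (V x)"] by linarith
    then show ?thesis unfolding V by (simp add: U_def y_def)
  qed
  have "(LINT x|\<mu>. cis (N * G x)) = (\<Sum>i\<in>I. of_real (p i) * (LINT x|\<mu>. cis (N * G (r i * x + t i))))"
    using G(1) by (intro stat[of _ 1] cisb) auto
  then have "cmod (LINT x|\<mu>. cis (N * G x)) \<le> (\<Sum>i\<in>I. p i * cmod (LINT x|\<mu>. cis (N * G (r i * x + t i))))"
  proof (simp only:, intro sum_norm_le)
    fix i assume "i \<in> I"
    then have "\<bar>p i\<bar> = p i" using p_pos[of i] by simp
    then show "cmod (of_real (p i) * (LINT x|\<mu>. cis (N * G (r i * x + t i))))
        \<le> p i * cmod (LINT x|\<mu>. cis (N * G (r i * x + t i)))"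
      by (simp add: norm_mult)
  qed
  also have "\<dots> \<le> (\<Sum>i\<in>I. p i * (cmod (ft \<mu> (N * r i * g' (r i * a + t i))) + ?E))"
    using p_pos by (intro sum_mono mult_left_mono each) (auto intro: less_imp_le)
  also have "\<dots> = (\<Sum>i\<in>I. p i * cmod (ft \<mu> (N * r i * g' (r i * a + t i)))) + ?E"
    using p_sum by (simp add: distrib_left sum.distrib flip: sum_distrib_right)
  finally show ?thesis .
qed

text \<open>Within a class of maps of equal ratio, close frequencies mean close values of \<open>g'\<close>, so the
  maps of the class send all of \<open>\<mu>\<close> into a sublevel set of \<open>g'\<close>.\<close>
lemma frequency_concentration:
  fixes P :: nat and B :: real
  assumes lip: "\<And>x y. x \<in> {a..b} \<Longrightarrow> y \<in> {a..b} \<Longrightarrow> \<bar>g' x - g' y\<bar> \<le> M * \<bar>x - y\<bar>" and "0 \<le> M"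
    and r: "\<And>i. i \<in> I \<Longrightarrow> e \<le> \<bar>r i\<bar> \<and> \<bar>r i\<bar> \<le> \<rho>" and "0 < e" "0 < N" "0 \<le> l"
    and cover: "\<And>y. \<exists>F. finite F \<and> card F \<le> P \<and>
      {x\<in>{a..b}. \<bar>g' x - y\<bar> < \<eta>} \<subseteq> (\<Union>u\<in>F. {u..u + 2 * \<delta>})"
    and frost: "\<And>s. prob {s..s + 2 * \<delta>} \<le> B"
    and \<eta>: "l / (N * e) + M * (\<rho> * (b - a)) < \<eta>"
  shows "conc_bound l I p (\<lambda>i. N * r i * g' (r i * a + t i)) (card (r ` I) * (P * B))"
  unfolding conc_bound_def
proof (intro allI impI)
  let ?\<xi> = "\<lambda>i. N * r i * g' (r i * a + t i)"
  fix K' assume K': "K' \<subseteq> I" and d: "\<forall>k\<in>K'. \<forall>k'\<in>K'. \<bar>?\<xi> k - ?\<xi> k'\<bar> \<le> l"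
  have B: "0 \<le> B" using frost[of 0] measure_nonneg order_trans by blast
  have class_bound: "sum p {k\<in>K'. r k = z} \<le> P * B" for z
  proof (cases "{k\<in>K'. r k = z} = {}")
    case True
    then show ?thesis unfolding True using B by simp
  next
    case False
    then obtain k0 where k0: "k0 \<in> K'" "r k0 = z" by auto
    let ?K = "{k\<in>K'. r k = z}"
    let ?y = "g' (r k0 * a + t k0)"
    obtain F where F: "finite F" "card F \<le> P" "{x\<in>{a..b}. \<bar>g' x - ?y\<bar> < \<eta>} \<subseteq> (\<Union>u\<in>F. {u..u + 2 * \<delta>})"
      using cover by blast
    define A where "A = (\<Union>u\<in>F. {u..u + 2 * \<delta>})"
    have A: "A \<in> sets borel" unfolding A_def using F(1) by (intro sets.finite_UN) auto
    \<comment> \<open>The image of the whole of \<open>{a..b}\<close> is in the sublevel set: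
      \<open>l / (N * e)\<close> bounds the difference of \<open>g'\<close> at the images of
      \<open>a\<close>, and \<open>M * (\<rho> * (b - a))\<close> its variation over one
      image.\<close>
    have full: "prob {x. r k * x + t k \<in> A} = 1" if k: "k \<in> ?K" for k
    proof -
      have kI: "k \<in> I" "k0 \<in> I" using k k0 K' by auto
      have z: "e \<le> \<bar>z\<bar>" "\<bar>z\<bar> \<le> \<rho>" using r[OF kI(2)] k0 by auto
      have "\<bar>?\<xi> k - ?\<xi> k0\<bar> \<le> l" using d k k0 by blast
      also have "?\<xi> k - ?\<xi> k0 = (N * z) * (g' (r k * a + t k) - ?y)"
        using k k0 by (simp add: algebra_simps)
      finally have "(N * \<bar>z\<bar>) * \<bar>g' (r k * a + t k) - ?y\<bar> \<le> l" using \<open>0 < N\<close> by (simp add: abs_mult)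
      moreover have "(N * e) * \<bar>g' (r k * a + t k) - ?y\<bar> \<le> (N * \<bar>z\<bar>) * \<bar>g' (r k * a + t k) - ?y\<bar>"
        using z \<open>0 < N\<close> by (intro mult_right_mono mult_left_mono) auto
      ultimately have "(N * e) * \<bar>g' (r k * a + t k) - ?y\<bar> \<le> l" by linarith
      then have 1: "\<bar>g' (r k * a + t k) - ?y\<bar> \<le> l / (N * e)"
        using \<open>0 < N\<close> \<open>0 < e\<close> by (simp add: le_divide_eq mult.commute)
      have mem: "r k * x + t k \<in> A" if x: "x \<in> {a..b}" for x
      proof -
        have "\<bar>g' (r k * x + t k) - g' (r k * a + t k)\<bar> \<le> M * \<bar>(r k * x + t k) - (r k * a + t k)\<bar>"
          using ab x by (intro lip inv[OF kI(1)]) auto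
        also have "(r k * x + t k) - (r k * a + t k) = r k * (x - a)" by (simp add: algebra_simps)
        also have "M * \<bar>r k * (x - a)\<bar> \<le> M * (\<rho> * (b - a))"
          using r[OF kI(1)] x \<open>0 \<le> M\<close> unfolding abs_mult by (intro mult_left_mono mult_mono) auto
        finally have "\<bar>g' (r k * x + t k) - ?y\<bar> < \<eta>" using 1 \<eta> by linarith
        then show ?thesis using F(3) inv[OF kI(1) x] unfolding A_def by blast
      qed
      have "AE x in \<mu>. x \<in> {x. r k * x + t k \<in> A}"
        using conc by eventually_elim (use mem in simp)
      moreover have "{x. r k * x + t k \<in> A} \<in> sets \<mu>" using A sets_mu by simp
      ultimately show ?thesis by (subst prob_eq_1) auto
    qed
    \<comment> \<open>Every map of the class puts its full mass into \<open>A\<close>, so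
      stationarity bounds the weight of the class by the measure of \<open>A\<close>, however the
      images overlap.\<close>
    have "sum p ?K = (\<Sum>k\<in>?K. p k * prob {x. r k * x + t k \<in> A})"
      using full by (intro sum.cong) auto
    also have "\<dots> \<le> (\<Sum>k\<in>I. p k * prob {x. r k * x + t k \<in> A})"
      using fin K' p_pos by (intro sum_mono2 mult_nonneg_nonneg) (auto intro: less_imp_le)
    also have "\<dots> = prob A" using stat_measure[OF A] by simp
    also have "\<dots> \<le> (\<Sum>u\<in>F. prob {u..u + 2 * \<delta>})"
      unfolding A_def
    proof (rule finite_measure_subadditive_finite[OF F(1)])
      show "(\<lambda>u. {u..u + 2 * \<delta>}) ` F \<subseteq> events" unfolding sets_mu by auto
    qed
    also have "\<dots> \<le> card F * B" using frost sum_bounded_above[of F "\<lambda>u. prob {u..u + 2 * \<delta>}" B] by simp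
    also have "\<dots> \<le> P * B" using F(2) B by (intro mult_right_mono) auto
    finally show ?thesis .
  qed
  have finK: "finite K'" using K' fin finite_subset by blast
  have "sum p K' = (\<Sum>z\<in>r ` I. sum p {k\<in>K'. r k = z})"
    using finK K' fin by (intro sum.group[symmetric]) auto
  also have "\<dots> \<le> card (r ` I) * (P * B)"
    using class_bound sum_bounded_above[of "r ` I" "\<lambda>z. sum p {k\<in>K'. r k = z}" "P * B"] by simp
  finally show "sum p K' \<le> card (r ` I) * (P * B)" .
qed

end

text \<open>The scale \<open>\<rho> = x\<^bsup>-2/3\<^esup>\<close> makes both the quadratic error \<open>x \<rho>\<^sup>2\<close> and the relative width
  \<open>1 / (x \<rho>)\<close> of a frequency window small; frequencies are compared with \<open>T = x\<^bsup>1/2\<^esup>\<close>.\<close>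
lemma eventually_scales:
  fixes A1 A2 A3 L \<beta> \<eta> :: real and k n :: nat
  assumes "0 < L" "0 < \<beta>" "0 < \<eta>" "2 \<le> k" "0 < n" "0 \<le> A3"
  shows "\<forall>\<^sub>F x in at_top. 1 < x \<and> A1 * x powr (1 / 3) \<le> x powr (1 / 2) \<and>
    A2 * x powr (- (1 / 3)) < \<eta> * (x powr (- (1 / (3 * k)))) ^ (k - 1) \<and>
    (real (nat \<lceil>ln (x powr (2 / 3)) / L\<rceil>) + 1) ^ n * (A3 * (2 * x powr (- (1 / (3 * k)))) powr \<beta>)
      \<le> (x powr (1 / 2)) powr - (\<beta> / (3 * k))"
proof -
  \<comment> \<open>Logarithms are bounded by \<open>x powr e / e\<close>, so their
    \<open>n\<close>-th power costs \<open>x powr (\<beta> / (12 * k))\<close>. This lowers the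
    exponent \<open>\<beta> / (3 * k)\<close> to \<open>\<beta> / (4 * k)\<close>, still above the
    required \<open>\<beta> / (6 * k)\<close>.\<close>
  define e where "e = \<beta> / (12 * k * n)"
  have e: "0 < e" unfolding e_def using assms by simp
  define A where "A = 2 / (3 * L * e) + 2"
  have k: "real k > 0" "real (k - 1) = real k - 1" using assms by auto
  \<comment> \<open>With \<open>x powr (- (1 / (3 * k)))\<close> as covering scale, its power
    \<open>k - 1\<close> decays with exponent \<open>(k - 1) / (3 * k)\<close>, just slower than the
    frequency window with exponent 1/3.\<close>
  have "\<forall>\<^sub>F x in at_top. 2 * A2 / \<eta> * x powr (- (1 / 3)) \<le> x powr (- ((real k - 1) / (3 * k)))"
    using k by (intro eventually_powr_le) (auto simp: field_simps)
  moreover have "\<forall>\<^sub>F x in at_top. (A ^ n * A3 * 2 powr \<beta>) * x powr (- (\<beta> / (4 * k))) \<le> x powr (- (\<beta> / (6 * k)))"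
    using k assms by (intro eventually_powr_le) (auto simp: field_simps)
  moreover have "\<forall>\<^sub>F x in at_top. A1 * x powr (1 / 3) \<le> x powr (1 / 2)"
    by (intro eventually_powr_le) auto
  ultimately show ?thesis
    using eventually_gt_at_top[of 1]
  proof eventually_elim
    case (elim x)
    have pw: "(x powr (- (1 / (3 * k)))) ^ (k - 1) = x powr (- ((real k - 1) / (3 * k)))"
      using elim k by (simp add: powr_powr flip: powr_realpow)
    have pos: "0 < x powr (- ((real k - 1) / (3 * k)))" using elim by simp
    have "A2 * x powr (- (1 / 3)) \<le> \<eta> / 2 * x powr (- ((real k - 1) / (3 * k)))"
      using elim(1) assms by (simp add: field_simps)
    also have "\<dots> < \<eta> * x powr (- ((real k - 1) / (3 * k)))" using pos assms by simp
    finally have 2: "A2 * x powr (- (1 / 3)) < \<eta> * (x powr (- (1 / (3 * k)))) ^ (k - 1)" unfolding pw .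
    have "0 \<le> ln (x powr (2 / 3)) / L" using elim assms by simp
    then have "real (nat \<lceil>ln (x powr (2 / 3)) / L\<rceil>) + 1 \<le> ln (x powr (2 / 3)) / L + 2" by linarith
    also have "\<dots> = 2 / (3 * L) * ln x + 2" using elim by simp
    also have "\<dots> \<le> 2 / (3 * L) * (x powr e / e) + 2 * x powr e"
      using elim assms e ln_powr_bound[of x e] ge_one_powr_ge_zero[of x e]
      by (intro add_mono mult_left_mono) auto
    also have "\<dots> = A * x powr e" unfolding A_def by (simp add: algebra_simps)
    finally have "(real (nat \<lceil>ln (x powr (2 / 3)) / L\<rceil>) + 1) ^ n \<le> (A * x powr e) ^ n"
      by (intro power_mono) auto
    also have "\<dots> = A ^ n * x powr (\<beta> / (12 * k))"
      unfolding e_def using elim assms by (simp add: power_mult_distrib powr_powr flip: powr_realpow)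
    finally have "(real (nat \<lceil>ln (x powr (2 / 3)) / L\<rceil>) + 1) ^ n * (A3 * (2 * x powr (- (1 / (3 * k)))) powr \<beta>)
        \<le> A ^ n * x powr (\<beta> / (12 * k)) * (A3 * (2 * x powr (- (1 / (3 * k)))) powr \<beta>)"
      using assms by (intro mult_right_mono) auto
    also have "\<dots> = (A ^ n * A3 * 2 powr \<beta>) * (x powr (\<beta> / (12 * k)) * x powr (- (\<beta> / (3 * k))))"
      using elim by (simp add: powr_mult powr_powr mult_ac)
    also have "x powr (\<beta> / (12 * k)) * x powr (- (\<beta> / (3 * k))) = x powr (- (\<beta> / (4 * k)))"
    proof -
      have "\<beta> / (12 * k) + - (\<beta> / (3 * k)) = - (\<beta> / (4 * k))" using k by (simp add: field_simps)
      then show ?thesis by (simp flip: powr_add)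
    qed
    also have "(A ^ n * A3 * 2 powr \<beta>) * x powr (- (\<beta> / (4 * k))) \<le> x powr (- (\<beta> / (6 * k)))"
      by (rule elim(2))
    also have "\<dots> = (x powr (1 / 2)) powr - (\<beta> / (3 * k))" by (simp add: powr_powr)
    finally show ?case using 2 elim by simp
  qed
qed

context self_sim
begin

text \<open>The rate is fixed by \<open>frostman\<close> and \<open>ft_decay\<close> before any data
  of \<open>g\<close> appear. The sequence \<open>D\<close> stands for \<open>g\<close> and its
  derivatives, which detaches the argument from the way in which they are formed.\<close>

lemma oscillatory_decay:
  assumes ij: "i \<in> I" "j \<in> I" and x: "r i * x + t i = x" and y: "r j * y + t j = y" and "x \<noteq> y"
    and k: "2 \<le> k"
  shows "\<exists>\<tau>>0. \<forall>D c0 G. (\<forall>j<k. \<forall>x\<in>{a..b}. (D j has_real_derivative D (Suc j) x) (at x within {a..b})) \<longrightarrow>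
    continuous_on {a..b} (D k) \<longrightarrow> 0 < c0 \<longrightarrow> (\<forall>x\<in>{a..b}. \<exists>j\<in>{2..k}. c0 \<le> \<bar>D j x\<bar>) \<longrightarrow>
    G \<in> borel_measurable borel \<longrightarrow> (\<forall>x\<in>{a..b}. G x = D 0 x) \<longrightarrow>
    (\<exists>C>0. \<forall>s>0. cmod (LINT x|\<mu>. cis (2 * pi * s * G x)) \<le> C * s powr - \<tau>)"
proof -
  obtain c d where cd: "0 < c" "c \<le> d" "d < 1" "\<And>i. i \<in> I \<Longrightarrow> c \<le> \<bar>r i\<bar> \<and> \<bar>r i\<bar> \<le> d"
    using ratio_bounds by auto
  define L where "L = ln (1 / d)"
  have L: "0 < L" unfolding L_def using cd by simp
  obtain \<beta> CF where \<beta>: "0 < \<beta>" "0 < CF" and frost: "\<And>s \<delta>. 0 < \<delta> \<Longrightarrow> prob {s..s+\<delta>} \<le> CF * \<delta> powr \<beta>"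
    using frostman[OF ij x y \<open>x \<noteq> y\<close>] by blast
  \<comment> \<open>At the covering scale \<open>s powr (- (1 / (3 * k)))\<close> Frostman gives
    concentration \<open>s powr (- (\<beta> / (3 * k)))\<close>, that is, exponent
    \<open>2 * \<beta> / (3 * k)\<close> in \<open>T = s powr (1 / 2)\<close>. Half of it is given
    up to absorb constants and the number of ratios.\<close>
  define \<alpha> where "\<alpha> = \<beta> / (3 * k)"
  have \<alpha>: "0 < \<alpha>" unfolding \<alpha>_def using \<beta> k by simp
  obtain l \<tau>0 C0 where l: "0 < l" and \<tau>0: "0 < \<tau>0" and C0: "0 < C0"
    and decay: "\<forall>T (K::'i list set) v x. 1 \<le> T \<longrightarrow> finite K \<longrightarrow> (\<forall>k\<in>K. 0 \<le> v k) \<longrightarrow>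
      sum v K = 1 \<longrightarrow> (\<forall>k\<in>K. \<bar>x k\<bar> \<le> T) \<longrightarrow> conc_bound l K v x (T powr - \<alpha>) \<longrightarrow>
      (\<Sum>k\<in>K. v k * cmod (ft \<mu> (x k))) \<le> C0 * T powr - \<tau>0"
    using ft_decay[OF ij x y \<open>x \<noteq> y\<close> \<alpha>, where 'k="'i list"] by (elim exE conjE) (rule that)
  \<comment> \<open>Passing from \<open>T = s powr (1 / 2)\<close> to \<open>s\<close> halves
    \<open>\<tau>0\<close>; the linearisation error is of order
    \<open>s powr (- (1 / 3))\<close>.\<close>
  define \<tau> where "\<tau> = min (\<tau>0 / 2) (1 / 3)"
  have \<tau>: "0 < \<tau>" unfolding \<tau>_def using \<tau>0 by simp
  have main: "\<exists>C>0. \<forall>s>0. cmod (LINT x|\<mu>. cis (2 * pi * s * G x)) \<le> C * s powr - \<tau>"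
    if D: "\<forall>j<k. \<forall>x\<in>{a..b}. (D j has_real_derivative D (Suc j) x) (at x within {a..b})"
      and cont: "continuous_on {a..b} (D k)" and "0 < c0"
      and nondeg: "\<forall>x\<in>{a..b}. \<exists>j\<in>{2..k}. c0 \<le> \<bar>D j x\<bar>"
      and G: "G \<in> borel_measurable borel" "\<forall>x\<in>{a..b}. G x = D 0 x" for D c0 G
  proof -
    have contD: "continuous_on {a..b} (D j)" if "j \<le> k" for j
    proof (cases "j = k")
      case False
      with that have "j < k" by simp
      then show ?thesis using D by (intro DERIV_continuous_on[where D="D (Suc j)"]) auto
    qed (use cont in simp)
    have bounded: "\<exists>M\<ge>0. \<forall>x\<in>{a..b}. \<bar>D j x\<bar> \<le> M" if "j \<le> k" for j
    proof -
      have "bounded (D j ` {a..b})"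
        using contD[OF that] by (intro compact_imp_bounded compact_continuous_image) auto
      then obtain M where M: "\<forall>x\<in>{a..b}. \<bar>D j x\<bar> \<le> M" unfolding bounded_iff by auto
      moreover have "\<bar>D j a\<bar> \<le> M" using M ab by auto
      ultimately show ?thesis by (intro exI[of _ M]) auto
    qed
    obtain M1 where M1: "0 \<le> M1" "\<And>x. x \<in> {a..b} \<Longrightarrow> \<bar>D 1 x\<bar> \<le> M1" using bounded[of 1] k by auto
    obtain M where M: "0 \<le> M" "\<And>x. x \<in> {a..b} \<Longrightarrow> \<bar>D 2 x\<bar> \<le> M" using bounded[of 2] k by auto
    have lip: "\<bar>D 1 x - D 1 y\<bar> \<le> M * \<bar>x - y\<bar>" if "x \<in> {a..b}" "y \<in> {a..b}" for x y
    proof -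
      have "norm (D 1 x - D 1 y) \<le> M * norm (x - y)"
      proof (rule field_differentiable_bound[where S="{a..b}" and f'="D 2"])
        show "(D 1 has_real_derivative D 2 z) (at z within {a..b})" if "z \<in> {a..b}" for z
          using D[rule_format, of 1 z] that k by (simp add: numeral_2_eq_2)
      qed (use M that in auto)
      then show ?thesis by simp
    qed
    have g: "(D 0 has_real_derivative D 1 x) (at x within {a..b})" if "x \<in> {a..b}" for x
      using D[rule_format, of 0 x] that k by simp
    have "\<exists>P::nat. \<forall>y \<delta>. 0 < \<delta> \<longrightarrow> \<delta> \<le> 1 \<longrightarrow> (\<exists>F. finite F \<and> card F \<le> P \<and>
      {x\<in>{a..b}. \<bar>D (Suc 0) x - y\<bar> < c0 / 2 * \<delta> ^ (k - 1)} \<subseteq> (\<Union>u\<in>F. {u..u + 2 * \<delta>}))"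
    \<comment> \<open>The sublevel sets are those of \<open>g'\<close>, so the orders
      \<open>2..k\<close> of \<open>g\<close> turn into the orders \<open>1..k-1\<close>.\<close>
    proof (rule sublevel_cover_compact[where D="\<lambda>j. D (Suc j)"])
      show "(D (Suc j) has_real_derivative D (Suc (Suc j)) x) (at x within {a..b})"
        if "j < k - 1" "x \<in> {a..b}" for j x using D that by auto
      show "continuous_on {a..b} (D (Suc (k - 1)))" using cont k by simp
      show "\<exists>j\<in>{1..k-1}. c0 \<le> \<bar>D (Suc j) x\<bar>" if x: "x \<in> {a..b}" for x
      proof -
        obtain j where j: "j \<in> {2..k}" "c0 \<le> \<bar>D j x\<bar>" using nondeg[rule_format, OF x] ..
        then have "Suc (j - 1) = j" "j - 1 \<in> {1..k-1}" by auto
        with j(2) show ?thesis by (intro bexI[of _ "j - 1"]) simp_all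
      qed
    qed (rule \<open>0 < c0\<close>)
    then obtain P :: nat where P: "\<forall>y \<delta>. 0 < \<delta> \<longrightarrow> \<delta> \<le> 1 \<longrightarrow> (\<exists>F. finite F \<and> card F \<le> P \<and>
      {x\<in>{a..b}. \<bar>D (Suc 0) x - y\<bar> < c0 / 2 * \<delta> ^ (k - 1)} \<subseteq> (\<Union>u\<in>F. {u..u + 2 * \<delta>}))" ..
    define A2 where "A2 = l / (2 * pi * c) + M * (b - a)"
    have "card I > 0" using fin I_ne by (simp add: card_gt_0_iff)
    then have "\<forall>\<^sub>F s in at_top. 1 < s \<and> (2 * pi * M1) * s powr (1 / 3) \<le> s powr (1 / 2) \<and>
      A2 * s powr (- (1 / 3)) < (c0 / 2) * (s powr (- (1 / (3 * k)))) ^ (k - 1) \<and>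
      (real (nat \<lceil>ln (s powr (2 / 3)) / L\<rceil>) + 1) ^ card I * ((P * CF) * (2 * s powr (- (1 / (3 * k)))) powr \<beta>)
        \<le> (s powr (1 / 2)) powr - (\<beta> / (3 * k))"
      using L \<beta> k \<open>0 < c0\<close> by (intro eventually_scales) auto
    then obtain s0 where s0: "\<forall>s\<ge>s0. 1 < s \<and> (2 * pi * M1) * s powr (1 / 3) \<le> s powr (1 / 2) \<and>
      A2 * s powr (- (1 / 3)) < (c0 / 2) * (s powr (- (1 / (3 * k)))) ^ (k - 1) \<and>
      (real (nat \<lceil>ln (s powr (2 / 3)) / L\<rceil>) + 1) ^ card I * ((P * CF) * (2 * s powr (- (1 / (3 * k)))) powr \<beta>)
        \<le> (s powr (1 / 2)) powr - (\<beta> / (3 * k))"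
      unfolding eventually_at_top_linorder ..
    define C1 where "C1 = C0 + 2 * pi * M * (b - a)\<^sup>2"
    have C1: "0 < C1" unfolding C1_def using C0 M by (intro add_pos_nonneg) auto
    have large: "cmod (LINT x|\<mu>. cis (2 * pi * s * G x)) \<le> C1 * s powr - \<tau>" if s: "s0 \<le> s" for s
    proof -
      note S = s0[rule_format, OF s]
      define \<rho> where "\<rho> = s powr (- (2 / 3))"
      define \<delta> where "\<delta> = s powr (- (1 / (3 * k)))"
      define T where "T = s powr (1 / 2)"
      define m where "m = nat \<lceil>ln (s powr (2 / 3)) / L\<rceil>"
      define N where "N = 2 * pi * s"
      have s1: "1 < s" using S by simp
      have N: "0 < N" unfolding N_def using s1 by simp
      have \<rho>: "0 < \<rho>" "\<rho> < 1" unfolding \<rho>_def using s1 powr_less_mono[of "- (2 / 3)" 0 s] by auto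
      have \<delta>: "0 < \<delta>" "\<delta> \<le> 1" unfolding \<delta>_def using s1 k powr_mono[of "- (1 / (3 * k))" 0 s] by auto
      have T: "1 \<le> T" unfolding T_def using s1 by (intro ge_one_powr_ge_zero) auto
      have dm: "d ^ m \<le> \<rho>"
      proof -
        have "ln (s powr (2 / 3)) / L \<le> real m" unfolding m_def by linarith
        then have "ln (s powr (2 / 3)) \<le> real m * L" using L by (simp add: divide_le_eq)
        then have "exp (real m * - L) \<le> exp (- ln (s powr (2 / 3)))" by simp
        also have "exp (real m * - L) = d ^ m"
          unfolding exp_of_nat_mult L_def using cd by (simp add: exp_minus)
        also have "exp (- ln (s powr (2 / 3))) = \<rho>"
          unfolding \<rho>_def powr_def using s1 by simp
        finally show ?thesis .
      qed
      obtain K where K: "self_sim \<mu> K (wprod p) (wprod r) (wtrans r t) a b"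
        and Kw: "\<And>w. w \<in> K \<Longrightarrow> set w \<subseteq> I \<and> length w \<le> m \<and> c * \<rho> \<le> \<bar>wprod r w\<bar> \<and> \<bar>wprod r w\<bar> \<le> \<rho>"
        using cut_at_scale[OF \<rho> cd(1) _ dm cd(4)] cd by auto
      interpret W: self_sim \<mu> K "wprod p" "wprod r" "wtrans r t" a b by (rule K)
      let ?\<xi> = "\<lambda>w. N * wprod r w * D 1 (wprod r w * a + wtrans r t w)"
      let ?B = "CF * (2 * \<delta>) powr \<beta>"
      have "conc_bound l K (wprod p) ?\<xi> (card (wprod r ` K) * (P * ?B))"
      proof (rule W.frequency_concentration[OF lip M(1)])
        show "c * \<rho> \<le> \<bar>wprod r w\<bar> \<and> \<bar>wprod r w\<bar> \<le> \<rho>" if "w \<in> K" for w using Kw that by auto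
        show "\<exists>F. finite F \<and> card F \<le> P \<and> {x \<in> {a..b}. \<bar>D 1 x - y\<bar> < c0 / 2 * \<delta> ^ (k - 1)}
            \<subseteq> (\<Union>u\<in>F. {u..u + 2 * \<delta>})" for y
          using P[rule_format, OF \<delta>, of y] by (simp only: One_nat_def)
        show "prob {u..u + 2 * \<delta>} \<le> ?B" for u using \<delta> by (intro frost) simp
        have sr: "s * \<rho> = s powr (1 / 3)"
        proof -
          have "s * \<rho> = s powr (1 + - (2 / 3))" unfolding \<rho>_def powr_add using s1 by simp
          then show ?thesis by simp
        qed
        have "l / (N * (c * \<rho>)) = l / (2 * pi * c) / (s * \<rho>)" unfolding N_def by (simp add: field_simps)
        also have "\<dots> = l / (2 * pi * c) * s powr (- (1 / 3))"
          unfolding sr powr_minus_divide by simp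
        finally have 1: "l / (N * (c * \<rho>)) = l / (2 * pi * c) * s powr (- (1 / 3))" .
        have "\<rho> \<le> s powr (- (1 / 3))" unfolding \<rho>_def using s1 by (intro powr_mono) auto
        then have "M * (\<rho> * (b - a)) \<le> M * (s powr (- (1 / 3)) * (b - a))"
          using M ab by (intro mult_left_mono mult_right_mono) auto
        then have "l / (N * (c * \<rho>)) + M * (\<rho> * (b - a)) \<le> A2 * s powr (- (1 / 3))"
          unfolding 1 A2_def by (simp add: algebra_simps)
        then show "l / (N * (c * \<rho>)) + M * (\<rho> * (b - a)) < c0 / 2 * \<delta> ^ (k - 1)"
          using S unfolding \<delta>_def by linarith
      qed (use cd \<rho> N l in auto)
      moreover have "card (wprod r ` K) * (P * ?B) \<le> T powr - \<alpha>"
      proof -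
        have "card (wprod r ` K) \<le> (m + 1) ^ card I"
          using Kw by (intro card_wprod_le(2)[OF fin]) auto
        then have "real (card (wprod r ` K)) \<le> real ((m + 1) ^ card I)" by (rule of_nat_mono)
        then have "card (wprod r ` K) * (P * ?B) \<le> (real m + 1) ^ card I * (P * ?B)"
          using \<beta> by (intro mult_right_mono) (auto simp: add.commute)
        also have "\<dots> \<le> T powr - \<alpha>"
          using S unfolding m_def \<delta>_def T_def \<alpha>_def by (simp add: mult.assoc)
        finally show ?thesis .
      qed
      ultimately have conc: "conc_bound l K (wprod p) ?\<xi> (T powr - \<alpha>)"
        unfolding conc_bound_def by (meson order_trans)
      have "\<forall>w\<in>K. \<bar>?\<xi> w\<bar> \<le> T"
      proof
        fix w assume w: "w \<in> K"
        have "\<bar>D 1 (wprod r w * a + wtrans r t w)\<bar> \<le> M1" using ab by (intro M1 W.inv[OF w]) auto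
        then have "\<bar>?\<xi> w\<bar> \<le> N * \<rho> * M1"
          using Kw[OF w] N M1(1) \<rho> unfolding abs_mult by (intro mult_mono) auto
        also have "\<dots> = (2 * pi * M1) * (s powr 1 * s powr (- (2 / 3)))"
          unfolding N_def \<rho>_def using s1 by simp
        also have "s powr 1 * s powr (- (2 / 3)) = s powr (1 / 3)" unfolding powr_add[symmetric] by simp
        also have "(2 * pi * M1) * s powr (1 / 3) \<le> T" using S unfolding T_def by simp
        finally show "\<bar>?\<xi> w\<bar> \<le> T" .
      qed
      then have "(\<Sum>w\<in>K. wprod p w * cmod (ft \<mu> (?\<xi> w))) \<le> C0 * T powr - \<tau>0"
        using T W.fin W.p_sum conc W.p_pos
        by (intro decay[rule_format, OF T W.fin _ W.p_sum _ conc]) (auto intro: less_imp_le)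
      moreover have "cmod (LINT x|\<mu>. cis (N * G x))
          \<le> (\<Sum>w\<in>K. wprod p w * cmod (ft \<mu> (?\<xi> w))) + N * M * (\<rho> * (b - a))\<^sup>2"
      proof (rule W.linearized_bound[where g="D 0", OF g lip M(1)])
        show "\<bar>wprod r w\<bar> \<le> \<rho>" if "w \<in> K" for w using Kw[OF that] by simp
      qed (use N G in auto)
      ultimately have "cmod (LINT x|\<mu>. cis (N * G x)) \<le> C0 * T powr - \<tau>0 + N * M * (\<rho> * (b - a))\<^sup>2"
        by linarith
      also have "C0 * T powr - \<tau>0 \<le> C0 * s powr - \<tau>"
      proof -
        have "T powr - \<tau>0 = s powr (- (\<tau>0 / 2))" unfolding T_def by (simp add: powr_powr)
        also have "\<dots> \<le> s powr - \<tau>" unfolding \<tau>_def using s1 by (intro powr_mono) auto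
        finally show ?thesis using C0 by simp
      qed
      also have "N * M * (\<rho> * (b - a))\<^sup>2 \<le> 2 * pi * M * (b - a)\<^sup>2 * s powr - \<tau>"
      proof -
        have "N * M * (\<rho> * (b - a))\<^sup>2 = 2 * pi * M * (b - a)\<^sup>2 * (s powr 1 * (s powr (- (2 / 3)) * s powr (- (2 / 3))))"
          unfolding N_def \<rho>_def using s1 by (simp add: power2_eq_square)
        also have "s powr 1 * (s powr (- (2 / 3)) * s powr (- (2 / 3))) = s powr (- (1 / 3))"
          unfolding powr_add[symmetric] by simp
        also have "\<dots> \<le> s powr - \<tau>" unfolding \<tau>_def using s1 by (intro powr_mono) auto
        finally show ?thesis using M by (simp add: mult_left_mono)
      qed
      finally show ?thesis unfolding C1_def N_def by (simp add: algebra_simps)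
    qed
    \<comment> \<open>Below the threshold \<open>s0\<close> the trivial bound 1 is enough. The
      threshold depends on \<open>g\<close>, the exponent does not.\<close>
    define C where "C = C1 + (max 1 s0) powr \<tau>"
    have C: "0 < C" unfolding C_def using C1 by (intro add_pos_nonneg) auto
    have "cmod (LINT x|\<mu>. cis (2 * pi * s * G x)) \<le> C * s powr - \<tau>" if s: "0 < s" for s
    proof (cases "s0 \<le> s")
      case True
      have "C1 * s powr - \<tau> \<le> C * s powr - \<tau>" unfolding C_def by (intro mult_right_mono) auto
      with large[OF True] show ?thesis by linarith
    next
      case False
      have "cmod (LINT x|\<mu>. cis (2 * pi * s * G x)) \<le> (LINT x|\<mu>. cmod (cis (2 * pi * s * G x)))"
        by (rule integral_norm_bound)
      also have "\<dots> = 1" using prob_space[unfolded space_mu] by simp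
      also have "1 = s powr \<tau> * s powr - \<tau>" using s by (simp flip: powr_add)
      also have "\<dots> \<le> C * s powr - \<tau>"
      proof (rule mult_right_mono)
        have "s powr \<tau> \<le> (max 1 s0) powr \<tau>" using s False \<tau> by (intro powr_mono2) auto
        then show "s powr \<tau> \<le> C" unfolding C_def using C1 by simp
      qed simp
      finally show ?thesis .
    qed
    with C show ?thesis by blast
  qed
  show ?thesis
  proof (rule exI[of _ \<tau>], rule conjI[OF \<tau>], intro allI impI)
    fix D c0 G
    assume "\<forall>j<k. \<forall>x\<in>{a..b}. (D j has_real_derivative D (Suc j) x) (at x within {a..b})"
      "continuous_on {a..b} (D k)" "0 < c0" "\<forall>x\<in>{a..b}. \<exists>j\<in>{2..k}. c0 \<le> \<bar>D j x\<bar>"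
      "G \<in> borel_measurable borel" "\<forall>x\<in>{a..b}. G x = D 0 x"
    then show "\<exists>C>0. \<forall>s>0. cmod (LINT x|\<mu>. cis (2 * pi * s * G x)) \<le> C * s powr - \<tau>"
      by (rule main)
  qed
qed

end

section \<open>The convex hull of the support\<close>

text \<open>The supremum of the almost sure lower bounds is itself one, by a countable limit, and
  its maximality gives mass just above it. Applied to the identity and to its negative, this yields
  the two ends of the support.\<close>

lemma (in prob_space) essential_infimum:
  fixes X :: "'a \<Rightarrow> real"
  assumes [measurable]: "X \<in> borel_measurable M" and bnd: "AE x in M. A \<le> X x \<and> X x \<le> B"
  shows "\<exists>a. (AE x in M. a \<le> X x) \<and> (\<forall>e>0. 0 < prob {x\<in>space M. X x < a + e})"
proof -
  define Z where "Z = {z. AE x in M. z \<le> X x}"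
  have "A \<in> Z" unfolding Z_def using bnd by auto
  have Z_le: "z \<le> B" if "z \<in> Z" for z
  proof -
    have "AE x in M. z \<le> X x" using that unfolding Z_def by simp
    with bnd have "AE x in M. z \<le> B" by eventually_elim auto
    then show ?thesis by simp
  qed
  then have bdd: "bdd_above Z" by (intro bdd_aboveI) auto
  define a where "a = Sup Z"
  have down: "AE x in M. z \<le> X x" if z: "z < a" for z
  proof -
    obtain z' where "z' \<in> Z" "z < z'"
      using z less_cSup_iff[of Z z] \<open>A \<in> Z\<close> bdd unfolding a_def by blast
    then show ?thesis unfolding Z_def by auto
  qed
  have "AE x in M. \<forall>n::nat. a - 1 / (n + 1) \<le> X x"
    unfolding AE_all_countable by (intro allI down) simp
  then have 1: "AE x in M. a \<le> X x"
  proof eventually_elim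
    case (elim x)
    show ?case
    proof (rule field_le_epsilon)
      fix e :: real assume "0 < e"
      then obtain n where "1 / (real n + 1) < e" using nat_approx_posE[of e] by (auto simp: add.commute)
      with elim show "a \<le> X x + e" by (smt (verit))
    qed
  qed
  have 2: "0 < prob {x\<in>space M. X x < a + e}" if e: "0 < e" for e
  proof (rule ccontr)
    assume "\<not> ?thesis"
    then have "prob {x\<in>space M. X x < a + e} = 0" using measure_nonneg[of M] by (simp add: not_less order_antisym)
    then have "AE x in M. x \<notin> {x\<in>space M. X x < a + e}" by (subst (asm) prob_eq_0) auto
    then have "AE x in M. a + e \<le> X x" by (rule AE_mp) (auto intro!: AE_I2)
    then have "a + e \<in> Z" unfolding Z_def by simp
    then have "a + e \<le> a" unfolding a_def using bdd by (rule cSup_upper)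
    with e show False by simp
  qed
  from 1 2 show ?thesis by blast
qed

lemma stationary_prob:
  assumes ss: "self_similar_measure_of n r t p \<mu>" and A: "A \<in> sets borel"
  shows "measure \<mu> A = (\<Sum>i<n. p i * measure \<mu> {x. r i * x + t i \<in> A})"
proof -
  have sets: "sets \<mu> = sets borel" using ss unfolding self_similar_measure_of_def by simp
  then have sp: "space \<mu> = UNIV" using sets_eq_imp_space_eq[of \<mu> borel] by simp
  have f: "sim_map (r i) (t i) \<in> measurable \<mu> borel" for i
    unfolding sim_map_def measurable_cong_sets[OF sets refl] by simp
  have "measure (distr \<mu> borel (sim_map (r i) (t i))) A = measure \<mu> {x. r i * x + t i \<in> A}" for i
    using A f by (simp add: measure_distr sp vimage_def sim_map_def)
  then show ?thesis using ss A unfolding self_similar_measure_of_def by simp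
qed

text \<open>The distance to the invariant interval is contracted by every map, so by stationarity the
  mass outside a neighbourhood is bounded by the mass arbitrarily far out.\<close>
lemma self_similar_concentrated:
  assumes ss: "self_similar_measure_of n r t p \<mu>" and p: "positive_prob_vector n p"
    and r: "\<And>i. i < n \<Longrightarrow> \<bar>r i\<bar> \<le> d" "0 < d" "d < 1" and "A \<le> B"
    and inv: "\<And>i x. i < n \<Longrightarrow> x \<in> {A..B} \<Longrightarrow> r i * x + t i \<in> {A..B}"
  shows "AE x in \<mu>. x \<in> {A..B}"
proof -
  have sets: "sets \<mu> = sets borel" using ss unfolding self_similar_measure_of_def by simp
  interpret prob_space \<mu> using ss unfolding self_similar_measure_of_def by simp
  have sp: "space \<mu> = UNIV" using sets_eq_imp_space_eq[OF sets] by simp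
  define h where "h x = \<bar>x - max A (min B x)\<bar>" for x
  have [measurable]: "h \<in> borel_measurable borel" unfolding h_def by measurable
  have ev: "{x. e < h x} \<in> events" for e unfolding sets by measurable
  have h_le: "h x \<le> \<bar>x - z\<bar>" if "z \<in> {A..B}" for x z using that unfolding h_def by auto
  have contract: "h (r i * x + t i) \<le> d * h x" if i: "i < n" for i x
  proof -
    define z where "z = max A (min B x)"
    have "z \<in> {A..B}" unfolding z_def using \<open>A \<le> B\<close> by auto
    then have "h (r i * x + t i) \<le> \<bar>(r i * x + t i) - (r i * z + t i)\<bar>" by (intro h_le inv i)
    also have "(r i * x + t i) - (r i * z + t i) = r i * (x - z)" by (simp add: algebra_simps)
    also have "\<bar>r i * (x - z)\<bar> = \<bar>r i\<bar> * h x" unfolding h_def z_def by (simp add: abs_mult)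
    also have "\<dots> \<le> d * h x" using r(1)[OF i] by (intro mult_right_mono) (auto simp: h_def)
    finally show ?thesis .
  qed
  have step: "prob {x. e < h x} \<le> prob {x. e / d < h x}" for e
  proof -
    have "prob {x. e < h x} = (\<Sum>i<n. p i * prob {x. r i * x + t i \<in> {x. e < h x}})"
      using ev[of e] sets by (intro stationary_prob[OF ss]) simp
    also have "\<dots> \<le> (\<Sum>i<n. p i * prob {x. e / d < h x})"
    proof (intro sum_mono mult_left_mono finite_measure_mono)
      fix i assume i: "i \<in> {..<n}"
      show "{x. r i * x + t i \<in> {x. e < h x}} \<subseteq> {x. e / d < h x}"
        using contract[of i] i r(2) by (auto simp: divide_less_eq mult.commute intro: less_le_trans)
      show "0 \<le> p i" using p i unfolding positive_prob_vector_def by (auto intro: less_imp_le)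
    qed (rule ev)
    also have "\<dots> = prob {x. e / d < h x}"
      using p unfolding positive_prob_vector_def by (simp flip: sum_distrib_right)
    finally show ?thesis .
  qed
  have iter: "prob {x. e < h x} \<le> prob {x. e / d ^ m < h x}" for e m
  proof (induction m)
    case (Suc m)
    also have "prob {x. e / d ^ m < h x} \<le> prob {x. e / d ^ m / d < h x}" by (rule step)
    finally show ?case by (simp add: mult.commute)
  qed simp
  have zero: "prob {x. e < h x} = 0" if e: "0 < e" for e
  proof -
    let ?A = "\<lambda>m. {x. e / d ^ m < h x}"
    have "decseq ?A"
    proof (rule decseq_SucI)
      fix m
      have "e / d ^ m \<le> e / d ^ Suc m"
        using r e by (intro divide_left_mono mult_pos_pos zero_less_power power_decreasing) auto
      then show "?A (Suc m) \<subseteq> ?A m" by auto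
    qed
    then have "(\<lambda>m. prob (?A m)) \<longlonglongrightarrow> prob (\<Inter>m. ?A m)"
      using ev by (intro finite_Lim_measure_decseq) auto
    moreover have "(\<Inter>m. ?A m) = {}"
    proof -
      have "x \<notin> (\<Inter>m. ?A m)" for x
      proof
        assume "x \<in> (\<Inter>m. ?A m)"
        then have *: "e / d ^ m < h x" for m by simp
        then have "0 < h x" using e *[of 0] by simp
        then obtain m where "d ^ m < e / h x" using real_arch_pow_inv[of "e / h x" d] r e by auto
        then have "h x < e / d ^ m" using \<open>0 < h x\<close> r by (simp add: field_simps)
        with *[of m] show False by simp
      qed
      then show ?thesis by blast
    qed
    ultimately have "(\<lambda>m. prob (?A m)) \<longlonglongrightarrow> 0" by simp
    then have "prob {x. e < h x} \<le> 0" using iter by (intro LIMSEQ_le_const) auto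
    then show ?thesis by (simp add: order_antisym)
  qed
  have "AE x in \<mu>. \<not> (1 / (real m + 1) < h x)" for m
  proof -
    have "AE x in \<mu>. x \<notin> {x. 1 / (real m + 1) < h x}"
      using zero[of "1 / (real m + 1)"] ev by (subst prob_eq_0[symmetric]) auto
    then show ?thesis by simp
  qed
  then have "AE x in \<mu>. \<forall>m. \<not> (1 / (real m + 1) < h x)" unfolding AE_all_countable by blast
  then show ?thesis
  proof eventually_elim
    case (elim x)
    have "\<not> 0 < h x"
    proof
      assume "0 < h x"
      then obtain m where "1 / (real m + 1) < h x" using nat_approx_posE[of "h x"] by (auto simp: add.commute)
      with elim show False by blast
    qed
    then show ?case using \<open>A \<le> B\<close> unfolding h_def by (auto split: if_splits simp: max_def min_def)
  qed
qed

text \<open>The invariant interval supplied with the maps may leave \<open>J\<close>; an interval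
  with both ends in the support cannot. Stationarity shows that the maps send support points into
  the hull, and affine maps then send the hull into itself.\<close>

lemma self_similar_measure_hull:
  assumes "self_similar_measure \<mu>" and na: "non_atomic \<mu>"
  shows "\<exists>n r t p a b i j x y. self_sim \<mu> {..<n::nat} p r t a b \<and> a \<in> msupport \<mu> \<and> b \<in> msupport \<mu> \<and>
    i < n \<and> j < n \<and> r i * x + t i = x \<and> r j * y + t j = y \<and> x \<noteq> y"
proof -
  obtain n r t p where ifs: "self_similar_IFS n r t" and p: "positive_prob_vector n p"
    and ss: "self_similar_measure_of n r t p \<mu>"
    using assms(1) unfolding self_similar_measure_def by blast
  have sets: "sets \<mu> = sets borel" using ss unfolding self_similar_measure_of_def by simp
  interpret prob_space \<mu> using ss unfolding self_similar_measure_of_def by simp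
  have sp: "space \<mu> = UNIV" using sets_eq_imp_space_eq[OF sets] by simp
  have r: "r i \<noteq> 0" "\<bar>r i\<bar> < 1" if "i < n" for i
    using ifs that unfolding self_similar_IFS_def by auto
  have pp: "0 < p i" if "i < n" for i using p that unfolding positive_prob_vector_def by auto
  obtain i j x y where ij: "i < n" "j < n" "r i * x + t i = x" "r j * y + t j = y" "x \<noteq> y"
    using ifs unfolding self_similar_IFS_def sim_map_def by blast
  obtain A B where AB: "A \<le> B" "\<And>i x. i < n \<Longrightarrow> x \<in> {A..B} \<Longrightarrow> r i * x + t i \<in> {A..B}"
    using ifs unfolding self_similar_IFS_def sim_map_def image_subset_iff by blast
  define d where "d = Max ((\<lambda>i. \<bar>r i\<bar>) ` {..<n})"
  have d: "\<bar>r i\<bar> \<le> d" if "i < n" for i unfolding d_def using that by (intro Max_ge) auto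
  have d1: "d < 1" unfolding d_def using r ij(1) by (subst Max_less_iff) auto
  have d0: "0 < d" using d[OF ij(1)] r(1)[OF ij(1)] by linarith
  have AE_AB: "AE x in \<mu>. x \<in> {A..B}"
    using d d0 d1 AB by (intro self_similar_concentrated[OF ss p]) auto
  have meas: "(\<lambda>x. x) \<in> borel_measurable \<mu>" "(\<lambda>x. - x) \<in> borel_measurable \<mu>"
    unfolding measurable_cong_sets[OF sets refl] by simp_all
  have "AE x in \<mu>. A \<le> x \<and> x \<le> B" "AE x in \<mu>. - B \<le> - x \<and> - x \<le> - A"
    using AE_AB by (eventually_elim, simp)+
  note inf = essential_infimum[OF meas(1) this(1)] essential_infimum[OF meas(2) this(2)]
  obtain a where a: "AE x in \<mu>. a \<le> x" "\<forall>e>0. 0 < prob {x. x < a + e}"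
    using inf(1) unfolding sp by (elim exE conjE) (rule that, simp_all)
  obtain b' where b': "AE x in \<mu>. b' \<le> - x" "\<forall>e>0. 0 < prob {x. - x < b' + e}"
    using inf(2) unfolding sp by (elim exE conjE) (rule that, simp_all)
  define b where "b = - b'"
  have b: "AE x in \<mu>. x \<le> b" "\<And>e. 0 < e \<Longrightarrow> 0 < prob {x. b - e < x}"
  proof -
    show "AE x in \<mu>. x \<le> b" using b'(1) by eventually_elim (simp add: b_def)
    show "0 < prob {x. b - e < x}" if "0 < e" for e
    proof -
      have "{x. - x < b' + e} = {x. b - e < x}" unfolding b_def by auto
      with b'(2)[rule_format, OF that] show ?thesis by simp
    qed
  qed
  have conc: "AE x in \<mu>. x \<in> {a..b}" using a(1) b(1) by eventually_elim auto
  have supp_a: "a \<in> msupport \<mu>"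
    unfolding msupport_def
  proof (intro CollectI allI impI)
    fix e :: real assume e: "0 < e"
    have "prob {x. x < a + e} \<le> prob (ball a e)"
    proof (rule finite_measure_mono_AE)
      show "AE x in \<mu>. x \<in> {x. x < a + e} \<longrightarrow> x \<in> ball a e"
        using a(1) by eventually_elim (auto simp: dist_real_def)
    qed (simp add: sets)
    with a(2)[rule_format, OF e] show "0 < prob (ball a e)" by linarith
  qed
  have supp_b: "b \<in> msupport \<mu>"
    unfolding msupport_def
  proof (intro CollectI allI impI)
    fix e :: real assume e: "0 < e"
    have "prob {x. b - e < x} \<le> prob (ball b e)"
    proof (rule finite_measure_mono_AE)
      show "AE x in \<mu>. x \<in> {x. b - e < x} \<longrightarrow> x \<in> ball b e"
        using b(1) by eventually_elim (auto simp: dist_real_def)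
    qed (simp add: sets)
    with b(2)[OF e] show "0 < prob (ball b e)" by linarith
  qed
  \<comment> \<open>Otherwise all mass would sit in one point.\<close>
  have ab: "a < b"
  proof (rule ccontr)
    assume le: "\<not> a < b"
    have "AE x in \<mu>. x \<in> {a}" using conc by eventually_elim (use le in auto)
    then have "prob {a} = 1" using sets by (subst prob_eq_1) auto
    with na show False unfolding non_atomic_def by simp
  qed
  \<comment> \<open>If a support point left \<open>{a..b}\<close>, so would a ball around it, and
    stationarity with \<open>p i > 0\<close> would give positive mass outside
    \<open>{a..b}\<close>.\<close>
  have ends: "r i * z + t i \<in> {a..b}" if i: "i < n" and z: "z \<in> msupport \<mu>" for i z
  proof (rule ccontr)
    assume out: "r i * z + t i \<notin> {a..b}"
    have "prob (- {a..b}) = 0"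
    proof -
      have "AE x in \<mu>. x \<notin> - {a..b}" using conc by eventually_elim auto
      then show ?thesis using sets by (subst prob_eq_0) auto
    qed
    then have "(\<Sum>i<n. p i * prob {x. r i * x + t i \<in> - {a..b}}) = 0"
      using stationary_prob[OF ss, of "- {a..b}"] by simp
    then have "p i * prob {x. r i * x + t i \<in> - {a..b}} = 0"
    proof (subst (asm) sum_nonneg_eq_0_iff)
      show "0 \<le> p j * prob {x. r j * x + t j \<in> - {a..b}}" if "j \<in> {..<n}" for j
        using pp[of j] that by (intro mult_nonneg_nonneg) auto
    qed (use i in auto)
    then have 0: "prob {x. r i * x + t i \<in> - {a..b}} = 0" using pp[OF i] by simp
    have "open ((\<lambda>x. r i * x + t i) -` (- {a..b}))"
      by (intro open_vimage continuous_intros)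
    moreover have "z \<in> (\<lambda>x. r i * x + t i) -` (- {a..b})" using out by simp
    ultimately obtain e where e: "0 < e" "ball z e \<subseteq> (\<lambda>x. r i * x + t i) -` (- {a..b})"
      by (meson open_contains_ball)
    have "prob (ball z e) \<le> prob {x. r i * x + t i \<in> - {a..b}}"
    proof (rule finite_measure_mono)
      show "ball z e \<subseteq> {x. r i * x + t i \<in> - {a..b}}" using e(2) by auto
      show "{x. r i * x + t i \<in> - {a..b}} \<in> events" unfolding sets by measurable
    qed
    with 0 z e(1) show False unfolding msupport_def by (auto simp: not_le)
  qed
  have "self_sim \<mu> {..<n} p r t a b"
  proof
    show "sum p {..<n} = 1" using p unfolding positive_prob_vector_def by simp
    show "r i * x + t i \<in> {a..b}" if i: "i \<in> {..<n}" and x: "x \<in> {a..b}" for i x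
    proof -
      have e: "r i * a + t i \<in> {a..b}" "r i * b + t i \<in> {a..b}" using i ends supp_a supp_b by auto
      show ?thesis
      proof (cases "0 \<le> r i")
        case True
        then have "r i * a \<le> r i * x" "r i * x \<le> r i * b" using x by (auto intro: mult_left_mono)
        with e show ?thesis by auto
      next
        case False
        then have "r i * x \<le> r i * a" "r i * b \<le> r i * x" using x by (auto intro: mult_left_mono_neg)
        with e show ?thesis by auto
      qed
    qed
  next
    fix F :: "real \<Rightarrow> complex" and B :: real assume F: "F \<in> borel_measurable borel" "\<And>x. cmod (F x) \<le> B"
    have "(LINT x|\<mu>. F x) = (\<Sum>i<n. of_real (p i) * (LINT x|\<mu>. F (sim_map (r i) (t i) x)))"
    proof (rule stationary_integral[OF _ _ prob_space_axioms sets _ _ _ F])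
      show "sum p {..<n} = 1" using p unfolding positive_prob_vector_def by simp
      show "sim_map (r i) (t i) \<in> borel_measurable borel" for i unfolding sim_map_def by simp
      show "prob A = (\<Sum>i<n. p i * measure (distr \<mu> borel (sim_map (r i) (t i))) A)"
        if "A \<in> sets borel" for A using ss that unfolding self_similar_measure_of_def by blast
    qed (use pp in \<open>auto intro: less_imp_le\<close>)
    then show "(LINT x|\<mu>. F x) = (\<Sum>i<n. of_real (p i) * (LINT x|\<mu>. F (r i * x + t i)))"
      unfolding sim_map_def .
  qed (use r pp ab conc sets in auto)
  with supp_a supp_b ij show ?thesis by blast
qed

section \<open>From integrals over \<open>J\<close> to the hull of the support\<close>

theorem theorem1p1:
  fixes \<mu> :: "real measure" and k :: nat
  assumes "self_similar_measure \<mu>" and "non_atomic \<mu>" and "k \<ge> 2"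
  shows "\<exists>\<tau>::real. \<tau> > 0 \<and>
    (\<forall>(J::real set) (g::real \<Rightarrow> real).
       is_interval J \<longrightarrow> msupport \<mu> \<subseteq> J \<longrightarrow> C_k_on k J g \<longrightarrow>
       (\<exists>c0>0. \<forall>x\<in>J. Max ((\<lambda>j. \<bar>nth_deriv_within J j g x\<bar>) ` {2..k}) \<ge> c0) \<longrightarrow>
       (\<exists>C::real. C > 0 \<and> (\<forall>s::real. s > 0 \<longrightarrow>
          cmod (LINT x:J|\<mu>. exp (2 * of_real pi * \<i> * of_real (g x) * of_real s))
            \<le> C * s powr (- \<tau>))))"
proof -
  obtain n r t p a b i j x y where ssm: "self_sim \<mu> {..<n::nat} p r t a b"
    and supp: "a \<in> msupport \<mu>" "b \<in> msupport \<mu>"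
    and ij: "i < n" "j < n" "r i * x + t i = x" "r j * y + t j = y" "x \<noteq> y"
    using self_similar_measure_hull[OF assms(1,2)] by (elim exE conjE) (rule that)
  interpret self_sim \<mu> "{..<n}" p r t a b by (rule ssm)
  obtain \<tau> where \<tau>: "0 < \<tau>" and decay: "\<forall>D c0 G.
    (\<forall>j<k. \<forall>x\<in>{a..b}. (D j has_real_derivative D (Suc j) x) (at x within {a..b})) \<longrightarrow>
    continuous_on {a..b} (D k) \<longrightarrow> 0 < c0 \<longrightarrow> (\<forall>x\<in>{a..b}. \<exists>j\<in>{2..k}. c0 \<le> \<bar>D j x\<bar>) \<longrightarrow>
    G \<in> borel_measurable borel \<longrightarrow> (\<forall>x\<in>{a..b}. G x = D 0 x) \<longrightarrow>
    (\<exists>C>0. \<forall>s>0. cmod (LINT x|\<mu>. cis (2 * pi * s * G x)) \<le> C * s powr - \<tau>)"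
    using oscillatory_decay[of i j x y k] ij assms(3) by auto
  show ?thesis
  proof (rule exI[of _ \<tau>], rule conjI[OF \<tau>], intro allI impI)
    fix J :: "real set" and g :: "real \<Rightarrow> real"
    assume J: "is_interval J" and sJ: "msupport \<mu> \<subseteq> J" and Ck: "C_k_on k J g"
      and "\<exists>c0>0. \<forall>x\<in>J. Max ((\<lambda>j. \<bar>nth_deriv_within J j g x\<bar>) ` {2..k}) \<ge> c0"
    then obtain c0 where c0: "0 < c0" "\<And>x. x \<in> J \<Longrightarrow> Max ((\<lambda>j. \<bar>nth_deriv_within J j g x\<bar>) ` {2..k}) \<ge> c0"
      by blast
    have abJ: "{a..b} \<subseteq> J"
      using J supp sJ unfolding is_interval_1 by (meson atLeastAtMost_iff subsetI subset_iff)
    define D where "D j = nth_deriv_within J j g" for j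
    \<comment> \<open>Clamping to \<open>{a..b}\<close> extends the restriction of \<open>g\<close>
      to a continuous, hence Borel, function on the whole line.\<close>
    define G where "G x = g (max a (min b x))" for x
    have contg: "continuous_on J g"
    proof (rule differentiable_imp_continuous_on)
      have "nth_deriv_within J 0 g differentiable_on J"
        using Ck assms(3) unfolding C_k_on_def by (elim conjE) (drule spec[of _ 0], simp)
      then show "g differentiable_on J" by simp
    qed
    have "\<exists>C>0. \<forall>s>0. cmod (LINT x|\<mu>. cis (2 * pi * s * G x)) \<le> C * s powr - \<tau>"
    proof (rule decay[rule_format, of D c0 G])
      fix j x assume j: "j < k" and x: "x \<in> {a..b}"
      have "D j differentiable_on J" using Ck j unfolding C_k_on_def D_def by blast
      then have "D j differentiable (at x within J)" using x abJ unfolding differentiable_on_def by blast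
      then have "(D j has_vector_derivative D (Suc j) x) (at x within J)"
        unfolding D_def by (simp add: vector_derivative_works)
      then show "(D j has_real_derivative D (Suc j) x) (at x within {a..b})"
        unfolding has_real_derivative_iff_has_vector_derivative
        using abJ by (rule has_vector_derivative_within_subset)
    next
      show "continuous_on {a..b} (D k)"
        using Ck abJ unfolding C_k_on_def D_def by (blast intro: continuous_on_subset)
    next
      fix x assume "x \<in> {a..b}"
      then have "c0 \<le> Max ((\<lambda>j. \<bar>D j x\<bar>) ` {2..k})" using c0(2) abJ unfolding D_def by blast
      moreover have "Max ((\<lambda>j. \<bar>D j x\<bar>) ` {2..k}) \<in> (\<lambda>j. \<bar>D j x\<bar>) ` {2..k}"
        using assms(3) by (intro Max_in) auto
      ultimately show "\<exists>j\<in>{2..k}. c0 \<le> \<bar>D j x\<bar>" by auto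
    next
      have "continuous_on UNIV G"
        unfolding G_def using ab abJ
        by (intro continuous_on_compose2[OF contg]) (auto intro!: continuous_intros)
      then show "G \<in> borel_measurable borel" by (rule borel_measurable_continuous_onI)
    qed (use c0 in \<open>auto simp: G_def D_def\<close>)
    moreover have "(LINT x:J|\<mu>. exp (2 * of_real pi * \<i> * of_real (g x) * of_real s))
        = (LINT x|\<mu>. cis (2 * pi * s * G x))" for s
    proof -
      have "(\<lambda>x. indicator J x *\<^sub>R exp (2 * of_real pi * \<i> * of_real (g x) * of_real s)) \<in> borel_measurable borel"
        using contg by (intro borel_measurable_continuous_on_indicator real_interval_borel_measurable J)
          (auto intro!: continuous_intros)
      moreover have "continuous_on UNIV (\<lambda>x. cis (2 * pi * s * G x))"
        unfolding G_def using ab abJ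
        by (intro continuous_intros continuous_on_compose2[OF contg]) auto
      then have "(\<lambda>x. cis (2 * pi * s * G x)) \<in> borel_measurable borel"
        by (rule borel_measurable_continuous_onI)
      \<comment> \<open>Almost every point lies in \<open>{a..b}\<close>, which is inside
        \<open>J\<close> and where clamping does nothing; the indicator of \<open>J\<close> is 1
        there.\<close>
      moreover have "AE x in \<mu>. indicator J x *\<^sub>R exp (2 * of_real pi * \<i> * of_real (g x) * of_real s)
          = cis (2 * pi * s * G x)"
        using conc
      proof eventually_elim
        case (elim x)
        then have "G x = g x" "x \<in> J" unfolding G_def using abJ by auto
        then show ?case by (simp add: cis_conv_exp mult_ac)
      qed
      ultimately show ?thesis
        unfolding set_lebesgue_integral_def by (intro integral_cong_AE borel_measurable_mu)
    qed
    ultimately show "\<exists>C::real. C > 0 \<and> (\<forall>s::real. s > 0 \<longrightarrow>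
          cmod (LINT x:J|\<mu>. exp (2 * of_real pi * \<i> * of_real (g x) * of_real s)) \<le> C * s powr (- \<tau>))"
      by simp
  qed
qed

end
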